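(* For all non-empty compact convex sets $L_1,\dots,L_n$ and $K$ in $\mathbb{R}^n$, $$V(L_1,\dots,L_{n})\,V_n(K)\leq n\,V(L_1,K[n-1])\,V(L_2,\dots,L_{n},K).$$ Moreover, the constant $n$ on the right-hand side cannot be improved, i.e. replaced by any smaller constant, neither in the class of compact convex sets nor in the class of convex bodies.
   Context: A convex body in $\mathbb{R}^n$ is a convex compact set with non-empty interior. $V_n$ denotes $n$-dimensional Euclidean volume. $V(K_1,\dots,K_n)$ denotes the ($n$-dimensional) mixed volume of compact convex sets, i.e. the symmetric function, multilinear with respect to Minkowski addition and non-negative scaling, satisfying $V_n(\lambda_1K_1+\dots+\lambda_nK_n)=\sum_{i_1,\dots,i_n=1}^n\lambda_{i_1}\cdots\lambda_{i_n}V(K_{i_1},\dots,K_{i_n})$ for $\lambda_i\ge 0$; in particular $V(K,\dots,K)=V_n(K)$. The notation $K[m]$ means that $K$ is repeated $m$ times. *)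

theory Defs
  imports "HOL-Analysis.Analysis"
begin

text \<open>
  Families of sets are lists. \<open>+\<close> and \<open>\<Sum>\<close> on sets are Minkowski addition
  (theory \<open>Set_Algebras\<close>), and \<open>(*\<^sub>R) c ` K\<close> is the dilate \<open>c K\<close>.
\<close>

definition compact_convex_sets :: "'a::euclidean_space set set" where
  "compact_convex_sets = {K. K \<noteq> {} \<and> compact K \<and> convex K}"

definition convex_bodies :: "'a::euclidean_space set set" where
  "convex_bodies = {K. compact K \<and> convex K \<and> interior K \<noteq> {}}"

definition is_mixed_volume :: "((real ^ 'n::finite) set list \<Rightarrow> real) \<Rightarrow> bool" where
  "is_mixed_volume V \<longleftrightarrow>
     (\<forall>Ks Ls. length Ks = CARD('n) \<and> set Ks \<subseteq> compact_convex_sets \<and> mset Ls = mset Ks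
        \<longrightarrow> V Ls = V Ks) \<and>
     (\<forall>Ks i K L a b. length Ks = CARD('n) \<and> set Ks \<subseteq> compact_convex_sets \<and> i < CARD('n) \<and>
        K \<in> compact_convex_sets \<and> L \<in> compact_convex_sets \<and> 0 \<le> a \<and> 0 \<le> b
        \<longrightarrow> V (Ks[i := (*\<^sub>R) a ` K + (*\<^sub>R) b ` L]) = a * V (Ks[i := K]) + b * V (Ks[i := L])) \<and>
     (\<forall>Ks c. length Ks = CARD('n) \<and> set Ks \<subseteq> compact_convex_sets \<and> (\<forall>i<CARD('n). 0 \<le> c i)
        \<longrightarrow> measure lebesgue (\<Sum>i<CARD('n). (*\<^sub>R) (c i) ` (Ks ! i)) =
            (\<Sum>is | length is = CARD('n) \<and> set is \<subseteq> {..<CARD('n)}.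
               prod_list (map c is) * V (map ((!) Ks) is)))"

text \<open>
  The values on lists of \<open>CARD('n)\<close> non-empty compact convex sets do not depend on the
  choice, by \<open>is_mixed_volume_unique\<close> below; on all other lists they are irrelevant.
\<close>

definition mixed_volume :: "(real ^ 'n::finite) set list \<Rightarrow> real" where
  "mixed_volume = (SOME V. is_mixed_volume V)"

lemma is_mixed_volume_unique:
  fixes Ks :: "(real ^ 'n::finite) set list"
  assumes V: "is_mixed_volume V" and W: "is_mixed_volume W"
    and len: "length Ks = CARD('n)" and sub: "set Ks \<subseteq> compact_convex_sets"
  shows "V Ks = W Ks"
proof -
  let ?n = "CARD('n)"
  define I where "I S = {is. length is = ?n \<and> set is \<subseteq> S}" for S :: "nat set"
  define J where "J S = {is. length is = ?n \<and> set is = S}" for S :: "nat set"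
  define vol where
    "vol S = measure lebesgue (\<Sum>i<?n. (*\<^sub>R) (of_bool (i \<in> S)) ` (Ks ! i))" for S
  define F where "F U S = (\<Sum>is\<in>J S. U (map ((!) Ks) is))"
    for U :: "(real ^ 'n) set list \<Rightarrow> real" and S
  have finI: "finite (I S)" if "finite S" for S
    using finite_lists_length_eq[OF that, of ?n] by (simp add: I_def conj_commute)
  have pl: "prod_list (map (\<lambda>i. of_bool (i \<in> S)) is) = (of_bool (set is \<subseteq> S) :: real)"
    for S :: "nat set" and "is"
    by (induction "is") auto
  have IJ: "vol S = (\<Sum>T\<in>Pow S. F U T)"
    if U: "is_mixed_volume U" and S: "S \<subseteq> {..<?n}" for U S
  proof -
    have finS: "finite S" using S finite_subset by blast
    have "vol S = (\<Sum>is\<in>I {..<?n}. of_bool (set is \<subseteq> S) * U (map ((!) Ks) is))"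
      using U len sub unfolding is_mixed_volume_def vol_def I_def pl[symmetric] by force
    also have "\<dots> = (\<Sum>is\<in>I S. U (map ((!) Ks) is))"
      using S by (intro sum.mono_neutral_cong_right finI) (auto simp: I_def)
    also have "\<dots> = (\<Sum>T\<in>Pow S. \<Sum>is | is \<in> I S \<and> set is = T. U (map ((!) Ks) is))"
      using finS by (intro sum.group[symmetric] finI) (auto simp: I_def)
    also have "\<dots> = (\<Sum>T\<in>Pow S. F U T)"
      unfolding F_def by (intro sum.cong) (auto simp: I_def J_def)
    finally show ?thesis .
  qed
  have FF: "F V S = F W S" if "S \<subseteq> {..<?n}" for S
    using finite_subset[OF that finite_lessThan] that
  proof (induction S rule: finite_psubset_induct)
    case (psubset S)
    have "(\<Sum>T\<in>Pow S. F V T) = (\<Sum>T\<in>Pow S. F W T)"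
      using IJ[OF V psubset.prems] IJ[OF W psubset.prems] by simp
    moreover have "(\<Sum>T\<in>Pow S - {S}. F V T) = (\<Sum>T\<in>Pow S - {S}. F W T)"
      using psubset by (intro sum.cong) auto
    ultimately show ?case
      using psubset.hyps by (simp add: sum.remove[of "Pow S" S])
  qed
  have perm: "F U {..<?n} = real (card (J {..<?n})) * U Ks"
    if U: "is_mixed_volume U" for U :: "(real ^ 'n) set list \<Rightarrow> real"
  proof -
    have "U (map ((!) Ks) is) = U Ks" if "is \<in> J {..<?n}" for "is"
    proof -
      have len_is: "length is = ?n" and set_is: "set is = {..<?n}"
        using that by (simp_all add: J_def)
      have "card (set is) = length is"
        unfolding len_is set_is by simp
      then have "distinct is"
        by (rule card_distinct)
      moreover have "set is = set [0..<?n]"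
        unfolding set_is by (simp add: atLeast0LessThan)
      ultimately have "mset is = mset [0..<?n]"
        using distinct_upt set_eq_iff_mset_eq_distinct by blast
      then have "mset (map ((!) Ks) is) = mset (map ((!) Ks) [0..<?n])"
        by (metis mset_map)
      also have "map ((!) Ks) [0..<?n] = Ks"
        using len map_nth by metis
      finally show ?thesis
        using U len sub unfolding is_mixed_volume_def by blast
    qed
    then show ?thesis by (simp add: F_def)
  qed
  have "[0..<?n] \<in> J {..<?n}" by (simp add: J_def atLeast0LessThan)
  moreover have "finite (J {..<?n})"
    using finI[of "{..<?n}"] by (rule finite_subset[rotated]) (auto simp: I_def J_def)
  ultimately have "card (J {..<?n}) \<noteq> 0" by auto
  then show ?thesis
    using FF[OF order_refl] perm[OF V] perm[OF W] by simp
qed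

end

theory Submission
  imports Defs
begin

text \<open>
  Write \<open>n = CARD('n)\<close>. By approximation, \<open>K\<close> may be taken to be a polytope and \<open>L\<close> to contain \<open>0\<close> in its
  interior. The inequality then follows from a containment. Let \<open>r\<close> be the largest number such that a
  translate \<open>x0 + r L\<close> fits into \<open>K\<close>. Then
  \<open>vol K \<le> r * n * V(L, K[n-1])\<close>, and monotonicity and translation invariance of mixed volumes give
  \<open>r * V(L, L2, ..., Ln) = V(x0 + r L, L2, ..., Ln) \<le> V(K, L2, ..., Ln)\<close>. Multiplying the first
  estimate by \<open>V(L, L2, ..., Ln)\<close> and inserting the second is the claim (\<open>bezout_polytope\<close>).

  The volume estimate is a slicing argument (\<open>layer_bound\<close>). Let \<open>K\<close> be given by the inequalities
  \<open>u i \<bullet> z \<le> h i\<close>, and let \<open>s z = min_i (h i - u i \<bullet> z) / (u i \<bullet> p i)\<close>, where \<open>p i\<close> is a point of \<open>L\<close>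
  that is extreme in direction \<open>u i\<close>. For \<open>z\<close> in \<open>K\<close> this is the largest \<open>t\<close> for which \<open>z + t L\<close> fits
  into \<open>K\<close>, so \<open>s \<le> r\<close>. Translating along \<open>c * p i\<close> maps the region where the \<open>i\<close>-th quotient is minimal into
  itself and lowers \<open>s\<close> by \<open>c\<close>. Hence every slice of \<open>K\<close> on which \<open>s\<close> varies by less than \<open>\<epsilon>\<close> can be
  moved, piece by piece and without overlaps, into the shell between \<open>K\<close> and \<open>K + \<epsilon> L\<close>. There are
  about \<open>r / \<epsilon>\<close> slices, and the volume of the shell divided by \<open>\<epsilon>\<close> tends to \<open>n * V(L, K[n-1])\<close>.

  That mixed volumes exist, are monotone and are invariant under translations is established first.
  For a finite set \<open>A\<close> with positive weights \<open>w\<close> the function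
  \<open>x \<mapsto> ln (\<Sum>p\<in>A. w p * exp (x \<bullet> p))\<close> is convex; its gradient is the mean and its Hessian the covariance
  matrix of a Gibbs distribution on \<open>A\<close>. For a nonnegative combination of such functions whose
  corresponding combination of convex hulls has interior points, the gradient maps the space
  bijectively onto a set between the interior of that combination and the combination itself. By the change of variables formula
  \<open>vol (\<Sum>i. c i * conv (A i)) = \<integral> det (\<Sum>i. c i * C i x) dx\<close> with positive semidefinite matrices \<open>C i x\<close>
  (\<open>integral_det_gibbs_cov\<close>), so the volume is a polynomial in \<open>c\<close> whose coefficients are integrals of
  mixed discriminants, and multilinearity is inherited from the determinant. The volume does not depend on the weights:
  enlarge one of the finite sets and let the weights of the new points tend to \<open>0\<close>; then the
  integrands tend to those of the smaller set, and Fatou's lemma shows monotonicity.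

  Equality holds when \<open>L, L2, ..., Ln\<close> are the edges at a vertex of a cube \<open>K\<close>, and adding small balls to
  the edges turns this into sharpness among convex bodies.
\<close>

section \<open>Mixed discriminants\<close>


definition outer :: "real^'n \<Rightarrow> real^'n^'n" where
  "outer v = (\<chi> a b. v$a * v$b)"

text \<open>
  The mixed discriminant: \<open>1 / n!\<close> times the coefficient of \<open>t 1 * ... * t n\<close> in \<open>det (\<Sum>i. t i * M i)\<close>.
  The \<open>n\<close> matrices are indexed by the same type as their rows, so that the assignments of matrices
  to rows are permutations.
\<close>

definition mixed_discriminant :: "('n::finite \<Rightarrow> real^'n^'n) \<Rightarrow> real" where
  "mixed_discriminant M = (\<Sum>p | p permutes UNIV. det (\<chi> a. M (p a) $ a)) / fact CARD('n)"

lemma det_rows_sum: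
  fixes r :: "'n::finite \<Rightarrow> 'i \<Rightarrow> real^'n"
  assumes "\<And>a. finite (J a)"
  shows "det (\<chi> a. \<Sum>i\<in>J a. r a i) = (\<Sum>f\<in>PiE UNIV J. det (\<chi> a. r a (f a)))"
proof -
  have "det (\<chi> a. \<Sum>i\<in>J a. r a i) =
    (\<Sum>p | p permutes (UNIV::'n set). of_int (sign p) * (\<Sum>f\<in>PiE UNIV J. \<Prod>a\<in>UNIV. r a (f a) $ p a))"
    unfolding det_def using assms by (simp add: prod.distrib sum_component prod_sum_PiE)
  also have "\<dots> = (\<Sum>f\<in>PiE UNIV J. det (\<chi> a. r a (f a)))"
    unfolding det_def sum_distrib_left by (subst sum.swap) simp
  finally show ?thesis .
qed

lemma mixed_discriminant_sum:
  fixes N :: "'n::finite \<Rightarrow> 'i \<Rightarrow> real^'n^'n"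
  assumes "\<And>a. finite (J a)"
  shows "mixed_discriminant (\<lambda>a. \<Sum>i\<in>J a. C a i *\<^sub>R N a i) =
    (\<Sum>f\<in>PiE UNIV J. (\<Prod>a\<in>UNIV. C a (f a)) * mixed_discriminant (\<lambda>a. N a (f a)))"
proof -
  have perm: "det (\<chi> r. (\<Sum>i\<in>J (p r). C (p r) i *\<^sub>R N (p r) i) $ r) =
    (\<Sum>f\<in>PiE UNIV J. (\<Prod>a\<in>UNIV. C a (f a)) * det (\<chi> r. N (p r) (f (p r)) $ r))"
    if p: "p permutes UNIV" for p
  proof -
    have b: "bij p" using p by (simp add: permutes_bij)
    have "det (\<chi> r. (\<Sum>i\<in>J (p r). C (p r) i *\<^sub>R N (p r) i) $ r) =
      (\<Sum>g\<in>PiE UNIV (J \<circ> p). det (\<chi> r. C (p r) (g r) *s (N (p r) (g r) $ r)))"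
      using assms by (subst det_rows_sum[symmetric])
        (auto simp: sum_component scalar_mult_eq_scaleR)
    also have "\<dots> = (\<Sum>g\<in>PiE UNIV (J \<circ> p). (\<Prod>r\<in>UNIV. C (p r) (g r)) * det (\<chi> r. N (p r) (g r) $ r))"
      by (simp add: det_rows_mul)
    also have "\<dots> = (\<Sum>f\<in>PiE UNIV J. (\<Prod>r\<in>UNIV. C (p r) (f (p r))) * det (\<chi> r. N (p r) (f (p r)) $ r))"
      by (rule sum.reindex_bij_witness[where i="\<lambda>f. f \<circ> p" and j="\<lambda>g. g \<circ> inv p"])
        (use b in \<open>auto simp: bij_is_inj bij_is_surj surj_f_inv_f fun_eq_iff PiE_def Pi_def\<close>,
         metis bij_inv_eq_iff)
    also have "(\<lambda>f. \<Prod>r\<in>UNIV. C (p r) (f (p r))) = (\<lambda>f. \<Prod>a\<in>UNIV. C a (f a))"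
      using prod.reindex_bij_betw[OF b, of "\<lambda>a. C a (f a)" for f] by (simp add: fun_eq_iff)
    finally show ?thesis by (simp add: fun_eq_iff) 
  qed
  show ?thesis
    unfolding mixed_discriminant_def
    by (subst sum.cong[OF refl perm])
      (auto simp: sum_divide_distrib sum_distrib_left intro: sum.swap)
qed

lemma mixed_discriminant_const: "mixed_discriminant (\<lambda>_. X) = det X"
  by (simp add: mixed_discriminant_def card_permutations vec_lambda_unique)

lemma det_sum_mixed_discriminant:
  fixes M :: "'i \<Rightarrow> real^'n::finite^'n"
  assumes "finite I"
  shows "det (\<Sum>i\<in>I. c i *\<^sub>R M i) = (\<Sum>f\<in>PiE UNIV (\<lambda>_. I). (\<Prod>a\<in>UNIV. c (f a)) * mixed_discriminant (\<lambda>a. M (f a)))"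
  using mixed_discriminant_sum[of "\<lambda>_. I" "\<lambda>_. c" "\<lambda>_. M"] assms by (simp add: mixed_discriminant_const)

text \<open>
  In each term of the mixed discriminant the \<open>j\<close>-th matrix contributes exactly one row.
\<close>

lemma mixed_discriminant_linear:
  fixes M :: "'n::finite \<Rightarrow> real^'n^'n"
  shows "mixed_discriminant (M(j := x *\<^sub>R X + y *\<^sub>R Y)) = x * mixed_discriminant (M(j := X)) + y * mixed_discriminant (M(j := Y))"
proof -
  have "det (\<chi> a. (M(j := x *\<^sub>R X + y *\<^sub>R Y)) (p a) $ a) =
      x * det (\<chi> a. (M(j := X)) (p a) $ a) + y * det (\<chi> a. (M(j := Y)) (p a) $ a)"
    if p: "p permutes UNIV" for p
  proof -
    define k where "k = inv p j"
    have pk: "p a = j \<longleftrightarrow> a = k" for a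
      using p unfolding k_def by (metis permutes_inverses)
    have *: "(\<chi> a. (M(j := Z)) (p a) $ a) = (\<chi> a. if a = k then Z $ k else M (p a) $ a)" for Z
      by (simp add: vec_eq_iff pk)
    show ?thesis
      unfolding * vector_add_component vector_scaleR_component
      using det_row_add[of k "\<lambda>_. x *s X $ k" "\<lambda>_. y *s Y $ k" "\<lambda>a. M (p a) $ a"]
        det_row_mul[of k x "\<lambda>_. X $ k" "\<lambda>a. M (p a) $ a"] det_row_mul[of k y "\<lambda>_. Y $ k" "\<lambda>a. M (p a) $ a"]
      by (simp add: scalar_mult_eq_scaleR cong: if_cong)
  qed
  then show ?thesis
    by (simp add: mixed_discriminant_def sum.distrib sum_distrib_left add_divide_distrib flip: sum_divide_distrib)
qed

text \<open>
  Expand the product over \<open>U\<close> of the factors \<open>1 + g x\<close>, where \<open>g\<close> vanishes on \<open>T\<close> and is \<open>-1\<close> elsewhere.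
\<close>

lemma alternating_sum_supersets:
  fixes U :: "'a set"
  assumes "finite U" "T \<subseteq> U"
  shows "(\<Sum>S | T \<subseteq> S \<and> S \<subseteq> U. (-1) ^ (card U - card S)) = (of_bool (T = U) :: real)"
proof -
  define g :: "'a \<Rightarrow> real" where "g = (\<lambda>x. if x \<in> T then 0 else -1)"
  have "(\<Prod>x\<in>U. 1 + g x) = (\<Sum>S\<in>Pow U. (\<Prod>x\<in>S. 1) * (\<Prod>x\<in>U - S. g x))"
    using assms by (simp add: prod_add)
  also have "\<dots> = (\<Sum>S\<in>Pow U. if T \<subseteq> S then (-1) ^ (card U - card S) else 0)"
  proof (intro sum.cong refl)
    fix S assume S: "S \<in> Pow U"
    then have fin: "finite S" using assms finite_subset by auto
    show "(\<Prod>x\<in>S. 1) * (\<Prod>x\<in>U - S. g x) = (if T \<subseteq> S then (-1) ^ (card U - card S) else 0)"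
    proof (cases "T \<subseteq> S")
      case True
      then have "(\<Prod>x\<in>U - S. g x) = (\<Prod>x\<in>U - S. -1)" by (intro prod.cong) (auto simp: g_def)
      then show ?thesis using True S fin by (simp add: card_Diff_subset)
    next
      case False
      then obtain x where "x \<in> T" "x \<notin> S" by auto
      then have "(\<Prod>x\<in>U - S. g x) = 0" using assms by (auto simp: g_def intro!: prod_zero)
      then show ?thesis using False by simp
    qed
  qed
  also have "\<dots> = (\<Sum>S | T \<subseteq> S \<and> S \<subseteq> U. (-1) ^ (card U - card S))"
    using assms by (intro sum.mono_neutral_cong_right) auto
  finally have "(\<Sum>S | T \<subseteq> S \<and> S \<subseteq> U. (-1) ^ (card U - card S)) = (\<Prod>x\<in>U. 1 + g x)" ..
  also have "\<dots> = of_bool (T = U)"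
  proof (cases "T = U")
    case False
    then obtain x where "x \<in> U" "x \<notin> T" using assms by auto
    then show ?thesis using assms False by (auto simp: g_def intro!: prod_zero)
  qed (simp add: g_def)
  finally show ?thesis .
qed

text \<open>
  This linear identity between determinants is what carries algebraic properties over to volumes:
  on both sides the determinants may be integrated. Expanding \<open>det (\<Sum>i\<in>S. M i)\<close> by rows gives
  a sum over all maps from rows to \<open>S\<close>, and inclusion-exclusion leaves the surjective ones.
\<close>

lemma mixed_discriminant_polarization:
  fixes M :: "'n::finite \<Rightarrow> real^'n^'n"
  shows "mixed_discriminant M = (\<Sum>S\<in>UNIV. (-1) ^ (CARD('n) - card S) * det (\<Sum>i\<in>S. M i)) / fact CARD('n)"
proof -
  let ?R = "\<lambda>f. det (\<chi> a. M (f a) $ a)"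
  have surj_perm: "surj f \<longleftrightarrow> f permutes UNIV" for f :: "'n \<Rightarrow> 'n"
    using bij_imp_permutes[of f UNIV] permutes_surj[of f] finite_UNIV_surj_inj[of f]
    by (auto simp: bij_def bij_betw_def)
  have eq: "(\<chi> a. (\<Sum>i\<in>S. M i) $ a) = (\<Sum>i\<in>S. M i)" for S
    by (simp add: vec_eq_iff sum_component)
  have "det (\<Sum>i\<in>S. M i) = (\<Sum>f\<in>PiE UNIV (\<lambda>_. S). ?R f)" for S :: "'n set"
    using det_rows_sum[of "\<lambda>_. S" "\<lambda>a i. M i $ a"] by (simp add: eq flip: sum_component)
  then have "det (\<Sum>i\<in>S. M i) = (\<Sum>f\<in>UNIV. if range f \<subseteq> S then ?R f else 0)" for S :: "'n set"
    by (simp add: sum.If_cases image_subset_iff PiE_def Pi_def)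
  then have "(\<Sum>S\<in>UNIV. (-1) ^ (CARD('n) - card S) * det (\<Sum>i\<in>S. M i)) =
     (\<Sum>S\<in>UNIV. \<Sum>f\<in>UNIV. (-1) ^ (CARD('n) - card S) * (if range f \<subseteq> S then ?R f else 0))"
    by (simp add: sum_distrib_left)
  also have "\<dots> = (\<Sum>f\<in>UNIV. \<Sum>S\<in>UNIV. (-1) ^ (CARD('n) - card S) * (if range f \<subseteq> S then ?R f else 0))"
    by (rule sum.swap)
  also have "\<dots> = (\<Sum>f\<in>UNIV. (\<Sum>S | range f \<subseteq> S \<and> S \<subseteq> UNIV. (-1) ^ (CARD('n) - card S)) * ?R f)"
    by (intro sum.cong refl) (simp add: sum_distrib_right sum.If_cases if_distrib cong: if_cong)
  also have "\<dots> = (\<Sum>f\<in>UNIV. of_bool (surj f) * ?R f)"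
    by (subst alternating_sum_supersets) auto
  also have "\<dots> = (\<Sum>f | f permutes UNIV. ?R f)"
    using surj_perm by (intro sum.mono_neutral_cong_right) auto
  finally show ?thesis by (simp add: mixed_discriminant_def)
qed

lemma mixed_discriminant_outer: "mixed_discriminant (\<lambda>a. outer (v a)) = (det (\<chi> a. v a))\<^sup>2 / fact CARD('n)"
  for v :: "'n::finite \<Rightarrow> real^'n"
proof -
  have "det (\<chi> a. outer (v (p a)) $ a) = of_int (sign p) * (\<Prod>a\<in>UNIV. v (p a) $ a) * det (\<chi> a. v a)"
    if p: "p permutes UNIV" for p
  proof -
    have "det (\<chi> a. outer (v (p a)) $ a) = det (\<chi> a. (v (p a) $ a) *s v (p a))"
      by (simp add: outer_def vector_scalar_mult_def)
    also have "\<dots> = (\<Prod>a\<in>UNIV. v (p a) $ a) * det (\<chi> a. (\<chi> b. v b) $ p a)"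
      by (simp add: det_rows_mul)
    finally show ?thesis using p by (simp only: det_permute_rows[OF p]) simp
  qed
  then have "(\<Sum>p | p permutes UNIV. det (\<chi> a. outer (v (p a)) $ a)) =
     (\<Sum>p | p permutes UNIV. of_int (sign p) * (\<Prod>a\<in>UNIV. v (p a) $ a)) * det (\<chi> a. v a)"
    by (simp add: sum_distrib_right)
  also have "(\<Sum>p | p permutes UNIV. of_int (sign p) * (\<Prod>a\<in>UNIV. v (p a) $ a)) = det (transpose (\<chi> a. v a))"
    by (simp add: det_def transpose_def)
  finally show ?thesis by (simp add: mixed_discriminant_def power2_eq_square det_transpose)
qed

text \<open>
  By multilinearity only matrices of rank one matter, and for these the value is a squared
  determinant.
\<close>

lemma mixed_discriminant_nonneg:
  fixes v :: "'n::finite \<Rightarrow> 'i \<Rightarrow> real^'n"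
  assumes "\<And>a. finite (J a)" "\<And>a i. i \<in> J a \<Longrightarrow> 0 \<le> C a i"
  shows "0 \<le> mixed_discriminant (\<lambda>a. \<Sum>i\<in>J a. C a i *\<^sub>R outer (v a i))"
  unfolding mixed_discriminant_sum[OF assms(1)] mixed_discriminant_outer
  using assms(2) by (intro sum_nonneg mult_nonneg_nonneg prod_nonneg) auto



section \<open>Gibbs distributions on finite point sets\<close>

definition gibbs :: "'a::real_inner set \<Rightarrow> ('a \<Rightarrow> real) \<Rightarrow> 'a \<Rightarrow> 'a \<Rightarrow> real" where
  "gibbs A w x p = w p * exp (x \<bullet> p) / (\<Sum>q\<in>A. w q * exp (x \<bullet> q))"

definition gibbs_mean :: "'a::real_inner set \<Rightarrow> ('a \<Rightarrow> real) \<Rightarrow> 'a \<Rightarrow> 'a" where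
  "gibbs_mean A w x = (\<Sum>p\<in>A. gibbs A w x p *\<^sub>R p)"

text \<open>
  The covariance matrix, symmetrized over pairs of points: this form exhibits it as a nonnegative
  combination of rank-one matrices.
\<close>

definition gibbs_cov :: "(real^'n::finite) set \<Rightarrow> (real^'n \<Rightarrow> real) \<Rightarrow> real^'n \<Rightarrow> real^'n^'n" where
  "gibbs_cov A w x = (\<Sum>(p,q)\<in>A \<times> A. (gibbs A w x p * gibbs A w x q / 2) *\<^sub>R outer (p - q))"

lemma outer_mult: "outer u *v v = (u \<bullet> v) *\<^sub>R u"
  by (simp add: vec_eq_iff outer_def matrix_vector_mult_def inner_vec_def sum_distrib_left mult_ac)

lemma sum_scaleR_matrix_vector:
  fixes M :: "'i \<Rightarrow> real^'n::finite^'m"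
  shows "(\<Sum>i\<in>I. r i *\<^sub>R M i) *v v = (\<Sum>i\<in>I. r i *\<^sub>R (M i *v v))"
  by (induction I rule: infinite_finite_induct)
    (auto simp: matrix_vector_mult_add_rdistrib scaleR_matrix_vector_assoc)

lemma inner_sum_scaleR_matrix_vector:
  fixes M :: "'i \<Rightarrow> real^'n::finite^'n"
  shows "v \<bullet> ((\<Sum>i\<in>I. r i *\<^sub>R M i) *v v) = (\<Sum>i\<in>I. r i * (v \<bullet> (M i *v v)))"
  by (simp add: sum_scaleR_matrix_vector inner_sum_right)

lemma partition_pos:
  assumes "finite A" "A \<noteq> {}" "\<forall>p\<in>A. 0 < w p"
  shows "0 < (\<Sum>q\<in>A. w q * exp (x \<bullet> q) :: real)"
  using assms by (intro sum_pos) auto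

lemma gibbs_pos:
  assumes "finite A" "A \<noteq> {}" "\<forall>p\<in>A. 0 < w p" "p \<in> A"
  shows "0 < gibbs A w x p"
  unfolding gibbs_def using partition_pos[OF assms(1-3)] assms by simp

lemma sum_gibbs:
  assumes "finite A" "A \<noteq> {}" "\<forall>p\<in>A. 0 < w p"
  shows "(\<Sum>p\<in>A. gibbs A w x p) = 1"
  unfolding gibbs_def using partition_pos[OF assms, where x=x] by (simp flip: sum_divide_distrib)

lemma gibbs_mean_in_hull:
  assumes "finite A" "A \<noteq> {}" "\<forall>p\<in>A. 0 < w p"
  shows "gibbs_mean A w x \<in> convex hull A"
  unfolding gibbs_mean_def
  using assms(1) sum_gibbs[OF assms] gibbs_pos[OF assms]
  by (intro convex_sum) (auto intro: hull_inc less_imp_le)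

lemma log_partition_deriv:
  assumes "finite A" "A \<noteq> {}" "\<forall>p\<in>A. 0 < w p"
  shows "((\<lambda>x. ln (\<Sum>q\<in>A. w q * exp (x \<bullet> q))) has_derivative (\<lambda>v. gibbs_mean A w x \<bullet> v)) (at x)"
proof -
  have pos: "0 < (\<Sum>q\<in>A. w q * exp (x \<bullet> q))" using partition_pos[OF assms] .
  have b: "gibbs_mean A w x \<bullet> v = (\<Sum>q\<in>A. w q * (exp (x \<bullet> q) * (v \<bullet> q))) / (\<Sum>q\<in>A. w q * exp (x \<bullet> q))" for v
    by (auto simp: gibbs_mean_def gibbs_def inner_sum_left sum_divide_distrib inner_commute[of v] mult_ac intro!: sum.cong)
  show ?thesis
    unfolding b
    by (rule derivative_eq_intros refl pos)+ (simp add: fun_eq_iff divide_simps mult_ac)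
qed

lemma gibbs_deriv:
  assumes "finite A" "A \<noteq> {}" "\<forall>p\<in>A. 0 < w p"
  shows "((\<lambda>x. gibbs A w x p) has_derivative (\<lambda>v. gibbs A w x p * (p \<bullet> v - gibbs_mean A w x \<bullet> v))) (at x)"
proof -
  have pos: "0 < (\<Sum>q\<in>A. w q * exp (x \<bullet> q))" using partition_pos[OF assms] .
  have b: "gibbs_mean A w x \<bullet> v = (\<Sum>q\<in>A. w q * (exp (x \<bullet> q) * (v \<bullet> q))) / (\<Sum>q\<in>A. w q * exp (x \<bullet> q))" for v
    by (auto simp: gibbs_mean_def gibbs_def inner_sum_left sum_divide_distrib inner_commute[of v] mult_ac intro!: sum.cong)
  show ?thesis
    unfolding gibbs_def
    apply (rule derivative_eq_intros refl)+
    subgoal using pos by simp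
    subgoal using pos unfolding b
      by (simp add: fun_eq_iff field_simps inner_commute power2_eq_square)
    done
qed

lemma gibbs_cov_mult:
  fixes A :: "(real^'n::finite) set"
  assumes "finite A" "A \<noteq> {}" "\<forall>p\<in>A. 0 < w p"
  shows "gibbs_cov A w x *v v = (\<Sum>p\<in>A. (gibbs A w x p * (p \<bullet> v - gibbs_mean A w x \<bullet> v)) *\<^sub>R p)"
proof -
  let ?g = "gibbs A w x"
  let ?B = "\<Sum>q\<in>A. (?g q * (q \<bullet> v)) *\<^sub>R q" and ?b = "gibbs_mean A w x"
  have bv: "?b \<bullet> v = (\<Sum>q\<in>A. ?g q * (q \<bullet> v))"
    by (simp add: gibbs_mean_def inner_sum_left)
  have cb: "c *\<^sub>R ?b = (\<Sum>p\<in>A. (c * ?g p) *\<^sub>R p)" for c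
    by (simp add: gibbs_mean_def scaleR_right.sum)
  have 1: "(\<Sum>p\<in>A. \<Sum>q\<in>A. (?g p * ?g q * (p \<bullet> v)) *\<^sub>R p) = ?B"
    using sum_gibbs[OF assms, where x=x]
    by (simp add: mult_ac flip: scaleR_left.sum sum_distrib_left sum_distrib_right)
  have 2: "(\<Sum>p\<in>A. \<Sum>q\<in>A. (?g p * ?g q * (q \<bullet> v)) *\<^sub>R p) = (?b \<bullet> v) *\<^sub>R ?b"
  proof -
    have "(\<Sum>p\<in>A. \<Sum>q\<in>A. (?g p * ?g q * (q \<bullet> v)) *\<^sub>R p) = (\<Sum>p\<in>A. (?g p * (?b \<bullet> v)) *\<^sub>R p)"
      unfolding bv by (simp add: sum_distrib_left mult.assoc flip: scaleR_left.sum)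
    also have "\<dots> = (?b \<bullet> v) *\<^sub>R ?b"
      by (simp add: cb mult.commute)
    finally show ?thesis .
  qed
  have 3: "(\<Sum>p\<in>A. \<Sum>q\<in>A. (?g p * ?g q * (p \<bullet> v)) *\<^sub>R q) = (?b \<bullet> v) *\<^sub>R ?b"
    using 2 by (subst sum.swap) (simp add: mult_ac)
  have 4: "(\<Sum>p\<in>A. \<Sum>q\<in>A. (?g p * ?g q * (q \<bullet> v)) *\<^sub>R q) = ?B"
    using 1 by (subst sum.swap) (simp add: mult_ac)
  have "gibbs_cov A w x *v v = (\<Sum>(p,q)\<in>A \<times> A. (?g p * ?g q / 2) *\<^sub>R (((p - q) \<bullet> v) *\<^sub>R (p - q)))"
    unfolding gibbs_cov_def using sum_scaleR_matrix_vector[of "\<lambda>(p,q). ?g p * ?g q / 2" "\<lambda>(p,q). outer (p - q)" "A \<times> A"]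
    by (simp add: case_prod_unfold outer_mult)
  also have "\<dots> = (1/2) *\<^sub>R (\<Sum>p\<in>A. \<Sum>q\<in>A. (?g p * ?g q * (p \<bullet> v)) *\<^sub>R p - (?g p * ?g q * (q \<bullet> v)) *\<^sub>R p
      - (?g p * ?g q * (p \<bullet> v)) *\<^sub>R q + (?g p * ?g q * (q \<bullet> v)) *\<^sub>R q)"
    unfolding sum.cartesian_product[symmetric] scaleR_right.sum
    by (intro sum.cong refl) (simp add: algebra_simps inner_diff_left)
  also have "\<dots> = ?B - (?b \<bullet> v) *\<^sub>R ?b"
    unfolding sum.distrib sum_subtractf 1 2 3 4 by (simp add: algebra_simps flip: scaleR_add_left)
  also have "\<dots> = (\<Sum>p\<in>A. (?g p * (p \<bullet> v - ?b \<bullet> v)) *\<^sub>R p)"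
    by (simp add: cb algebra_simps sum_subtractf)
  finally show ?thesis .
qed

lemma gibbs_mean_deriv:
  fixes A :: "(real^'n::finite) set"
  assumes "finite A" "A \<noteq> {}" "\<forall>p\<in>A. 0 < w p"
  shows "(gibbs_mean A w has_derivative (*v) (gibbs_cov A w x)) (at x)"
proof -
  have "((\<lambda>x. \<Sum>p\<in>A. gibbs A w x p *\<^sub>R p) has_derivative
      (\<lambda>v. \<Sum>p\<in>A. (gibbs A w x p * (p \<bullet> v - gibbs_mean A w x \<bullet> v)) *\<^sub>R p)) (at x)"
    by (intro has_derivative_sum has_derivative_scaleR_left gibbs_deriv assms)
  moreover have "gibbs_mean A w = (\<lambda>x. \<Sum>p\<in>A. gibbs A w x p *\<^sub>R p)"
    by (simp add: gibbs_mean_def fun_eq_iff)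
  moreover have "(*v) (gibbs_cov A w x) = (\<lambda>v. \<Sum>p\<in>A. (gibbs A w x p * (p \<bullet> v - gibbs_mean A w x \<bullet> v)) *\<^sub>R p)"
    using gibbs_cov_mult[OF assms] by (simp add: fun_eq_iff)
  ultimately show ?thesis by simp
qed

lemma inner_gibbs_cov:
  fixes A :: "(real^'n::finite) set"
  shows "v \<bullet> (gibbs_cov A w x *v v) = (\<Sum>p\<in>A. \<Sum>q\<in>A. gibbs A w x p * gibbs A w x q / 2 * ((p - q) \<bullet> v)\<^sup>2)"
  unfolding gibbs_cov_def case_prod_unfold inner_sum_scaleR_matrix_vector
  unfolding sum.cartesian_product
  by (simp add: case_prod_unfold outer_mult power2_eq_square inner_commute)

text \<open>
  The logarithm of the partition function dominates the support function of the hull up to a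
  constant; this is the source of coercivity later.
\<close>

lemma log_partition_ge:
  assumes "finite A" "A \<noteq> {}" "\<forall>p\<in>A. 0 < w p" "z \<in> convex hull A"
  shows "z \<bullet> x + ln (Min (w ` A)) \<le> ln (\<Sum>q\<in>A. w q * exp (x \<bullet> q))"
proof -
  let ?m = "Min (w ` A)"
  let ?H = "{z. x \<bullet> z \<le> ln (\<Sum>q\<in>A. w q * exp (x \<bullet> q)) - ln ?m}"
  have m: "0 < ?m" using assms by simp
  have "A \<subseteq> ?H"
  proof
    fix p assume p: "p \<in> A"
    have "?m * exp (x \<bullet> p) \<le> w p * exp (x \<bullet> p)" using assms p by (simp add: Min_le)
    also have "\<dots> \<le> (\<Sum>q\<in>A. w q * exp (x \<bullet> q))"
      using p assms by (intro member_le_sum) (auto intro: less_imp_le)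
    finally have "ln (?m * exp (x \<bullet> p)) \<le> ln (\<Sum>q\<in>A. w q * exp (x \<bullet> q))"
      using m by (subst ln_le_cancel_iff) (auto intro: partition_pos[OF assms(1-3)])
    then show "p \<in> ?H" using m by (simp add: ln_mult)
  qed
  then have "convex hull A \<subseteq> ?H" by (intro hull_minimal convex_halfspace_le)
  then show ?thesis using assms(4) by (auto simp: inner_commute)
qed



section \<open>Volume as an integral of determinants\<close>

lemma compact_set_sum:
  fixes B :: "'i \<Rightarrow> 'a::real_normed_vector set"
  assumes "\<And>i. i \<in> I \<Longrightarrow> compact (B i)"
  shows "compact (\<Sum>i\<in>I. B i)"
  using assms
proof (induction I rule: infinite_finite_induct)
  case (insert i I)
  have "B i + (\<Sum>i\<in>I. B i) = {x + y |x y. x \<in> B i \<and> y \<in> (\<Sum>i\<in>I. B i)}"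
    by (auto simp: set_plus_def)
  with insert show ?case
    using compact_sums[of "B i" "\<Sum>i\<in>I. B i"] by simp
qed (auto simp: set_zero)

locale gibbs_family =
  fixes I :: "'i set" and A :: "'i \<Rightarrow> (real^'n::finite) set" and w :: "'i \<Rightarrow> real^'n \<Rightarrow> real"
  assumes fin_I: "finite I"
    and fin: "\<And>i. i \<in> I \<Longrightarrow> finite (A i)"
    and ne: "\<And>i. i \<in> I \<Longrightarrow> A i \<noteq> {}"
    and pos: "\<And>i. i \<in> I \<Longrightarrow> \<forall>p\<in>A i. 0 < w i p"
begin

lemma mixed_discriminant_gibbs_cov_nonneg:
  assumes "\<And>a i. i \<in> I \<Longrightarrow> 0 \<le> C a i"
  shows "0 \<le> mixed_discriminant (\<lambda>a. \<Sum>i\<in>I. C a i *\<^sub>R gibbs_cov (A i) (w i) x)"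
proof -
  let ?J = "Sigma I (\<lambda>i. A i \<times> A i)"
  let ?c = "\<lambda>a (i,p,q). C a i * (gibbs (A i) (w i) x p * gibbs (A i) (w i) x q / 2)"
  have "(\<Sum>i\<in>I. C a i *\<^sub>R gibbs_cov (A i) (w i) x) = (\<Sum>k\<in>?J. ?c a k *\<^sub>R outer (fst (snd k) - snd (snd k)))" for a
    unfolding gibbs_cov_def scaleR_right.sum using fin_I fin
    by (subst sum.Sigma) (auto simp: case_prod_unfold)
  moreover have "0 \<le> mixed_discriminant (\<lambda>a. \<Sum>k\<in>?J. ?c a k *\<^sub>R outer (fst (snd k) - snd (snd k)))"
    using fin_I fin ne pos assms
    by (intro mixed_discriminant_nonneg) (auto intro!: mult_nonneg_nonneg divide_nonneg_pos less_imp_le[OF gibbs_pos])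
  ultimately show ?thesis by simp
qed

end

text \<open>
  The combination \<open>\<Sum>i. c i * ln (\<Sum>p\<in>A i. w i p * exp (x \<bullet> p))\<close> of potentials has gradient \<open>moment\<close> and
  Hessian \<open>jac\<close>; \<open>body\<close> is the convex set that the gradient fills.
\<close>

locale weighted_gibbs_family = gibbs_family I A w
  for I :: "'i set" and A :: "'i \<Rightarrow> (real^'n::finite) set" and w +
  fixes c :: "'i \<Rightarrow> real"
  assumes c_nonneg: "\<And>i. i \<in> I \<Longrightarrow> 0 \<le> c i"
begin

definition body :: "(real^'n) set" where
  "body = (\<Sum>i\<in>I. (*\<^sub>R) (c i) ` (convex hull A i))"

definition moment :: "real^'n \<Rightarrow> real^'n" where
  "moment x = (\<Sum>i\<in>I. c i *\<^sub>R gibbs_mean (A i) (w i) x)"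

definition jac :: "real^'n \<Rightarrow> real^'n^'n" where
  "jac x = (\<Sum>i\<in>I. c i *\<^sub>R gibbs_cov (A i) (w i) x)"

lemma body_alt: "body = {\<Sum>i\<in>I. c i *\<^sub>R s i | s. \<forall>i\<in>I. s i \<in> convex hull A i}"
proof -
  have "\<exists>t. (\<Sum>i\<in>I. s i) = (\<Sum>i\<in>I. c i *\<^sub>R t i) \<and> (\<forall>i\<in>I. t i \<in> convex hull A i)"
    if s: "\<forall>i\<in>I. s i \<in> (*\<^sub>R) (c i) ` (convex hull A i)" for s
  proof -
    from s have "\<forall>i\<in>I. \<exists>t. t \<in> convex hull A i \<and> s i = c i *\<^sub>R t" by blast
    then obtain t where t: "\<forall>i\<in>I. t i \<in> convex hull A i \<and> s i = c i *\<^sub>R t i"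
      by (rule bchoice[THEN exE])
    then have "(\<Sum>i\<in>I. s i) = (\<Sum>i\<in>I. c i *\<^sub>R t i)" by (intro sum.cong) auto
    with t show ?thesis by (intro exI[of _ t]) simp
  qed
  moreover have "\<exists>t. (\<Sum>i\<in>I. c i *\<^sub>R s i) = (\<Sum>i\<in>I. t i) \<and> (\<forall>i\<in>I. t i \<in> (*\<^sub>R) (c i) ` (convex hull A i))"
    if "\<forall>i\<in>I. s i \<in> convex hull A i" for s
    using that by (intro exI[of _ "\<lambda>i. c i *\<^sub>R s i"]) auto
  ultimately show ?thesis
    unfolding body_def set_sum_alt[OF fin_I] by (intro set_eqI iffI; elim CollectE exE conjE; simp)
qed

lemma convex_body: "convex body"
  unfolding body_def by (intro convex_set_sum convex_scaling) simp

lemma compact_body: "compact body"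
  unfolding body_def using fin
  by (intro compact_set_sum compact_scaling compact_convex_hull finite_imp_compact)

lemma moment_in_body: "moment x \<in> body"
proof -
  have "\<forall>i\<in>I. gibbs_mean (A i) (w i) x \<in> convex hull A i"
    by (intro ballI gibbs_mean_in_hull fin ne pos)
  then show ?thesis
    unfolding body_alt moment_def
    by (intro CollectI exI[of _ "\<lambda>i. gibbs_mean (A i) (w i) x"] conjI refl)
qed

lemma moment_deriv: "(moment has_derivative (*v) (jac x)) (at x)"
proof -
  have "((\<lambda>x. \<Sum>i\<in>I. c i *\<^sub>R gibbs_mean (A i) (w i) x) has_derivative (\<lambda>v. \<Sum>i\<in>I. c i *\<^sub>R (gibbs_cov (A i) (w i) x *v v))) (at x)"
    using fin ne pos by (intro has_derivative_sum has_derivative_scaleR_right gibbs_mean_deriv)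
  moreover have "moment = (\<lambda>x. \<Sum>i\<in>I. c i *\<^sub>R gibbs_mean (A i) (w i) x)"
    by (simp add: moment_def fun_eq_iff)
  moreover have "(*v) (jac x) = (\<lambda>v. \<Sum>i\<in>I. c i *\<^sub>R (gibbs_cov (A i) (w i) x *v v))"
    by (simp add: jac_def sum_scaleR_matrix_vector fun_eq_iff)
  ultimately show ?thesis by simp
qed

lemma det_jac_nonneg: "0 \<le> det (jac x)"
  using mixed_discriminant_gibbs_cov_nonneg[of "\<lambda>_. c" x] c_nonneg by (simp add: jac_def mixed_discriminant_const)

text \<open>
  \<open>flat v\<close> says that \<open>body\<close> has no extent in direction \<open>v\<close>. The next lemmas identify this with \<open>body\<close>
  lying in a hyperplane orthogonal to \<open>v\<close> and with degeneracy of the Hessian in direction \<open>v\<close>.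
\<close>

definition flat :: "real^'n \<Rightarrow> bool" where
  "flat v \<longleftrightarrow> (\<forall>i\<in>I. \<forall>p\<in>A i. \<forall>q\<in>A i. c i * ((p - q) \<bullet> v) = 0)"

lemma flat_if_body_in_hyperplane:
  assumes "body \<subseteq> {z. v \<bullet> z = b}"
  shows "flat v"
  unfolding flat_def
proof (intro ballI)
  fix i p q assume i: "i \<in> I" and p: "p \<in> A i" and q: "q \<in> A i"
  have "\<forall>j\<in>I. \<exists>p. p \<in> A j" using ne by blast
  then obtain s where s: "\<And>j. j \<in> I \<Longrightarrow> s j \<in> A j" by metis
  have eq: "v \<bullet> (\<Sum>j\<in>I. c j *\<^sub>R (s(i := z)) j) = b" if "z \<in> A i" for z
  proof -
    have "(\<Sum>j\<in>I. c j *\<^sub>R (s(i := z)) j) \<in> body"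
      unfolding body_alt using s that by (auto intro!: exI[of _ "s(i := z)"] hull_inc)
    then show ?thesis using assms by auto
  qed
  have split: "(\<Sum>j\<in>I. c j *\<^sub>R (s(i := z)) j) = c i *\<^sub>R z + (\<Sum>j\<in>I - {i}. c j *\<^sub>R s j)" for z
    using i fin_I by (simp add: sum.remove)
  have "c i * (p \<bullet> v) = c i * (q \<bullet> v)"
    using eq[OF p] eq[OF q]
    unfolding split inner_add_right inner_scaleR_right inner_commute[of v p] inner_commute[of v q]
    by linarith
  then show "c i * ((p - q) \<bullet> v) = 0"
    by (simp only: inner_diff_left right_diff_distrib)
qed

lemma body_in_hyperplane_if_flat:
  assumes "flat v"
  shows "\<exists>b. body \<subseteq> {z. v \<bullet> z = b}"
proof -
  have "\<forall>j\<in>I. \<exists>p. p \<in> A j" using ne by blast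
  then obtain s where s: "\<And>j. j \<in> I \<Longrightarrow> s j \<in> A j" by metis
  have "c i * (v \<bullet> z) = c i * (v \<bullet> s i)" if i: "i \<in> I" and z: "z \<in> convex hull A i" for i z
  proof -
    have "convex hull A i \<subseteq> {z. (c i *\<^sub>R v) \<bullet> z = c i * (v \<bullet> s i)}"
    proof (intro hull_minimal convex_hyperplane subsetI CollectI)
      fix p assume "p \<in> A i"
      then have "c i * ((p - s i) \<bullet> v) = 0"
        using assms s[OF i] i unfolding flat_def by blast
      then show "(c i *\<^sub>R v) \<bullet> p = c i * (v \<bullet> s i)"
        by (simp add: inner_diff_left inner_commute algebra_simps)
    qed
    then show ?thesis using z by auto
  qed
  then have "body \<subseteq> {z. v \<bullet> z = (\<Sum>i\<in>I. c i * (v \<bullet> s i))}"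
    unfolding body_alt by (auto simp: inner_sum_right intro!: sum.cong)
  then show ?thesis ..
qed

lemma inner_jac:
  "v \<bullet> (jac x *v v) = (\<Sum>i\<in>I. \<Sum>p\<in>A i. \<Sum>q\<in>A i. c i * (gibbs (A i) (w i) x p * gibbs (A i) (w i) x q / 2 * ((p - q) \<bullet> v)\<^sup>2))"
  unfolding jac_def inner_sum_scaleR_matrix_vector
  by (intro sum.cong refl) (simp add: inner_gibbs_cov sum_distrib_left)

lemma flat_if_inner_jac_zero:
  assumes "v \<bullet> (jac x *v v) = 0"
  shows "flat v"
proof -
  define t where "t i p q = c i * (gibbs (A i) (w i) x p * gibbs (A i) (w i) x q / 2 * ((p - q) \<bullet> v)\<^sup>2)" for i p q
  have g: "0 < gibbs (A i) (w i) x p" if "i \<in> I" "p \<in> A i" for i p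
    by (rule gibbs_pos[OF fin ne pos]) (use that in auto)
  have nn: "0 \<le> t i p q" if "i \<in> I" "p \<in> A i" "q \<in> A i" for i p q
    unfolding t_def using that(1) c_nonneg g[of i p] g[of i q] that by simp
  have "(\<Sum>i\<in>I. \<Sum>p\<in>A i. \<Sum>q\<in>A i. t i p q) = 0"
    using assms unfolding inner_jac t_def .
  from sum_nonneg_0[OF fin_I _ this] have 1: "(\<Sum>p\<in>A i. \<Sum>q\<in>A i. t i p q) = 0" if "i \<in> I" for i
    using that nn by (simp add: sum_nonneg)
  have 2: "(\<Sum>q\<in>A i. t i p q) = 0" if "i \<in> I" "p \<in> A i" for i p
    by (rule sum_nonneg_0[OF fin _ 1]) (use that nn in \<open>auto intro: sum_nonneg\<close>)
  have "t i p q = 0" if "i \<in> I" "p \<in> A i" "q \<in> A i" for i p q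
    by (rule sum_nonneg_0[OF fin _ 2]) (use that nn in auto)
  then have "c i * ((p - q) \<bullet> v) = 0" if "i \<in> I" "p \<in> A i" "q \<in> A i" for i p q
    using that g[of i p] g[of i q] by (fastforce simp: t_def)
  then show ?thesis by (simp add: flat_def)
qed

lemma det_jac_zero_if_flat:
  assumes "flat v" "v \<noteq> 0"
  shows "det (jac x) = 0"
proof -
  have "gibbs_cov (A i) (w i) x *v v = 0" if i: "i \<in> I" "c i \<noteq> 0" for i
    unfolding gibbs_cov_def case_prod_unfold sum_scaleR_matrix_vector using assms(1) i
    by (intro sum.neutral) (auto simp: outer_mult flat_def)
  then have "jac x *v v = 0"
    unfolding jac_def sum_scaleR_matrix_vector by (intro sum.neutral) auto
  then have "\<not> invertible (jac x)"
    using assms(2) matrix_left_invertible_ker[of "jac x"] unfolding invertible_def by blast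
  then show ?thesis by (simp add: invertible_det_nz)
qed

text \<open>
  If \<open>moment\<close> took the same value at \<open>x\<close> and \<open>y\<close>, then by the mean value theorem the Hessian would be
  degenerate in direction \<open>y - x\<close> at some point of the segment.
\<close>

lemma inj_moment:
  assumes "interior body \<noteq> {}"
  shows "inj moment"
proof (rule injI, rule ccontr)
  fix x y assume eq: "moment x = moment y" and "x \<noteq> y"
  define v where "v = y - x"
  have v: "v \<noteq> 0" using \<open>x \<noteq> y\<close> by (simp add: v_def)
  define f where "f t = v \<bullet> moment (x + t *\<^sub>R v)" for t :: real
  have "(f has_derivative (\<lambda>h. v \<bullet> (jac (x + t *\<^sub>R v) *v (h *\<^sub>R v)))) (at t within {0..1})" for t
    unfolding f_def
    by (intro has_derivative_inner_right has_derivative_compose[OF _ moment_deriv, where f="\<lambda>t. x + t *\<^sub>R v"])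
       (auto intro!: derivative_eq_intros)
  then obtain t where "f 1 - f 0 = v \<bullet> (jac (x + t *\<^sub>R v) *v ((1 - 0) *\<^sub>R v))"
    using mvt_simple[of 0 1 f "\<lambda>t h. v \<bullet> (jac (x + t *\<^sub>R v) *v (h *\<^sub>R v))"] by auto
  then have "v \<bullet> (jac (x + t *\<^sub>R v) *v v) = 0"
    using eq by (simp add: f_def v_def)
  then obtain b where "body \<subseteq> {z. v \<bullet> z = b}"
    using flat_if_inner_jac_zero body_in_hyperplane_if_flat by blast
  then show False
    using assms v interior_mono[of body "{z. v \<bullet> z = b}"] by auto
qed

text \<open>
  For \<open>y\<close> in the interior, the potential minus \<open>y \<bullet> x\<close> is coercive; at a minimum its gradient vanishes.
\<close>

lemma interior_subset_range_moment: "interior body \<subseteq> range moment"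
proof
  fix y assume y: "y \<in> interior body"
  then obtain d where d: "d > 0" "cball y d \<subseteq> body"
    by (meson mem_interior_cball)
  let ?Z = "\<lambda>i x. \<Sum>q\<in>A i. w i q * exp (x \<bullet> q)"
  define F where "F x = (\<Sum>i\<in>I. c i * ln (?Z i x)) - y \<bullet> x" for x
  define B where "B = (\<Sum>i\<in>I. c i * ln (Min (w i ` A i)))"
  have der: "(F has_derivative (\<lambda>v. moment x \<bullet> v - y \<bullet> v)) (at x)" for x
  proof -
    have "(F has_derivative (\<lambda>v. (\<Sum>i\<in>I. c i * (gibbs_mean (A i) (w i) x \<bullet> v)) - y \<bullet> v)) (at x)"
      unfolding F_def using fin ne pos
      by (intro has_derivative_diff has_derivative_sum has_derivative_mult_right log_partition_deriv
          has_derivative_inner_right has_derivative_ident) blast+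
    then show ?thesis by (simp add: moment_def inner_sum_left)
  qed
  have lower: "z \<bullet> x + B - y \<bullet> x \<le> F x" if zb: "z \<in> body" for z x
  proof -
    have "\<exists>s. z = (\<Sum>i\<in>I. c i *\<^sub>R s i) \<and> (\<forall>i\<in>I. s i \<in> convex hull A i)"
      using zb unfolding body_alt by (rule CollectD)
    then obtain s where z: "z = (\<Sum>i\<in>I. c i *\<^sub>R s i)" and s: "\<forall>i\<in>I. s i \<in> convex hull A i"
      by (elim exE conjE)
    have "z \<bullet> x + B = (\<Sum>i\<in>I. c i * (s i \<bullet> x + ln (Min (w i ` A i))))"
      by (simp add: z B_def inner_sum_left sum.distrib distrib_left)
    also have "\<dots> \<le> (\<Sum>i\<in>I. c i * ln (?Z i x))"
    proof (intro sum_mono mult_left_mono)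
      fix i assume i: "i \<in> I"
      show "s i \<bullet> x + ln (Min (w i ` A i)) \<le> ln (?Z i x)"
        using log_partition_ge[OF fin[OF i] ne[OF i] pos[OF i]] s i by blast
    qed (rule c_nonneg)
    finally show ?thesis by (simp add: F_def)
  qed
  have coercive: "d * norm x + B \<le> F x" for x
  proof (cases "x = 0")
    case True
    then show ?thesis using lower[of y 0] y interior_subset[of body] by (simp add: subsetD)
  next
    case False
    have "y + (d / norm x) *\<^sub>R x \<in> body"
      using d False by (intro subsetD[OF d(2)]) (simp add: dist_norm)
    from lower[OF this, of x] False show ?thesis
      by (simp add: inner_add_left power2_norm_eq_inner[symmetric] power2_eq_square)
  qed
  define R where "R = (\<bar>F 0\<bar> + \<bar>B\<bar>) / d"
  have R: "0 \<le> R" using d by (simp add: R_def)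
  have cont: "continuous_on (cball 0 R) F"
    by (intro continuous_at_imp_continuous_on ballI has_derivative_continuous[OF der])
  have "cball (0::real^'n) R \<noteq> {}" using R by simp
  from continuous_attains_inf[OF compact_cball this cont]
  obtain x where x: "x \<in> cball 0 R" "\<And>u. u \<in> cball 0 R \<Longrightarrow> F x \<le> F u"
    by blast
  have "F x \<le> F u" for u
  proof (cases "u \<in> cball 0 R")
    case False
    then have "R \<le> norm u" by simp
    then have "\<bar>F 0\<bar> + \<bar>B\<bar> \<le> d * norm u" using d by (simp add: R_def field_simps)
    then have "F 0 \<le> F u" using coercive[of u] by linarith
    then show ?thesis using x(2)[of 0] R by simp
  qed (rule x(2))
  then have zero: "(\<lambda>v. moment x \<bullet> v - y \<bullet> v) = (\<lambda>v. 0)"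
    by (intro differential_zero_maxmin[OF UNIV_I open_UNIV der]) blast
  have "(moment x - y) \<bullet> (moment x - y) = 0"
    using fun_cong[OF zero, of "moment x - y"] unfolding inner_diff_left .
  then have "moment x = y" by simp
  then show "y \<in> range moment" by blast
qed

end

text \<open>
  The map \<open>moment\<close> is injective and its range differs from \<open>body\<close> by at most the boundary, which is
  negligible. If \<open>body\<close> has no interior, both sides vanish. The order on the index type is needed
  for the change of variables formula; it is removed again by relabelling coordinates.
\<close>

lemma integral_det_gibbs_cov:
  fixes A :: "'i \<Rightarrow> (real^'n::{finite,wellorder}) set"
  assumes "gibbs_family I A w" and "\<And>i. i \<in> I \<Longrightarrow> 0 \<le> c i"
  shows "has_bochner_integral lebesgue (\<lambda>x. det (\<Sum>i\<in>I. c i *\<^sub>R gibbs_cov (A i) (w i) x))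
     (measure lebesgue (\<Sum>i\<in>I. (*\<^sub>R) (c i) ` (convex hull A i)))"
proof -
  interpret gibbs_family I A w by fact
  interpret weighted_gibbs_family I A w c by unfold_locales fact
  have "has_bochner_integral lebesgue (\<lambda>x. det (jac x)) (measure lebesgue body)"
  proof (cases "interior body = {}")
    case True
    obtain v b where v: "v \<noteq> 0" "body \<subseteq> {z. v \<bullet> z = b}"
      using empty_interior_subset_hyperplane[OF convex_body True] by metis
    then have "det (jac x) = 0" for x
      using flat_if_body_in_hyperplane det_jac_zero_if_flat by blast
    moreover have "measure lebesgue body = 0"
      using v negligible_hyperplane[of v b] by (intro negligible_imp_measure0) (auto intro: negligible_subset)
    ultimately show ?thesis by (simp add: has_bochner_integral_zero)
  next
    case False
    have sub: "interior body \<subseteq> range moment" "range moment \<subseteq> body"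
      using interior_subset_range_moment moment_in_body by auto
    have neg: "negligible (body - interior body)"
      using negligible_convex_frontier[OF convex_body] compact_body
      by (simp add: frontier_def compact_imp_closed)
    have lm: "body \<in> lmeasurable" using compact_body by (rule lmeasurable_compact)
    have "negligible (body - range moment)" "negligible (range moment - body)"
      using sub neg by (auto intro: negligible_subset)
    then have sd: "negligible (sym_diff body (range moment))" by simp
    have "range moment \<in> lmeasurable"
      using lmeasurable_negligible_symdiff[OF lm sd] .
    moreover have "measure lebesgue (range moment) = measure lebesgue body"
      using measure_negligible_symdiff[OF lm sd] .
    moreover have "(moment has_derivative (*v) (jac x)) (at x within UNIV)" for x
      using moment_deriv by simp
    ultimately have hi: "((\<lambda>x. \<bar>det (matrix ((*v) (jac x)))\<bar>) has_integral measure lebesgue body) UNIV"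
      using has_measure_differentiable_image[of UNIV moment "\<lambda>x. (*v) (jac x)" "measure lebesgue body"] inj_moment[OF False]
      by auto
    then have hi: "((\<lambda>x. det (jac x)) has_integral measure lebesgue body) UNIV"
      using det_jac_nonneg by (simp add: matrix_of_matrix_vector_mul)
    then have ai: "(\<lambda>x. det (jac x)) absolutely_integrable_on UNIV"
      using det_jac_nonneg by (intro nonnegative_absolutely_integrable_1) auto
    then have "integrable lebesgue (\<lambda>x. det (jac x))"
      by (simp add: set_integrable_def)
    moreover from this have "integral\<^sup>L lebesgue (\<lambda>x. det (jac x)) = measure lebesgue body"
      using has_integral_integral_lebesgue hi has_integral_unique by blast
    ultimately show ?thesis by (simp add: has_bochner_integral_iff)
  qed
  then show ?thesis by (simp add: jac_def body_def)
qed



section \<open>Outer approximation by polytopes\<close>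

lemma compact_set_plus:
  fixes S :: "'a::real_normed_vector set"
  assumes "compact S" "compact T"
  shows "compact (S + T)"
proof -
  have "S + T = {x + y |x y. x \<in> S \<and> y \<in> T}" by (auto simp: set_plus_def)
  then show ?thesis using compact_sums[OF assms] by simp
qed

lemma scaleR_set_plus: "(*\<^sub>R) c ` (S + T) = (*\<^sub>R) c ` S + (*\<^sub>R) c ` T"
  for S T :: "'a::real_vector set"
  by (force simp: set_plus_def scaleR_add_right)

lemma scaleR_add_convex:
  fixes K :: "'a::real_vector set"
  assumes "convex K" "0 \<le> a" "0 \<le> b"
  shows "(*\<^sub>R) (a + b) ` K = (*\<^sub>R) a ` K + (*\<^sub>R) b ` K"
proof
  show "(*\<^sub>R) (a + b) ` K \<subseteq> (*\<^sub>R) a ` K + (*\<^sub>R) b ` K"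
    by (force simp: set_plus_def scaleR_add_left)
  show "(*\<^sub>R) a ` K + (*\<^sub>R) b ` K \<subseteq> (*\<^sub>R) (a + b) ` K"
  proof
    fix z assume "z \<in> (*\<^sub>R) a ` K + (*\<^sub>R) b ` K"
    then obtain x y where xy: "x \<in> K" "y \<in> K" "z = a *\<^sub>R x + b *\<^sub>R y"
      by (auto simp: set_plus_def)
    show "z \<in> (*\<^sub>R) (a + b) ` K"
    proof (cases "a + b = 0")
      case True
      then have "a = 0" "b = 0" using assms by auto
      then show ?thesis using xy by auto
    next
      case False
      then have "a + b > 0" using assms by simp
      then have "(a / (a + b)) *\<^sub>R x + (b / (a + b)) *\<^sub>R y \<in> K"
        using assms xy by (intro convexD) (auto simp: divide_simps)
      moreover have "z = (a + b) *\<^sub>R ((a / (a + b)) *\<^sub>R x + (b / (a + b)) *\<^sub>R y)"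
        using False xy by (simp add: scaleR_add_right)
      ultimately show ?thesis by blast
    qed
  qed
qed

lemma scaleR_sum_convex:
  fixes K :: "'a::real_vector set"
  assumes "convex K" "K \<noteq> {}" "\<And>i. i \<in> S \<Longrightarrow> 0 \<le> c i"
  shows "(*\<^sub>R) (\<Sum>i\<in>S. c i) ` K = (\<Sum>i\<in>S. (*\<^sub>R) (c i) ` K)"
  using assms(3)
proof (induction S rule: infinite_finite_induct)
  case (insert i S)
  then show ?case by (simp add: scaleR_add_convex[OF assms(1)] sum_nonneg)
qed (use assms(2) in \<open>auto simp: set_zero\<close>)

text \<open>
  Convergence from outside in the Hausdorff sense. It is preserved by Minkowski combinations, and
  volume is continuous along it even when the limit has no interior.
\<close>

definition shrinks_to :: "(nat \<Rightarrow> 'a::real_normed_vector set) \<Rightarrow> 'a set \<Rightarrow> bool" where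
  "shrinks_to P K \<longleftrightarrow> (\<forall>k. K \<subseteq> P k) \<and> (\<forall>e>0. \<forall>\<^sub>F k in sequentially. P k \<subseteq> K + cball 0 e)"

lemma cball_plus_cball: "cball (0::'a::real_normed_vector) d + cball 0 e \<subseteq> cball 0 (d + e)"
  by (auto simp: set_plus_def intro: norm_triangle_mono)

lemma shrinks_to_plus:
  assumes "shrinks_to P K" "shrinks_to Q L"
  shows "shrinks_to (\<lambda>k. P k + Q k) (K + L)"
  unfolding shrinks_to_def
proof (intro conjI allI impI)
  show "K + L \<subseteq> P k + Q k" for k
    using assms unfolding shrinks_to_def by (intro set_plus_mono2) auto
  fix e :: real assume "e > 0"
  then have "\<forall>\<^sub>F k in sequentially. P k \<subseteq> K + cball 0 (e/2) \<and> Q k \<subseteq> L + cball 0 (e/2)"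
    using assms unfolding shrinks_to_def by (intro eventually_conj) auto
  then show "\<forall>\<^sub>F k in sequentially. P k + Q k \<subseteq> K + L + cball 0 e"
  proof eventually_elim
    case (elim k)
    then have "P k + Q k \<subseteq> (K + cball 0 (e/2)) + (L + cball 0 (e/2))"
      by (intro set_plus_mono2) auto
    also have "\<dots> = (K + L) + (cball 0 (e/2) + cball 0 (e/2))"
      by (simp add: ac_simps)
    also have "\<dots> \<subseteq> (K + L) + cball 0 e"
      using cball_plus_cball[of "e/2" "e/2"] by (intro set_plus_mono2) auto
    finally show ?case .
  qed
qed

lemma shrinks_to_scaleR:
  assumes "shrinks_to P K"
  shows "shrinks_to (\<lambda>k. (*\<^sub>R) c ` P k) ((*\<^sub>R) c ` K)"
  unfolding shrinks_to_def
proof (intro conjI allI impI)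
  show "(*\<^sub>R) c ` K \<subseteq> (*\<^sub>R) c ` P k" for k
    using assms unfolding shrinks_to_def by (intro image_mono) auto
  fix e :: real assume "e > 0"
  define d where "d = e / (\<bar>c\<bar> + 1)"
  have d: "d > 0" "\<bar>c\<bar> * d \<le> e" using \<open>e > 0\<close> by (auto simp: d_def field_simps)
  have "\<forall>\<^sub>F k in sequentially. P k \<subseteq> K + cball 0 d"
    using assms d unfolding shrinks_to_def by auto
  then show "\<forall>\<^sub>F k in sequentially. (*\<^sub>R) c ` P k \<subseteq> (*\<^sub>R) c ` K + cball 0 e"
  proof eventually_elim
    case (elim k)
    then have "(*\<^sub>R) c ` P k \<subseteq> (*\<^sub>R) c ` (K + cball 0 d)" by (intro image_mono)
    also have "\<dots> = (*\<^sub>R) c ` K + (*\<^sub>R) c ` cball 0 d" by (rule scaleR_set_plus)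
    also have "\<dots> \<subseteq> (*\<^sub>R) c ` K + cball 0 e"
    proof (intro set_plus_mono2 order_refl image_subsetI)
      fix x :: 'a assume "x \<in> cball 0 d"
      then have "\<bar>c\<bar> * norm x \<le> \<bar>c\<bar> * d" by (intro mult_left_mono) auto
      then show "c *\<^sub>R x \<in> cball 0 e" using d by simp
    qed
    finally show ?case .
  qed
qed

lemma shrinks_to_const: "shrinks_to (\<lambda>_. K) K"
proof -
  have "K \<subseteq> K + cball 0 e" if "e > 0" for e
    using that set_zero_plus2[of "cball 0 e" K] by (simp add: add.commute)
  then show ?thesis by (simp add: shrinks_to_def)
qed

lemma shrinks_to_sum:
  assumes "\<And>i. i \<in> I \<Longrightarrow> shrinks_to (\<lambda>k. P k i) (K i)"
  shows "shrinks_to (\<lambda>k. \<Sum>i\<in>I. P k i) (\<Sum>i\<in>I. K i)"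
  using assms
  by (induction I rule: infinite_finite_induct) (auto intro: shrinks_to_plus shrinks_to_const)

lemma measure_fattening:
  fixes K :: "'a::euclidean_space set"
  assumes "compact K" "0 < \<epsilon>"
  shows "\<exists>e>0. measure lebesgue (K + cball 0 e) < measure lebesgue K + \<epsilon>"
proof -
  let ?F = "\<lambda>m. K + cball (0::'a) (1 / real (Suc m))"
  have cF: "compact (?F m)" for m using assms by (intro compact_set_plus compact_cball)
  have "decseq ?F"
    by (intro decseq_SucI set_plus_mono2 order_refl subset_cball) (simp add: field_simps)
  moreover have "range ?F \<subseteq> sets lebesgue"
    using cF by (auto intro!: lmeasurable_compact fmeasurableD)
  moreover have "emeasure lebesgue (?F m) \<noteq> \<infinity>" for m
    using lmeasurable_compact[OF cF[of m]] by (metis fmeasurableD2 infinity_ennreal_def)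
  ultimately have "(\<lambda>m. measure lebesgue (?F m)) \<longlonglongrightarrow> measure lebesgue (\<Inter>m. ?F m)"
    by (intro Lim_measure_decseq)
  moreover have "(\<Inter>m. ?F m) = K"
  proof
    show "K \<subseteq> (\<Inter>m. ?F m)"
      using set_zero_plus2[of "cball 0 (1 / real (Suc m))" K for m] by (auto simp: add.commute)
    show "(\<Inter>m. ?F m) \<subseteq> K"
    proof
      fix x assume x: "x \<in> (\<Inter>m. ?F m)"
      then have "K \<noteq> {}" by (auto simp: set_plus_def)
      have "infdist x K \<le> 1 / real (Suc m)" for m
      proof -
        have "x \<in> ?F m" using x by blast
        then obtain y z where "x = y + z" "y \<in> K" "norm z \<le> 1 / real (Suc m)"
          by (auto elim!: set_plus_elim)
        then show ?thesis using infdist_le[of y K x] by (simp add: dist_norm)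
      qed
      then have "infdist x K \<le> 0"
        by (intro LIMSEQ_le_const[OF LIMSEQ_Suc[OF lim_1_over_n]]) auto
      then show "x \<in> K"
        using assms \<open>K \<noteq> {}\<close> in_closed_iff_infdist_zero[OF compact_imp_closed, of K x] infdist_nonneg[of x K]
        by simp
    qed
  qed
  ultimately have "\<forall>\<^sub>F m in sequentially. measure lebesgue (?F m) < measure lebesgue K + \<epsilon>"
    using assms(2) by (intro order_tendstoD(2)) auto
  then obtain m where "measure lebesgue (?F m) < measure lebesgue K + \<epsilon>"
    by (meson eventually_sequentially order_refl)
  then show ?thesis by (intro exI[of _ "1 / real (Suc m)"]) auto
qed

lemma measure_shrinks_to:
  fixes K :: "'a::euclidean_space set"
  assumes P: "shrinks_to P K" and K: "compact K" and cP: "\<And>k. compact (P k)"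
  shows "(\<lambda>k. measure lebesgue (P k)) \<longlonglongrightarrow> measure lebesgue K"
proof (rule order_tendstoI)
  fix a assume "a < measure lebesgue K"
  moreover have "measure lebesgue K \<le> measure lebesgue (P k)" for k
    using P K cP unfolding shrinks_to_def
    by (intro measure_mono_fmeasurable) (auto intro: lmeasurable_compact fmeasurableD)
  ultimately show "\<forall>\<^sub>F k in sequentially. a < measure lebesgue (P k)"
    by (intro always_eventually) (auto intro: less_le_trans)
next
  fix a assume "measure lebesgue K < a"
  then obtain e where e: "e > 0" "measure lebesgue (K + cball 0 e) < a"
    using measure_fattening[OF K, of "a - measure lebesgue K"] by auto
  have "\<forall>\<^sub>F k in sequentially. P k \<subseteq> K + cball 0 e"
    using P e unfolding shrinks_to_def by auto
  then show "\<forall>\<^sub>F k in sequentially. measure lebesgue (P k) < a"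
  proof eventually_elim
    case (elim k)
    have "compact (K + cball 0 e)" using K by (intro compact_set_plus compact_cball)
    with elim have "measure lebesgue (P k) \<le> measure lebesgue (K + cball 0 e)"
      using cP[of k] by (intro measure_mono_fmeasurable) (auto intro: lmeasurable_compact fmeasurableD)
    then show ?case using e by simp
  qed
qed

text \<open>
  The set of points at distance exactly \<open>e\<close> from \<open>K\<close> is compact, so finitely many half-spaces
  containing \<open>K\<close> exclude all of it. Their intersection is connected and meets \<open>K\<close>, hence stays within
  distance \<open>e\<close>.
\<close>

lemma polytope_approximation:
  fixes K :: "'a::euclidean_space set"
  assumes K: "compact K" "convex K" "K \<noteq> {}" and e: "0 < e"
  shows "\<exists>P. polytope P \<and> K \<subseteq> P \<and> P \<subseteq> K + cball 0 e"
proof -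
  define S where "S = {x. infdist x K = e}"
  have bd: "bounded (K + cball 0 e)"
    using K by (intro compact_imp_bounded compact_set_plus compact_cball)
  have near: "x \<in> K + cball 0 e" if x: "infdist x K \<le> e" for x
  proof -
    obtain y where y: "y \<in> K" "infdist x K = dist x y"
      using infdist_attains_inf[OF compact_imp_closed[OF K(1)] K(3), of x] by blast
    have "x = y + (x - y)" "x - y \<in> cball 0 e"
      using x y by (auto simp: dist_norm norm_minus_commute)
    with y(1) show ?thesis by (metis set_plus_intro)
  qed
  have cont: "continuous_on UNIV (\<lambda>x. infdist x K)"
    by (intro continuous_intros)
  have "closed S"
    unfolding S_def using continuous_closed_vimage[of "{e}" "\<lambda>x. infdist x K"] cont
    by (simp add: vimage_def closed_Collect_eq)
  moreover have "bounded S" by (rule bounded_subset[OF bd]) (use near in \<open>auto simp: S_def\<close>)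
  ultimately have "compact S" by (simp add: compact_eq_bounded_closed)
  have "\<exists>u h. K \<subseteq> {z. u \<bullet> z \<le> h} \<and> h < u \<bullet> x \<and> u \<noteq> 0" if "x \<in> S" for x
  proof -
    have "x \<notin> K" using that e by (auto simp: S_def)
    then obtain a b where "a \<bullet> x < b" "\<forall>z\<in>K. b < a \<bullet> z"
      using separating_hyperplane_closed_point[OF K(2) compact_imp_closed[OF K(1)]] by blast
    then show ?thesis
      using K(3) by (intro exI[of _ "-a"] exI[of _ "-b"]) (auto intro: less_imp_le)
  qed
  then obtain u h where uh: "\<And>x. x \<in> S \<Longrightarrow> K \<subseteq> {z. u x \<bullet> z \<le> h x} \<and> h x < u x \<bullet> x \<and> u x \<noteq> 0"
    by metis
  have cover: "S \<subseteq> (\<Union>x\<in>S. {z. h x < u x \<bullet> z})"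
  proof
    fix x assume "x \<in> S"
    then show "x \<in> (\<Union>x\<in>S. {z. h x < u x \<bullet> z})" using uh[of x] by blast
  qed
  obtain X where X: "X \<subseteq> S" "finite X" "S \<subseteq> (\<Union>x\<in>X. {z. h x < u x \<bullet> z})"
    by (rule compactE_image[OF \<open>compact S\<close> _ cover]) (rule open_halfspace_gt)
  define P where "P = (\<Inter>x\<in>X. {z. u x \<bullet> z \<le> h x})"
  have "K \<subseteq> P"
    unfolding P_def
  proof (rule INT_greatest)
    fix x assume "x \<in> X"
    then show "K \<subseteq> {z. u x \<bullet> z \<le> h x}" using uh[of x] X(1) by blast
  qed
  have PS: "P \<inter> S = {}" using X(3) by (force simp: P_def)
  have "convex P" unfolding P_def by (intro convex_INT convex_halfspace_le)
  have sub: "P \<subseteq> K + cball 0 e"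
  proof
    fix x assume x: "x \<in> P"
    show "x \<in> K + cball 0 e"
    proof (rule ccontr)
      assume "x \<notin> K + cball 0 e"
      then have "e < infdist x K" using near not_less by blast
      moreover obtain y where y: "y \<in> K" using K by auto
      moreover have "connected ((\<lambda>x. infdist x K) ` P)"
        using \<open>convex P\<close> cont by (intro connected_continuous_image convex_connected) (auto intro: continuous_on_subset)
      moreover have "infdist y K \<in> (\<lambda>x. infdist x K) ` P" "infdist x K \<in> (\<lambda>x. infdist x K) ` P"
        using x y \<open>K \<subseteq> P\<close> by blast+
      ultimately have "e \<in> (\<lambda>x. infdist x K) ` P"
        using e connectedD_interval[of "(\<lambda>x. infdist x K) ` P" "infdist y K" "infdist x K" e]
        by simp
      then show False using PS by (auto simp: S_def)
    qed
  qed
  have "polyhedron P"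
    unfolding P_def using X by (intro polyhedron_Inter) (auto simp: polyhedron_halfspace_le)
  moreover have "bounded P" using sub bd bounded_subset by blast
  ultimately show ?thesis
    using \<open>K \<subseteq> P\<close> sub polytope_eq_bounded_polyhedron by blast
qed

lemma shrinking_polytopes:
  fixes K :: "'a::euclidean_space set"
  assumes "compact K" "convex K" "K \<noteq> {}"
  shows "\<exists>A. (\<forall>k. finite (A k) \<and> A k \<noteq> {}) \<and> shrinks_to (\<lambda>k. convex hull (A k)) K"
proof -
  have "\<exists>A. finite A \<and> K \<subseteq> convex hull A \<and> convex hull A \<subseteq> K + cball 0 (1 / real (Suc k))" for k
    using polytope_approximation[OF assms, of "1 / real (Suc k)"] unfolding polytope_def by auto
  then obtain A where A: "\<And>k. finite (A k)" "\<And>k. K \<subseteq> convex hull A k"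
    "\<And>k. convex hull A k \<subseteq> K + cball 0 (1 / real (Suc k))" by metis
  have "\<forall>\<^sub>F k in sequentially. convex hull (A k) \<subseteq> K + cball 0 e" if "e > 0" for e
  proof -
    have "(\<lambda>k. 1 / real (Suc k)) \<longlonglongrightarrow> 0" by (intro LIMSEQ_Suc[OF lim_1_over_n])
    then have "\<forall>\<^sub>F k in sequentially. 1 / real (Suc k) < e" using that by (rule order_tendstoD)
    then show ?thesis
    proof eventually_elim
      case (elim k)
      then have "K + cball 0 (1 / real (Suc k)) \<subseteq> K + cball 0 e"
        by (intro set_plus_mono2 order_refl subset_cball) simp
      then show ?case using A(3)[of k] by blast
    qed
  qed
  moreover have "A k \<noteq> {}" for k using A(2)[of k] assms(3) by auto
  ultimately show ?thesis using A unfolding shrinks_to_def by blast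
qed



section \<open>Mixed volumes by polarization\<close>

text \<open>
  The mixed volume of a family indexed by the coordinates, in the form dictated by
  \<open>mixed_discriminant_polarization\<close>.
\<close>

definition polarized_volume :: "('n::finite \<Rightarrow> (real^'n) set) \<Rightarrow> real" where
  "polarized_volume K = (\<Sum>S\<in>UNIV. (-1) ^ (CARD('n) - card S) * measure lebesgue (\<Sum>i\<in>S. K i)) / fact CARD('n)"

lemma polarized_volume_translate: "polarized_volume (\<lambda>a. {t a} + K a) = polarized_volume K"
proof -
  have "(\<Sum>i\<in>S. {t i}) = {\<Sum>i\<in>S. t i}" for S
    by (induction S rule: infinite_finite_induct) (auto simp: set_zero set_plus_def)
  moreover have "measure lebesgue ({b} + S) = measure lebesgue S" for b :: "real^'a" and S
    using measure_translation[of b S] by (simp add: translation_eq_singleton_plus)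
  ultimately have "measure lebesgue (\<Sum>i\<in>S. {t i} + K i) = measure lebesgue (\<Sum>i\<in>S. K i)" for S
    unfolding sum.distrib by metis
  then show ?thesis by (simp add: polarized_volume_def)
qed

lemma polarized_volume_permute:
  assumes "bij p"
  shows "polarized_volume (\<lambda>a. K (p a)) = polarized_volume K"
proof -
  have inj: "inj_on p S" for S using assms by (auto simp: bij_def inj_on_def)
  have "(\<Sum>S\<in>UNIV. (-1) ^ (CARD('a) - card S) * measure lebesgue (\<Sum>i\<in>S. K (p i))) =
    (\<Sum>S\<in>UNIV. (-1) ^ (CARD('a) - card (p ` S)) * measure lebesgue (\<Sum>i\<in>p ` S. K i))"
    using inj by (simp add: card_image sum.reindex)
  also have "\<dots> = (\<Sum>S\<in>UNIV. (-1) ^ (CARD('a) - card S) * measure lebesgue (\<Sum>i\<in>S. K i))"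
  proof (rule sum.reindex_bij_betw)
    show "bij (image p)"
      by (rule o_bij[where g="image (inv p)"])
        (use assms in \<open>auto simp: fun_eq_iff image_inv_f_f image_f_inv_f bij_def\<close>)
  qed
  finally show ?thesis by (simp add: polarized_volume_def)
qed

lemma polarized_volume_tendsto:
  fixes K :: "'n::finite \<Rightarrow> (real^'n) set"
  assumes "\<And>a. shrinks_to (\<lambda>k. P k a) (K a)" "\<And>a. compact (K a)" "\<And>k a. compact (P k a)"
  shows "(\<lambda>k. polarized_volume (P k)) \<longlonglongrightarrow> polarized_volume K"
  unfolding polarized_volume_def using assms
  by (intro tendsto_intros measure_shrinks_to shrinks_to_sum compact_set_sum) auto

text \<open>
  The polarization formulas on both sides agree term by term through \<open>integral_det_gibbs_cov\<close>,
  after collecting coefficients; for convex sets \<open>a K + b K = (a + b) K\<close>.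
\<close>

lemma integral_mixed_discriminant_gibbs_cov:
  fixes A :: "'i \<Rightarrow> (real^'n::{finite,wellorder}) set"
  assumes g: "gibbs_family I A w" and C: "\<And>a i. i \<in> I \<Longrightarrow> 0 \<le> C a i"
  shows "has_bochner_integral lebesgue (\<lambda>x. mixed_discriminant (\<lambda>a. \<Sum>i\<in>I. C a i *\<^sub>R gibbs_cov (A i) (w i) x))
    (polarized_volume (\<lambda>a. \<Sum>i\<in>I. (*\<^sub>R) (C a i) ` (convex hull A i)))"
proof -
  have ne: "A i \<noteq> {}" if "i \<in> I" for i using gibbs_family.ne[OF g that] .
  have mat: "(\<Sum>a\<in>S. \<Sum>i\<in>I. C a i *\<^sub>R gibbs_cov (A i) (w i) x) = (\<Sum>i\<in>I. (\<Sum>a\<in>S. C a i) *\<^sub>R gibbs_cov (A i) (w i) x)" for S x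
    by (subst sum.swap) (simp add: scaleR_left.sum)
  have set: "(\<Sum>a\<in>S. \<Sum>i\<in>I. (*\<^sub>R) (C a i) ` (convex hull A i)) = (\<Sum>i\<in>I. (*\<^sub>R) (\<Sum>a\<in>S. C a i) ` (convex hull A i))" for S
    using ne C by (subst sum.swap) (intro sum.cong refl scaleR_sum_convex[symmetric], auto)
  have "has_bochner_integral lebesgue (\<lambda>x. det (\<Sum>a\<in>S. \<Sum>i\<in>I. C a i *\<^sub>R gibbs_cov (A i) (w i) x))
     (measure lebesgue (\<Sum>a\<in>S. \<Sum>i\<in>I. (*\<^sub>R) (C a i) ` (convex hull A i)))" for S
    unfolding mat set using C by (intro integral_det_gibbs_cov[OF g] sum_nonneg)
  then show ?thesis
    unfolding mixed_discriminant_polarization polarized_volume_def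
    by (intro has_bochner_integral_divide_zero has_bochner_integral_sum has_bochner_integral_mult_right)
qed

lemma select_scaleR:
  assumes "finite I" "j \<in> I" "\<And>i. i \<in> I \<Longrightarrow> K i \<noteq> {}"
  shows "(\<Sum>i\<in>I. (*\<^sub>R) (of_bool (i = j)) ` K i) = (K j :: 'a::real_vector set)"
proof -
  have "(\<Sum>i\<in>I. (*\<^sub>R) (of_bool (i = j)) ` K i) = K j + (\<Sum>i\<in>I - {j}. (*\<^sub>R) (of_bool (i = j)) ` K i)"
    using assms by (simp add: sum.remove)
  also have "(\<Sum>i\<in>I - {j}. (*\<^sub>R) (of_bool (i = j)) ` K i) = 0"
    using assms(3) by (intro sum.neutral) (auto simp: set_zero)
  finally show ?thesis by (simp only: add_0_right)
qed

lemma integral_mixed_discriminant_gibbs_cov_select: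
  fixes A :: "'i \<Rightarrow> (real^'n::{finite,wellorder}) set"
  assumes g: "gibbs_family I A w" and f: "\<And>a. f a \<in> I"
  shows "has_bochner_integral lebesgue (\<lambda>x. mixed_discriminant (\<lambda>a. gibbs_cov (A (f a)) (w (f a)) x)) (polarized_volume (\<lambda>a. convex hull A (f a)))"
proof -
  have "finite I" and ne: "\<And>i. i \<in> I \<Longrightarrow> A i \<noteq> {}"
    using gibbs_family.fin_I[OF g] gibbs_family.ne[OF g] by auto
  then have "(\<Sum>i\<in>I. of_bool (i = f a) *\<^sub>R gibbs_cov (A i) (w i) x) = gibbs_cov (A (f a)) (w (f a)) x" for a x
    using f[of a] by (simp add: of_bool_def if_distrib[of "\<lambda>r. r *\<^sub>R _"] cong: if_cong)
  moreover have "(\<Sum>i\<in>I. (*\<^sub>R) (of_bool (i = f a)) ` (convex hull A i)) = convex hull A (f a)" for a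
    using \<open>finite I\<close> f ne by (intro select_scaleR) auto
  ultimately show ?thesis
    using integral_mixed_discriminant_gibbs_cov[OF g, of "\<lambda>a i. of_bool (i = f a)"] by simp
qed

text \<open>
  The integrand identity is \<open>det_sum_mixed_discriminant\<close>.
\<close>

lemma polarized_volume_expand_polytopes:
  fixes A :: "'i \<Rightarrow> (real^'n::{finite,wellorder}) set"
  assumes "finite I" "\<And>i. i \<in> I \<Longrightarrow> finite (A i) \<and> A i \<noteq> {}" "\<And>i. i \<in> I \<Longrightarrow> 0 \<le> c i"
  shows "measure lebesgue (\<Sum>i\<in>I. (*\<^sub>R) (c i) ` (convex hull A i)) =
    (\<Sum>f\<in>PiE UNIV (\<lambda>_. I). (\<Prod>a\<in>UNIV. c (f a)) * polarized_volume (\<lambda>a. convex hull A (f a)))"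
proof -
  define w where "w = (\<lambda>(_::'i) (_::real^'n::{finite,wellorder}). 1 :: real)"
  have g: "gibbs_family I A w" using assms by unfold_locales (auto simp: w_def)
  have "has_bochner_integral lebesgue (\<lambda>x. det (\<Sum>i\<in>I. c i *\<^sub>R gibbs_cov (A i) (w i) x))
    (measure lebesgue (\<Sum>i\<in>I. (*\<^sub>R) (c i) ` (convex hull A i)))"
    using assms by (intro integral_det_gibbs_cov[OF g])
  moreover have "has_bochner_integral lebesgue (\<lambda>x. det (\<Sum>i\<in>I. c i *\<^sub>R gibbs_cov (A i) (w i) x))
    (\<Sum>f\<in>PiE UNIV (\<lambda>_. I). (\<Prod>a\<in>UNIV. c (f a)) * polarized_volume (\<lambda>a. convex hull A (f a)))"
    unfolding det_sum_mixed_discriminant[OF assms(1)]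
    by (intro has_bochner_integral_sum has_bochner_integral_mult_right integral_mixed_discriminant_gibbs_cov_select[OF g]) auto
  ultimately show ?thesis by (rule has_bochner_integral_eq)
qed

lemma obtain_shrinking_polytopes:
  fixes K :: "'i \<Rightarrow> 'a::euclidean_space set"
  assumes "\<And>i. i \<in> I \<Longrightarrow> K i \<in> compact_convex_sets"
  obtains A where "\<And>k i. i \<in> I \<Longrightarrow> finite (A k i) \<and> A k i \<noteq> {}"
    "\<And>i. i \<in> I \<Longrightarrow> shrinks_to (\<lambda>k. convex hull (A k i)) (K i)"
proof -
  have "\<forall>i\<in>I. \<exists>A. (\<forall>k. finite (A k) \<and> A k \<noteq> {}) \<and> shrinks_to (\<lambda>k. convex hull (A k)) (K i)"
    using assms by (intro ballI shrinking_polytopes) (auto simp: compact_convex_sets_def)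
  then obtain A where A: "\<forall>i\<in>I. (\<forall>k. finite (A i k) \<and> A i k \<noteq> {}) \<and> shrinks_to (\<lambda>k. convex hull (A i k)) (K i)"
    by (rule bchoice[THEN exE])
  show ?thesis
    by (rule that[of "\<lambda>k i. A i k"]) (use A in auto)
qed

lemma polarized_volume_expand:
  fixes K :: "'i \<Rightarrow> (real^'n::{finite,wellorder}) set"
  assumes I: "finite I" and K: "\<And>i. i \<in> I \<Longrightarrow> K i \<in> compact_convex_sets" and c: "\<And>i. i \<in> I \<Longrightarrow> 0 \<le> c i"
  shows "measure lebesgue (\<Sum>i\<in>I. (*\<^sub>R) (c i) ` K i) =
    (\<Sum>f\<in>PiE UNIV (\<lambda>_. I). (\<Prod>a\<in>UNIV. c (f a)) * polarized_volume (\<lambda>a. K (f a)))"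
proof -
  obtain A where A: "\<And>k i. i \<in> I \<Longrightarrow> finite (A k i) \<and> A k i \<noteq> {}"
    and sh: "\<And>i. i \<in> I \<Longrightarrow> shrinks_to (\<lambda>k. convex hull (A k i)) (K i)"
    by (rule obtain_shrinking_polytopes[of I K]) (use K in auto)
  have cA: "compact (convex hull (A k i))" if "i \<in> I" for k i
    using A[OF that] by (simp add: finite_imp_compact_convex_hull)
  have cK: "compact (K i)" if "i \<in> I" for i using K[OF that] by (simp add: compact_convex_sets_def)
  have "(\<lambda>k. measure lebesgue (\<Sum>i\<in>I. (*\<^sub>R) (c i) ` (convex hull A k i))) \<longlonglongrightarrow>
     measure lebesgue (\<Sum>i\<in>I. (*\<^sub>R) (c i) ` K i)"
    by (intro measure_shrinks_to shrinks_to_sum shrinks_to_scaleR sh compact_set_sum compact_scaling cA cK)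
  moreover have "(\<lambda>k. \<Sum>f\<in>PiE UNIV (\<lambda>_. I). (\<Prod>a\<in>UNIV. c (f a)) * polarized_volume (\<lambda>a. convex hull A k (f a))) \<longlonglongrightarrow>
     (\<Sum>f\<in>PiE UNIV (\<lambda>_. I). (\<Prod>a\<in>UNIV. c (f a)) * polarized_volume (\<lambda>a. K (f a)))"
    by (intro tendsto_intros polarized_volume_tendsto sh cA cK) auto
  ultimately show ?thesis
    using polarized_volume_expand_polytopes[OF I A c] LIMSEQ_unique by fastforce
qed

text \<open>
  A Minkowski combination of hulls is again a hull, but its own Hessian is not the combination of
  the two Hessians. Therefore all sets are put into one family indexed by \<open>'n + bool\<close>, whose
  coefficients \<open>C\<close> select either a single set or the combination at position \<open>j\<close>.
\<close>

lemma polarized_volume_linear_polytopes: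
  fixes A :: "'n \<Rightarrow> (real^'n::{finite,wellorder}) set"
  assumes A: "\<And>a. finite (A a) \<and> A a \<noteq> {}" and B: "finite B" "B \<noteq> {}" and D: "finite D" "D \<noteq> {}"
    and xy: "0 \<le> x" "0 \<le> y"
  defines "K \<equiv> \<lambda>a. convex hull (A a)"
  shows "polarized_volume (K(j := (*\<^sub>R) x ` (convex hull B) + (*\<^sub>R) y ` (convex hull D))) =
    x * polarized_volume (K(j := convex hull B)) + y * polarized_volume (K(j := convex hull D))"
proof -
  define F :: "'n + bool \<Rightarrow> (real^'n::{finite,wellorder}) set" where "F = case_sum A (\<lambda>b. if b then B else D)"
  define w where "w = (\<lambda>(_::'n + bool) (_::real^'n::{finite,wellorder}). 1 :: real)"
  have g: "gibbs_family UNIV F w"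
    using A B D by unfold_locales (auto simp: w_def F_def split: sum.splits)
  define M where "M i z = gibbs_cov (F i) (w i) z" for i z
  define C where "C s t a i = (if a = j then (case i of Inl b \<Rightarrow> 0 | Inr b \<Rightarrow> if b then s else t)
     else (of_bool (i = Inl a) :: real))" for s t :: real and a :: 'n and i :: "'n + bool"
  have neF: "convex hull (F i) \<noteq> {}" for i using gibbs_family.ne[OF g] by auto
  have neA: "convex hull (A i) \<noteq> {}" for i using A by auto
  have univ: "(UNIV :: ('n + bool) set) = range Inl \<union> {Inr True, Inr False}"
    using UNIV_sum UNIV_bool by auto
  have mat: "(\<Sum>i\<in>UNIV. C s t a i *\<^sub>R M i z) =
      ((\<lambda>a. M (Inl a) z)(j := s *\<^sub>R M (Inr True) z + t *\<^sub>R M (Inr False) z)) a" for s t a z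
    unfolding univ
    by (subst sum.union_disjoint)
      (auto simp: C_def sum.reindex if_distrib[of "\<lambda>r. r *\<^sub>R _"] of_bool_def cong: if_cong)
  have set: "(\<Sum>i\<in>UNIV. (*\<^sub>R) (C s t a i) ` (convex hull F i)) =
      (K(j := (*\<^sub>R) s ` (convex hull B) + (*\<^sub>R) t ` (convex hull D))) a" for s t a
  proof (cases "a = j")
    case True
    have "(\<Sum>i\<in>range Inl. (*\<^sub>R) (C s t a i) ` (convex hull F i)) = 0"
      using neA True by (intro sum.neutral) (auto simp: C_def F_def set_zero image_constant_conv)
    moreover have "(\<Sum>i\<in>{Inr True, Inr False}. (*\<^sub>R) (C s t a i) ` (convex hull F i)) =
        (*\<^sub>R) s ` (convex hull B) + (*\<^sub>R) t ` (convex hull D)"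
      using True by (simp add: C_def F_def)
    moreover have "(\<Sum>i\<in>UNIV. (*\<^sub>R) (C s t a i) ` (convex hull F i)) =
       (\<Sum>i\<in>range Inl. (*\<^sub>R) (C s t a i) ` (convex hull F i)) +
       (\<Sum>i\<in>{Inr True, Inr False}. (*\<^sub>R) (C s t a i) ` (convex hull F i))"
      unfolding univ by (rule sum.union_disjoint) auto
    ultimately show ?thesis using True by (simp only: add_0_left fun_upd_same)
  next
    case False
    then have "(\<Sum>i\<in>UNIV. (*\<^sub>R) (C s t a i) ` (convex hull F i)) = convex hull F (Inl a)"
      using select_scaleR[of UNIV "Inl a" "\<lambda>i. convex hull F i"] neF by (simp add: C_def)
    then show ?thesis using False by (simp add: F_def K_def)
  qed
  have int: "has_bochner_integral lebesgue (\<lambda>z. mixed_discriminant ((\<lambda>a. M (Inl a) z)(j := s *\<^sub>R M (Inr True) z + t *\<^sub>R M (Inr False) z)))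
     (polarized_volume (K(j := (*\<^sub>R) s ` (convex hull B) + (*\<^sub>R) t ` (convex hull D))))" if "0 \<le> s" "0 \<le> t" for s t
  proof -
    have "has_bochner_integral lebesgue (\<lambda>z. mixed_discriminant (\<lambda>a. \<Sum>i\<in>UNIV. C s t a i *\<^sub>R M i z))
      (polarized_volume (\<lambda>a. \<Sum>i\<in>UNIV. (*\<^sub>R) (C s t a i) ` (convex hull F i)))"
      unfolding M_def using that by (intro integral_mixed_discriminant_gibbs_cov[OF g]) (auto simp: C_def split: sum.splits)
    then show ?thesis unfolding mat set by (simp only:)
  qed
  have one: "(*\<^sub>R) 1 ` (convex hull B) + (*\<^sub>R) 0 ` (convex hull D) = convex hull B"
    "(*\<^sub>R) 0 ` (convex hull B) + (*\<^sub>R) 1 ` (convex hull D) = convex hull D"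
    using B D by (simp_all add: image_constant_conv)
  have "has_bochner_integral lebesgue (\<lambda>z. mixed_discriminant ((\<lambda>a. M (Inl a) z)(j := x *\<^sub>R M (Inr True) z + y *\<^sub>R M (Inr False) z)))
     (x * polarized_volume (K(j := convex hull B)) + y * polarized_volume (K(j := convex hull D)))"
    unfolding mixed_discriminant_linear
    using int[of 1 0, unfolded one] int[of 0 1, unfolded one]
    by (intro has_bochner_integral_add has_bochner_integral_mult_right) simp_all
  then show ?thesis using int[OF xy] has_bochner_integral_eq by blast
qed

lemma polarized_volume_linear:
  fixes K :: "'n \<Rightarrow> (real^'n::{finite,wellorder}) set"
  assumes K: "\<And>a. K a \<in> compact_convex_sets" and X: "X \<in> compact_convex_sets" and Y: "Y \<in> compact_convex_sets"
    and xy: "0 \<le> x" "0 \<le> y"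
  shows "polarized_volume (K(j := (*\<^sub>R) x ` X + (*\<^sub>R) y ` Y)) = x * polarized_volume (K(j := X)) + y * polarized_volume (K(j := Y))"
proof -
  obtain A where A: "\<And>k a. finite (A k a) \<and> A k a \<noteq> {}"
    and sh: "\<And>a. shrinks_to (\<lambda>k. convex hull (A k a)) (K a)"
    by (rule obtain_shrinking_polytopes[of UNIV K]) (use K in auto)
  obtain B where B: "\<And>k. finite (B k)" "\<And>k. B k \<noteq> {}" and shB: "shrinks_to (\<lambda>k. convex hull (B k)) X"
    using shrinking_polytopes[of X] X by (auto simp: compact_convex_sets_def)
  obtain D where D: "\<And>k. finite (D k)" "\<And>k. D k \<noteq> {}" and shD: "shrinks_to (\<lambda>k. convex hull (D k)) Y"
    using shrinking_polytopes[of Y] Y by (auto simp: compact_convex_sets_def)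
  have cK: "compact (K a)" "compact X" "compact Y" for a
    using K X Y by (auto simp: compact_convex_sets_def)
  have cA: "compact (convex hull (A k a))" "compact (convex hull (B k))" "compact (convex hull (D k))" for k a
    using A B D by (auto intro!: finite_imp_compact_convex_hull)
  have tends: "(\<lambda>k. polarized_volume ((\<lambda>a. convex hull (A k a))(j := Q k))) \<longlonglongrightarrow> polarized_volume (K(j := Z))"
    if "shrinks_to Q Z" "compact Z" "\<And>k. compact (Q k)" for Q Z
    using that sh cA cK by (intro polarized_volume_tendsto) (auto simp: fun_upd_def)
  have "(\<lambda>k. polarized_volume ((\<lambda>a. convex hull (A k a))(j := (*\<^sub>R) x ` (convex hull (B k)) + (*\<^sub>R) y ` (convex hull (D k)))))
     \<longlonglongrightarrow> polarized_volume (K(j := (*\<^sub>R) x ` X + (*\<^sub>R) y ` Y))"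
    by (intro tends shrinks_to_plus shrinks_to_scaleR shB shD compact_set_plus compact_scaling cK cA)
  moreover have "(\<lambda>k. x * polarized_volume ((\<lambda>a. convex hull (A k a))(j := convex hull (B k))) + y * polarized_volume ((\<lambda>a. convex hull (A k a))(j := convex hull (D k))))
     \<longlonglongrightarrow> x * polarized_volume (K(j := X)) + y * polarized_volume (K(j := Y))"
    by (intro tendsto_intros tends shB shD cK cA)
  ultimately show ?thesis
    unfolding polarized_volume_linear_polytopes[OF A B D xy] by (rule LIMSEQ_unique)
qed



section \<open>Monotonicity\<close>

lemma tendsto_det:
  fixes X :: "nat \<Rightarrow> real^'n^'n"
  assumes "X \<longlonglongrightarrow> Y"
  shows "(\<lambda>k. det (X k)) \<longlonglongrightarrow> det Y"
  unfolding det_def using assms by (intro tendsto_intros)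

lemma tendsto_mixed_discriminant:
  fixes M :: "nat \<Rightarrow> 'n::finite \<Rightarrow> real^'n^'n"
  assumes "\<And>a. (\<lambda>k. M k a) \<longlonglongrightarrow> N a"
  shows "(\<lambda>k. mixed_discriminant (M k)) \<longlonglongrightarrow> mixed_discriminant N"
  unfolding mixed_discriminant_def using assms
  by (intro tendsto_divide tendsto_sum tendsto_det tendsto_const tendsto_vec_lambda tendsto_vec_nth) auto

lemma fatou_bound:
  assumes f: "\<And>k. has_bochner_integral M (f k) (c::real)" and F: "has_bochner_integral M F d"
    and nn: "\<And>k x. 0 \<le> f k x" "\<And>x. 0 \<le> F x" and lim: "\<And>x. (\<lambda>k. f k x) \<longlonglongrightarrow> F x"
  shows "d \<le> c"
proof -
  have nnf: "(\<integral>\<^sup>+ x. ennreal (f k x) \<partial>M) = ennreal c" for k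
    using f[of k] nn by (simp add: nn_integral_eq_integral has_bochner_integral_iff)
  have "c = (\<integral>x. f 0 x \<partial>M)" using f[of 0] by (simp add: has_bochner_integral_iff)
  then have "0 \<le> c" using nn by (simp add: integral_nonneg)
  have "ennreal d = (\<integral>\<^sup>+ x. ennreal (F x) \<partial>M)"
    using F nn by (simp add: nn_integral_eq_integral has_bochner_integral_iff)
  also have "\<dots> = (\<integral>\<^sup>+ x. liminf (\<lambda>k. ennreal (f k x)) \<partial>M)"
    using lim by (intro nn_integral_cong lim_imp_Liminf[symmetric]) (auto intro: tendsto_ennrealI)
  also have "\<dots> \<le> liminf (\<lambda>k. \<integral>\<^sup>+ x. ennreal (f k x) \<partial>M)"
    using f by (intro nn_integral_liminf measurable_compose[OF _ measurable_ennreal])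
      (blast intro: borel_measurable_has_bochner_integral)
  also have "\<dots> = ennreal c" unfolding nnf by (simp add: Liminf_const)
  finally show ?thesis using \<open>0 \<le> c\<close> by (simp add: ennreal_le_iff)
qed

lemma gibbs_cov_tendsto_subset:
  fixes A :: "(real^'n::finite) set"
  assumes A: "finite B" "A \<subseteq> B" "A \<noteq> {}"
    and w: "\<And>p. p \<in> A \<Longrightarrow> (\<lambda>k. w k p) \<longlonglongrightarrow> 1" "\<And>p. p \<in> B - A \<Longrightarrow> (\<lambda>k. w k p) \<longlonglongrightarrow> 0"
  shows "(\<lambda>k. gibbs_cov B (w k) x) \<longlonglongrightarrow> gibbs_cov A (\<lambda>_. 1) x"
proof -
  define v where "v p = (of_bool (p \<in> A) :: real)" for p :: "real^'n"
  have "(\<lambda>k. w k p) \<longlonglongrightarrow> v p" if "p \<in> B" for p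
    using w[of p] that by (cases "p \<in> A") (auto simp: v_def)
  moreover have finA: "finite A" using A finite_subset by blast
  have Z: "(\<Sum>q\<in>B. v q * exp (x \<bullet> q)) = (\<Sum>q\<in>A. 1 * exp (x \<bullet> q))"
    using A by (intro sum.mono_neutral_cong_right) (auto simp: v_def)
  have pos: "0 < (\<Sum>q\<in>A. 1 * exp (x \<bullet> q))"
    using finA A by (intro sum_pos) auto
  ultimately have g: "(\<lambda>k. gibbs B (w k) x p) \<longlonglongrightarrow> gibbs B v x p" if "p \<in> B" for p
    using that pos Z unfolding gibbs_def by (intro tendsto_intros) auto
  have gv: "gibbs B v x p = of_bool (p \<in> A) * gibbs A (\<lambda>_. 1) x p" for p
    unfolding gibbs_def Z by (simp add: v_def)
  have "(\<lambda>k. gibbs_cov B (w k) x) \<longlonglongrightarrow> gibbs_cov B v x"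
    unfolding gibbs_cov_def case_prod_unfold using g by (intro tendsto_intros) auto
  also have "gibbs_cov B v x = gibbs_cov A (\<lambda>_. 1) x"
    unfolding gibbs_cov_def gv using A by (intro sum.mono_neutral_cong_right) auto
  finally show ?thesis .
qed

text \<open>
  Both sides are integrals of mixed discriminants. The additional points of \<open>B\<close> receive the weight
  \<open>1 / Suc k\<close>: the integral does not depend on \<open>k\<close>, while the integrand tends pointwise to that for
  \<open>A j\<close>. Mass may escape in the limit, so Fatou's lemma yields only an inequality.
\<close>

lemma polarized_volume_mono_polytopes:
  fixes A :: "'n \<Rightarrow> (real^'n::{finite,wellorder}) set"
  assumes A: "\<And>a. finite (A a) \<and> A a \<noteq> {}" and B: "finite B" "A j \<subseteq> B"
  shows "polarized_volume (\<lambda>a. convex hull (A a)) \<le> polarized_volume ((\<lambda>a. convex hull (A a))(j := convex hull B))"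
proof -
  define w where "w k i p = (if i = j \<and> p \<notin> A j then 1 / real (Suc k) else 1)" for k i p
  let ?A = "A(j := B)"
  have neB: "B \<noteq> {}" using A[of j] B by auto
  have g: "gibbs_family UNIV ?A (w k)" for k
    using A B neB by unfold_locales (auto simp: w_def)
  have g1: "gibbs_family UNIV A (\<lambda>_ _. 1)"
    using A by unfold_locales auto
  have nn: "0 \<le> mixed_discriminant (\<lambda>a. gibbs_cov (F a) (u a) x)" if "gibbs_family UNIV F u" for F u x
    using gibbs_family.mixed_discriminant_gibbs_cov_nonneg[OF that, of "\<lambda>a i. of_bool (i = a)" x]
    by (simp add: of_bool_def if_distrib[of "\<lambda>r. r *\<^sub>R _"] cong: if_cong)
  have "(\<lambda>k. mixed_discriminant (\<lambda>a. gibbs_cov (?A a) (w k a) x)) \<longlonglongrightarrow> mixed_discriminant (\<lambda>a. gibbs_cov (A a) (\<lambda>_. 1) x)" for x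
  proof (intro tendsto_mixed_discriminant)
    fix a
    have "(\<lambda>k. 1 / real (Suc k)) \<longlonglongrightarrow> 0" by (intro LIMSEQ_Suc[OF lim_1_over_n])
    then show "(\<lambda>k. gibbs_cov (?A a) (w k a) x) \<longlonglongrightarrow> gibbs_cov (A a) (\<lambda>_. 1) x"
      using A B by (cases "a = j"; intro gibbs_cov_tendsto_subset) (simp_all add: w_def)
  qed
  from fatou_bound[OF integral_mixed_discriminant_gibbs_cov_select[OF g, of "\<lambda>a. a"] integral_mixed_discriminant_gibbs_cov_select[OF g1, of "\<lambda>a. a"] nn[OF g] nn[OF g1] this]
  show ?thesis by (simp add: fun_upd_def if_distrib cong: if_cong)
qed

lemma polarized_volume_mono:
  fixes K :: "'n \<Rightarrow> (real^'n::{finite,wellorder}) set"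
  assumes K: "\<And>a. K a \<in> compact_convex_sets" and X: "X \<in> compact_convex_sets" and sub: "K j \<subseteq> X"
  shows "polarized_volume K \<le> polarized_volume (K(j := X))"
proof -
  obtain A where A: "\<And>k a. finite (A k a) \<and> A k a \<noteq> {}"
    and sh: "\<And>a. shrinks_to (\<lambda>k. convex hull (A k a)) (K a)"
    by (rule obtain_shrinking_polytopes[of UNIV K]) (use K in auto)
  obtain B where B: "\<And>k. finite (B k)" "\<And>k. B k \<noteq> {}" and shB: "shrinks_to (\<lambda>k. convex hull (B k)) X"
    using shrinking_polytopes[of X] X by (auto simp: compact_convex_sets_def)
  have shU: "shrinks_to (\<lambda>k. convex hull (A k j \<union> B k)) X"
    unfolding shrinks_to_def
  proof (intro conjI allI impI)
    have "X \<subseteq> convex hull B k" for k using shB by (auto simp: shrinks_to_def)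
    moreover have "convex hull B k \<subseteq> convex hull (A k j \<union> B k)" for k by (intro hull_mono) auto
    ultimately show "X \<subseteq> convex hull (A k j \<union> B k)" for k by blast
    fix e :: real assume "e > 0"
    then have "\<forall>\<^sub>F k in sequentially. convex hull (A k j) \<subseteq> K j + cball 0 e \<and> convex hull B k \<subseteq> X + cball 0 e"
      using sh[of j] shB by (auto simp: shrinks_to_def intro: eventually_conj)
    then show "\<forall>\<^sub>F k in sequentially. convex hull (A k j \<union> B k) \<subseteq> X + cball 0 e"
    proof eventually_elim
      case (elim k)
      have "K j + cball 0 e \<subseteq> X + cball 0 e" using sub by (intro set_plus_mono2) auto
      then have "A k j \<union> B k \<subseteq> X + cball 0 e"
        using elim hull_subset[of "A k j" convex] hull_subset[of "B k" convex] by blast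
      moreover have "convex (X + cball 0 e)"
        using X by (intro convex_set_plus) (auto simp: compact_convex_sets_def)
      ultimately show ?case by (intro hull_minimal)
    qed
  qed
  have cK: "compact (K a)" "compact X" for a
    using K X by (auto simp: compact_convex_sets_def)
  have cA: "compact (convex hull (A k a))" "compact (convex hull (A k j \<union> B k))" for k a
    using A B by (auto intro!: finite_imp_compact_convex_hull)
  have 1: "(\<lambda>k. polarized_volume (\<lambda>a. convex hull (A k a))) \<longlonglongrightarrow> polarized_volume K"
    by (intro polarized_volume_tendsto sh cK cA)
  have "(\<lambda>k. polarized_volume ((\<lambda>a. convex hull (A k a))(j := convex hull (A k j \<union> B k)))) \<longlonglongrightarrow> polarized_volume (K(j := X))"
    using sh shU cK cA by (intro polarized_volume_tendsto) (auto simp: fun_upd_def)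
  moreover have "polarized_volume (\<lambda>a. convex hull (A k a)) \<le> polarized_volume ((\<lambda>a. convex hull (A k a))(j := convex hull (A k j \<union> B k)))" for k
    using polarized_volume_mono_polytopes[of "A k" "A k j \<union> B k" j] A B by auto
  ultimately show ?thesis
    using tendsto_le[OF sequentially_bot _ 1] by (meson always_eventually)
qed

text \<open>
  Monotonicity and translation invariance are recorded together with the defining properties
  so that they can be transferred to the chosen functional \<open>mixed_volume\<close> by uniqueness.
\<close>

definition monotone_mixed_volume :: "((real ^ 'n::finite) set list \<Rightarrow> real) \<Rightarrow> bool" where
  "monotone_mixed_volume V \<longleftrightarrow> is_mixed_volume V \<and>
    (\<forall>Ks j X. length Ks = CARD('n) \<and> set Ks \<subseteq> compact_convex_sets \<and> j < CARD('n) \<and>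
       X \<in> compact_convex_sets \<and> Ks ! j \<subseteq> X \<longrightarrow> V Ks \<le> V (Ks[j := X])) \<and>
    (\<forall>Ks j t. length Ks = CARD('n) \<and> set Ks \<subseteq> compact_convex_sets \<and> j < CARD('n) \<longrightarrow>
       V (Ks[j := {t} + Ks ! j]) = V Ks)"

lemma monotone_mixed_volume_wellorder: "\<exists>V :: (real ^ 'n::{finite,wellorder}) set list \<Rightarrow> real. monotone_mixed_volume V"
proof -
  let ?n = "CARD('n)"
  obtain e :: "'n \<Rightarrow> nat" where e: "bij_betw e UNIV {..<?n}"
    using ex_bij_betw_finite_nat[of "UNIV :: 'n set"] by (auto simp: atLeast0LessThan)
  have e_lt: "e a < ?n" for a using e by (auto simp: bij_betw_def)
  have e_inj: "e a = e b \<longleftrightarrow> a = b" for a b using e by (auto simp: bij_betw_def inj_on_def)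
  have e_inv: "e (inv e i) = i" if "i < ?n" for i
    using e that by (simp add: bij_betw_def f_inv_into_f)
  have inv_e: "inv e (e a) = a" for a using e_inj inv_f_f[of e] by (auto simp: inj_def)
  define V where "V Ks = polarized_volume (\<lambda>a. Ks ! e a)" for Ks
  have upd: "V (Ks[i := Z]) = polarized_volume ((\<lambda>a. Ks ! e a)(inv e i := Z))" if "i < ?n" "length Ks = ?n" for Ks i Z
  proof -
    have "(\<lambda>a. Ks[i := Z] ! e a) = (\<lambda>a. Ks ! e a)(inv e i := Z)"
      using that e_lt e_inv inv_e by (auto simp: fun_eq_iff nth_list_update)
    then show ?thesis by (simp add: V_def)
  qed
  have mem: "Ks ! e a \<in> compact_convex_sets" if "length Ks = ?n" "set Ks \<subseteq> compact_convex_sets" for Ks a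
    using that e_lt[of a] by (metis nth_mem subsetD)
  have "V Ls = V Ks" if len: "length Ks = ?n" and m: "mset Ls = mset Ks" for Ks Ls
  proof -
    obtain p where p: "p permutes {..<length Ks}" "permute_list p Ks = Ls"
      using mset_eq_permutation[OF m] by metis
    define q where "q = inv e \<circ> p \<circ> e"
    have pe: "p (e a) < ?n" for a using p(1) e_lt[of a] len by (metis lessThan_iff permutes_in_image)
    have "inj q"
      using pe e_inv p(1) e_inj unfolding q_def inj_def o_def by (metis permutes_inverses(2))
    then have "bij q" by (simp add: finite_UNIV_inj_surj bij_def)
    moreover have "Ls ! e a = Ks ! e (q a)" for a
      using p len e_lt[of a] pe[of a] e_inv by (auto simp: q_def permute_list_nth)
    ultimately show ?thesis using polarized_volume_permute[of q "\<lambda>a. Ks ! e a"] by (simp add: V_def)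
  qed
  moreover have "V (Ks[i := (*\<^sub>R) a ` K + (*\<^sub>R) b ` L]) = a * V (Ks[i := K]) + b * V (Ks[i := L])"
    if "length Ks = ?n" "set Ks \<subseteq> compact_convex_sets" "i < ?n"
      "K \<in> compact_convex_sets" "L \<in> compact_convex_sets" "0 \<le> a" "0 \<le> b" for Ks i K L a b
    using polarized_volume_linear[of "\<lambda>a. Ks ! e a" K L a b "inv e i"] mem[OF that(1,2)] that by (simp add: upd)
  moreover have "measure lebesgue (\<Sum>i<?n. (*\<^sub>R) (c i) ` (Ks ! i)) =
     (\<Sum>is | length is = ?n \<and> set is \<subseteq> {..<?n}. prod_list (map c is) * V (map ((!) Ks) is))"
    if len: "length Ks = ?n" and Ks: "set Ks \<subseteq> compact_convex_sets" and c: "\<forall>i<?n. 0 \<le> c i" for Ks c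
  proof -
    have K: "Ks ! i \<in> compact_convex_sets" if "i < ?n" for i
      using that len Ks nth_mem[of i Ks] by auto
    have "measure lebesgue (\<Sum>i<?n. (*\<^sub>R) (c i) ` (Ks ! i)) =
      (\<Sum>f\<in>PiE UNIV (\<lambda>_. {..<?n}). (\<Prod>a\<in>UNIV. c (f a)) * polarized_volume (\<lambda>a. Ks ! f a))"
      using K c by (intro polarized_volume_expand) auto
    also have "\<dots> = (\<Sum>is | length is = ?n \<and> set is \<subseteq> {..<?n}. prod_list (map c is) * V (map ((!) Ks) is))"
    proof (rule sum.reindex_bij_witness[where i="\<lambda>is a. is ! e a" and j="\<lambda>f. map (f \<circ> inv e) [0..<?n]"])
      fix f :: "'n \<Rightarrow> nat" assume f: "f \<in> PiE UNIV (\<lambda>_. {..<?n})"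
      show "(\<lambda>a. map (f \<circ> inv e) [0..<?n] ! e a) = f" using e_lt inv_e by (simp add: fun_eq_iff)
      show "map (f \<circ> inv e) [0..<?n] \<in> {is. length is = ?n \<and> set is \<subseteq> {..<?n}}"
        using f by (auto simp: PiE_def Pi_def)
      have "prod_list (map c (map (f \<circ> inv e) [0..<?n])) = (\<Prod>i<?n. c (f (inv e i)))"
        by (simp add: prod.list_conv_set_nth atLeast0LessThan)
      also have "\<dots> = (\<Prod>a\<in>UNIV. c (f a))"
        using prod.reindex_bij_betw[OF e, of "\<lambda>i. c (f (inv e i))"] by (simp add: inv_e)
      finally show "prod_list (map c (map (f \<circ> inv e) [0..<?n])) * V (map ((!) Ks) (map (f \<circ> inv e) [0..<?n])) =
          (\<Prod>a\<in>UNIV. c (f a)) * polarized_volume (\<lambda>a. Ks ! f a)"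
        using e_lt inv_e by (simp add: V_def)
    next
      fix "is" assume "is": "is \<in> {is. length is = ?n \<and> set is \<subseteq> {..<?n}}"
      then show "map ((\<lambda>a. is ! e a) \<circ> inv e) [0..<?n] = is"
        using e_inv by (intro nth_equalityI) auto
      have "is ! e a \<in> set is" for a
        using "is" e_lt[of a] by (intro nth_mem) auto
      then have "is ! e a < ?n" for a
        using "is" by blast
      then show "(\<lambda>a. is ! e a) \<in> PiE UNIV (\<lambda>_. {..<?n})"
        by (simp add: PiE_def Pi_def)
    qed
    finally show ?thesis .
  qed
  ultimately have "is_mixed_volume V"
    unfolding is_mixed_volume_def by blast
  moreover have "V Ks \<le> V (Ks[j := X])"
    if "length Ks = ?n" "set Ks \<subseteq> compact_convex_sets" "j < ?n" "X \<in> compact_convex_sets" "Ks ! j \<subseteq> X" for Ks j X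
  proof -
    have "polarized_volume (\<lambda>a. Ks ! e a) \<le> polarized_volume ((\<lambda>a. Ks ! e a)(inv e j := X))"
      using that mem e_inv by (intro polarized_volume_mono) auto
    then show ?thesis using that by (simp add: upd) (simp add: V_def)
  qed
  moreover have "V (Ks[j := {t} + Ks ! j]) = V Ks"
    if "length Ks = ?n" "j < ?n" for Ks j t
  proof -
    have "(\<lambda>a. Ks ! e a)(inv e j := {t} + Ks ! j) = (\<lambda>a. {if a = inv e j then t else 0} + Ks ! e a)"
      using that e_inv by (auto simp: fun_eq_iff set_plus_def)
    then show ?thesis using that polarized_volume_translate[of "\<lambda>a. if a = inv e j then t else 0" "\<lambda>a. Ks ! e a"]
      by (simp add: upd) (simp add: V_def)
  qed
  ultimately show ?thesis unfolding monotone_mixed_volume_def by blast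
qed



lemma plus_in_compact_convex_sets:
  "K \<in> compact_convex_sets \<Longrightarrow> L \<in> compact_convex_sets \<Longrightarrow> K + L \<in> compact_convex_sets"
  by (auto simp: compact_convex_sets_def compact_set_plus convex_set_plus)

lemma scaleR_in_compact_convex_sets:
  "K \<in> compact_convex_sets \<Longrightarrow> (*\<^sub>R) c ` K \<in> compact_convex_sets"
  by (auto simp: compact_convex_sets_def compact_scaling convex_scaling)

lemma singleton_in_compact_convex_sets: "{t} \<in> compact_convex_sets"
  by (simp add: compact_convex_sets_def)

section \<open>Arbitrary finite index types\<close>

text \<open>
  A copy of a finite type, well-ordered along an arbitrary injection into the natural numbers.
  Relabelling coordinates preserves volume, so results for well-ordered index types carry over.
\<close>

typedef 'a ranked = "UNIV :: 'a set" by auto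

instance ranked :: (finite) finite
proof
  have "range (Abs_ranked :: 'a \<Rightarrow> 'a ranked) = UNIV"
    by (metis Rep_ranked_inverse UNIV_eq_I rangeI)
  then show "finite (UNIV :: 'a ranked set)" by (metis finite finite_imageI)
qed

definition rank_of :: "'a::finite \<Rightarrow> nat" where
  "rank_of = (SOME f. inj f)"

lemma inj_rank_of: "inj (rank_of :: 'a::finite \<Rightarrow> nat)"
proof -
  obtain f :: "'a \<Rightarrow> nat" where "inj f"
    using finite_imp_inj_to_nat_seg[of "UNIV :: 'a set"] by auto
  then show ?thesis unfolding rank_of_def by (rule someI[of inj])
qed

instantiation ranked :: (finite) wellorder
begin

definition less_eq_ranked :: "'a ranked \<Rightarrow> 'a ranked \<Rightarrow> bool" where
  "less_eq_ranked x y \<longleftrightarrow> rank_of (Rep_ranked x) \<le> rank_of (Rep_ranked y)"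

definition less_ranked :: "'a ranked \<Rightarrow> 'a ranked \<Rightarrow> bool" where
  "less_ranked x y \<longleftrightarrow> rank_of (Rep_ranked x) < rank_of (Rep_ranked y)"

instance
proof
  fix x y z :: "'a ranked"
  show "x < y \<longleftrightarrow> x \<le> y \<and> \<not> y \<le> x" "x \<le> x" "x \<le> y \<Longrightarrow> y \<le> z \<Longrightarrow> x \<le> z" "x \<le> y \<or> y \<le> x"
    by (auto simp: less_eq_ranked_def less_ranked_def)
  show "x \<le> y \<Longrightarrow> y \<le> x \<Longrightarrow> x = y"
    using inj_rank_of Rep_ranked_inject unfolding less_eq_ranked_def by (metis injD order_antisym)
next
  fix P :: "'a ranked \<Rightarrow> bool" and a
  assume step: "\<And>x. (\<And>y. y < x \<Longrightarrow> P y) \<Longrightarrow> P x"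
  show "P a"
    by (induction "rank_of (Rep_ranked a)" arbitrary: a rule: less_induct)
      (auto intro: step simp: less_ranked_def)
qed

end

lemma bij_Rep_ranked: "bij (Rep_ranked :: 'a ranked \<Rightarrow> 'a)"
  by (metis Abs_ranked_inverse Rep_ranked_inverse UNIV_I bij_def injI surjI)

lemma card_ranked: "CARD('a ranked) = CARD('a)"
  using bij_betw_same_card[OF bij_Rep_ranked] by simp

definition relabel :: "real^'n::finite \<Rightarrow> real^'n ranked" where
  "relabel x = (\<chi> i. x $ Rep_ranked i)"

lemma linear_relabel: "linear relabel"
  by (rule linearI) (auto simp: relabel_def vec_eq_iff)

lemma emeasure_box_cart:
  fixes l u :: "real^'n::finite"
  assumes "\<And>i. l $ i \<le> u $ i"
  shows "emeasure lborel (box l u) = (\<Prod>i\<in>UNIV. u $ i - l $ i)"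
proof -
  have b: "(Basis :: (real^'n) set) = range (\<lambda>i. axis i 1)"
    by (auto simp: Basis_vec_def)
  have inj: "inj (\<lambda>i. axis i (1::real) :: real^'n)"
    by (auto simp: inj_def axis_eq_axis)
  have "emeasure lborel (box l u) = (\<Prod>b\<in>Basis. (u - l) \<bullet> b)"
    using assms by (subst emeasure_lborel_box) (auto simp: b inner_axis)
  also have "(\<Prod>b\<in>Basis. (u - l) \<bullet> b) = (\<Prod>i\<in>UNIV. u $ i - l $ i)"
    unfolding b by (subst prod.reindex[OF inj]) (simp add: inner_axis)
  finally show ?thesis .
qed

lemma continuous_relabel: "continuous_on S relabel"
  by (intro linear_continuous_on) (simp add: linear_relabel flip: linear_conv_bounded_linear)

lemma measurable_relabel: "relabel \<in> borel_measurable borel"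
  by (rule borel_measurable_continuous_onI[OF continuous_relabel])

text \<open>
  Lebesgue measure is determined by its values on boxes, and \<open>relabel\<close> permutes the side lengths.
\<close>

lemma distr_relabel: "distr lborel borel relabel = (lborel :: (real^'n::finite ranked) measure)"
proof (rule lborel_eqI[symmetric])
  fix l u :: "real^'n ranked"
  assume le: "\<And>b. b \<in> Basis \<Longrightarrow> l \<bullet> b \<le> u \<bullet> b"
  have lu: "l $ i \<le> u $ i" for i
    using le[of "axis i 1"] by (simp add: inner_axis)
  let ?r = "\<lambda>y :: real^'n ranked. (\<chi> i. y $ Abs_ranked i) :: real^'n"
  have R: "Rep_ranked (Abs_ranked i) = i" "Abs_ranked (Rep_ranked j) = j" for i :: 'n and j :: "'n ranked"
    by (auto simp: Abs_ranked_inverse Rep_ranked_inverse)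
  have all: "(\<forall>i::'n ranked. Q i) \<longleftrightarrow> (\<forall>i. Q (Abs_ranked i))" for Q by (metis R(2))
  have pre: "relabel -` box l u = box (?r l) (?r u)"
    by (auto simp: mem_box_cart relabel_def all R)
  have "emeasure (distr lborel borel relabel) (box l u) = emeasure lborel (box (?r l) (?r u))"
    using measurable_relabel by (subst emeasure_distr) (auto simp: pre)
  also have "\<dots> = (\<Prod>i\<in>UNIV. u $ Abs_ranked i - l $ Abs_ranked i)"
    using lu by (subst emeasure_box_cart) auto
  also have "(\<Prod>i\<in>UNIV. u $ Abs_ranked i - l $ Abs_ranked i) = (\<Prod>i\<in>UNIV. u $ i - l $ i)"
    using prod.reindex_bij_betw[OF bij_Rep_ranked, of "\<lambda>i. u $ Abs_ranked i - l $ Abs_ranked i"] by (simp add: R)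
  also have "ennreal \<dots> = emeasure lborel (box l u)"
    using lu by (subst emeasure_box_cart) auto
  also have "\<dots> = (\<Prod>b\<in>Basis. (u - l) \<bullet> b)"
    using le by (simp add: emeasure_lborel_box)
  finally show "emeasure (distr lborel borel relabel) (box l u) = (\<Prod>b\<in>Basis. (u - l) \<bullet> b)" .
qed simp

lemma measure_relabel:
  fixes K :: "(real^'n::finite) set"
  assumes "compact K"
  shows "measure lebesgue (relabel ` K) = measure lebesgue K"
proof -
  have c: "compact (relabel ` K)"
    using assms by (intro compact_continuous_image continuous_relabel)
  have inj: "inj (relabel :: real^'n \<Rightarrow> _)"
  proof (rule injI)
    fix x y :: "real^'n" assume "relabel x = relabel y"
    then have "x $ Rep_ranked i = y $ Rep_ranked i" for i
      by (simp add: relabel_def vec_eq_iff)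
    then show "x = y" by (metis Abs_ranked_inverse UNIV_I vec_eq_iff)
  qed
  have "emeasure lborel (relabel ` K) = emeasure (distr lborel borel relabel) (relabel ` K)"
    by (simp add: distr_relabel)
  also have "\<dots> = emeasure lborel K"
    using measurable_relabel c inj
    by (subst emeasure_distr) (auto simp: inj_vimage_image_eq compact_imp_closed)
  finally have "measure lborel (relabel ` K) = measure lborel K"
    by (simp add: measure_def)
  moreover have "K \<in> sets borel" "relabel ` K \<in> sets borel"
    using assms c by (auto simp: compact_imp_closed)
  ultimately show ?thesis by (simp add: measure_completion)
qed

lemma monotone_mixed_volume_exists: "\<exists>V :: (real ^ 'n::finite) set list \<Rightarrow> real. monotone_mixed_volume V"
proof -
  obtain W :: "(real ^ 'n ranked) set list \<Rightarrow> real" where W: "monotone_mixed_volume W"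
    using monotone_mixed_volume_wellorder by blast
  let ?n = "CARD('n)"
  let ?R = "image (relabel :: real^'n \<Rightarrow> real^'n ranked)"
  define V where "V Ks = W (map ?R Ks)" for Ks
  have n: "CARD('n ranked) = ?n" by (rule card_ranked)
  have ccs: "?R K \<in> compact_convex_sets" if "K \<in> compact_convex_sets" for K
    using that linear_relabel
    by (auto simp: compact_convex_sets_def intro: compact_continuous_image continuous_relabel convex_linear_image)
  then have ccs_list: "set (map ?R Ks) \<subseteq> compact_convex_sets" if "set Ks \<subseteq> compact_convex_sets" for Ks
    using that by auto
  have plus: "?R (S + T) = ?R S + ?R T" for S T
    by (force simp: set_plus_def linear_add[OF linear_relabel])
  have zero: "?R {0} = {0}" by (simp add: linear_0[OF linear_relabel])
  have scale: "?R ((*\<^sub>R) c ` S) = (*\<^sub>R) c ` ?R S" for c S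
    by (simp add: image_image linear_cmul[OF linear_relabel])
  have sum: "?R (\<Sum>i\<in>I. B i) = (\<Sum>i\<in>I. ?R (B i))" for I and B :: "nat \<Rightarrow> (real^'n) set"
    using sum_set_linear[of ?R B I] plus zero by (simp add: o_def)
  note W_def = W[unfolded monotone_mixed_volume_def is_mixed_volume_def n]
  have W_sym: "W Ls = W Ks" if "length Ks = ?n" "set Ks \<subseteq> compact_convex_sets" "mset Ls = mset Ks" for Ks Ls
    using W_def that by blast
  have W_lin: "W (Ks[i := (*\<^sub>R) a ` K + (*\<^sub>R) b ` L]) = a * W (Ks[i := K]) + b * W (Ks[i := L])"
    if "length Ks = ?n" "set Ks \<subseteq> compact_convex_sets" "i < ?n"
      "K \<in> compact_convex_sets" "L \<in> compact_convex_sets" "0 \<le> a" "0 \<le> b" for Ks i K L a b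
    using W_def that by blast
  have W_expand: "measure lebesgue (\<Sum>i<?n. (*\<^sub>R) (c i) ` (Ks ! i)) =
     (\<Sum>is | length is = ?n \<and> set is \<subseteq> {..<?n}. prod_list (map c is) * W (map ((!) Ks) is))"
    if "length Ks = ?n" "set Ks \<subseteq> compact_convex_sets" "\<forall>i<?n. 0 \<le> c i" for Ks c
    using W_def that by blast
  have W_mono: "W Ks \<le> W (Ks[j := X])"
    if "length Ks = ?n" "set Ks \<subseteq> compact_convex_sets" "j < ?n" "X \<in> compact_convex_sets" "Ks ! j \<subseteq> X" for Ks j X
    using W_def that by blast
  have W_translate: "W (Ks[j := {t} + Ks ! j]) = W Ks"
    if "length Ks = ?n" "set Ks \<subseteq> compact_convex_sets" "j < ?n" for Ks j t
    using W_def that by blast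
  have sym: "V Ls = V Ks" if "length Ks = ?n" "set Ks \<subseteq> compact_convex_sets" "mset Ls = mset Ks" for Ks Ls
    unfolding V_def using that by (intro W_sym ccs_list) simp_all
  have lin: "V (Ks[i := (*\<^sub>R) a ` K + (*\<^sub>R) b ` L]) = a * V (Ks[i := K]) + b * V (Ks[i := L])"
    if "length Ks = ?n" "set Ks \<subseteq> compact_convex_sets" "i < ?n"
      "K \<in> compact_convex_sets" "L \<in> compact_convex_sets" "0 \<le> a" "0 \<le> b" for Ks i K L a b
    unfolding V_def map_update plus scale using that by (intro W_lin ccs_list ccs) simp_all
  have expand: "measure lebesgue (\<Sum>i<?n. (*\<^sub>R) (c i) ` (Ks ! i)) =
     (\<Sum>is | length is = ?n \<and> set is \<subseteq> {..<?n}. prod_list (map c is) * V (map ((!) Ks) is))"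
    if len: "length Ks = ?n" and Ks: "set Ks \<subseteq> compact_convex_sets" and c: "\<forall>i<?n. 0 \<le> c i" for Ks c
  proof -
    have "Ks ! i \<in> compact_convex_sets" if "i < ?n" for i
      using Ks len nth_mem[of i Ks] that by auto
    then have "compact (Ks ! i)" if "i < ?n" for i
      using that by (simp add: compact_convex_sets_def)
    then have "measure lebesgue (\<Sum>i<?n. (*\<^sub>R) (c i) ` (Ks ! i)) = measure lebesgue (?R (\<Sum>i<?n. (*\<^sub>R) (c i) ` (Ks ! i)))"
      by (intro measure_relabel[symmetric] compact_set_sum compact_scaling) auto
    also have "?R (\<Sum>i<?n. (*\<^sub>R) (c i) ` (Ks ! i)) = (\<Sum>i<?n. (*\<^sub>R) (c i) ` (map ?R Ks ! i))"
      unfolding sum scale using len by (intro sum.cong) auto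
    also have "measure lebesgue \<dots> = (\<Sum>is | length is = ?n \<and> set is \<subseteq> {..<?n}. prod_list (map c is) * W (map ((!) (map ?R Ks)) is))"
      using len c by (intro W_expand ccs_list Ks) simp_all
    also have "\<dots> = (\<Sum>is | length is = ?n \<and> set is \<subseteq> {..<?n}. prod_list (map c is) * V (map ((!) Ks) is))"
    proof (intro sum.cong refl)
      fix "is" assume "is \<in> {is. length is = ?n \<and> set is \<subseteq> {..<?n}}"
      then have "map ((!) (map ?R Ks)) is = map ?R (map ((!) Ks) is)"
        using len by auto
      then show "prod_list (map c is) * W (map ((!) (map ?R Ks)) is) = prod_list (map c is) * V (map ((!) Ks) is)"
        by (simp only: V_def)
    qed
    finally show ?thesis .
  qed
  have mono: "V Ks \<le> V (Ks[j := X])"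
    if "length Ks = ?n" "set Ks \<subseteq> compact_convex_sets" "j < ?n" "X \<in> compact_convex_sets" "Ks ! j \<subseteq> X" for Ks j X
    unfolding V_def map_update using that by (intro W_mono ccs_list ccs) (simp_all add: image_mono)
  have translate: "V (Ks[j := {t} + Ks ! j]) = V Ks"
    if "length Ks = ?n" "set Ks \<subseteq> compact_convex_sets" "j < ?n" for Ks j t
    using W_translate[of "map ?R Ks" j "relabel t"] ccs_list[OF that(2)] that
    unfolding V_def by (simp add: map_update plus)
  have "is_mixed_volume V"
    unfolding is_mixed_volume_def using sym lin expand by blast
  then show ?thesis
    unfolding monotone_mixed_volume_def using mono translate by blast
qed

lemma monotone_mixed_volume: "monotone_mixed_volume (mixed_volume :: (real ^ 'n::finite) set list \<Rightarrow> real)"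
proof -
  obtain V :: "(real ^ 'n) set list \<Rightarrow> real" where V: "monotone_mixed_volume V"
    using monotone_mixed_volume_exists by blast
  then have iV: "is_mixed_volume V" by (simp add: monotone_mixed_volume_def)
  then have iM: "is_mixed_volume (mixed_volume :: (real ^ 'n) set list \<Rightarrow> real)"
    unfolding mixed_volume_def by (rule someI[of is_mixed_volume])
  have eq: "mixed_volume Ks = V Ks" if "length Ks = CARD('n)" "set Ks \<subseteq> compact_convex_sets" for Ks
    using is_mixed_volume_unique[OF iM iV that] .
  have tr: "{t} + K \<in> compact_convex_sets" if "K \<in> compact_convex_sets" for t and K :: "(real^'n) set"
    using that by (intro plus_in_compact_convex_sets singleton_in_compact_convex_sets)
  have set_up: "set (Ks[j := X]) \<subseteq> compact_convex_sets"
    if "set Ks \<subseteq> compact_convex_sets" "X \<in> compact_convex_sets" for Ks j and X :: "(real^'n) set"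
    using that set_update_subset_insert[of Ks j X] by blast
  have mono: "mixed_volume Ks \<le> mixed_volume (Ks[j := X])"
    if "length Ks = CARD('n)" "set Ks \<subseteq> compact_convex_sets" "j < CARD('n)" "X \<in> compact_convex_sets" "Ks ! j \<subseteq> X"
    for Ks j and X :: "(real^'n) set"
    using V that set_up[OF that(2,4), of j] by (simp add: eq monotone_mixed_volume_def)
  have translate: "mixed_volume (Ks[j := {t} + Ks ! j]) = mixed_volume Ks"
    if "length Ks = CARD('n)" "set Ks \<subseteq> compact_convex_sets" "j < CARD('n)" for Ks j and t :: "real^'n"
  proof -
    have "Ks ! j \<in> compact_convex_sets" using that by auto
    then show ?thesis
      using V that set_up[OF that(2) tr, of "Ks ! j" j t] by (simp add: eq monotone_mixed_volume_def)
  qed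
  show ?thesis
    unfolding monotone_mixed_volume_def using iM mono translate by blast
qed



section \<open>Slicing a polytope by inner parallel bodies\<close>

lemma inradius_attained:
  fixes s :: "nat \<Rightarrow> 'a::topological_space \<Rightarrow> real"
  assumes "compact P" "P \<noteq> {}" "0 < N" "\<And>i. i < N \<Longrightarrow> continuous_on P (s i)"
  shows "\<exists>x\<in>P. \<exists>r. (\<forall>i<N. r \<le> s i x) \<and> (\<forall>z\<in>P. \<exists>i<N. s i z \<le> r)"
proof -
  have "\<exists>m. continuous_on P m \<and> (\<forall>z\<in>P. (\<forall>i<N. m z \<le> s i z) \<and> (\<exists>i<N. s i z = m z))"
    using assms(3,4)
  proof (induction N rule: nat_induct_non_zero)
    case 1
    then show ?case by (intro exI[of _ "s 0"]) auto
  next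
    case (Suc n)
    then obtain m where m: "continuous_on P m" "\<forall>z\<in>P. (\<forall>i<n. m z \<le> s i z) \<and> (\<exists>i<n. s i z = m z)"
      by auto
    have "continuous_on P (\<lambda>z. min (m z) (s n z))"
      using m(1) Suc.prems by (intro continuous_on_min) auto
    moreover have "\<forall>z\<in>P. (\<forall>i<Suc n. min (m z) (s n z) \<le> s i z) \<and> (\<exists>i<Suc n. s i z = min (m z) (s n z))"
      using m(2) by (auto simp: less_Suc_eq min_def intro: min.coboundedI1 dest: bspec) (meson less_SucI order_trans linear)+
    ultimately show ?case by blast
  qed
  then obtain m where m: "continuous_on P m" "\<forall>z\<in>P. (\<forall>i<N. m z \<le> s i z) \<and> (\<exists>i<N. s i z = m z)"
    by blast
  obtain x where x: "x \<in> P" "\<forall>z\<in>P. m z \<le> m x"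
    using continuous_attains_sup[OF assms(1,2) m(1)] by blast
  have "\<exists>i<N. s i z \<le> m x" if "z \<in> P" for z
    using x(2) m(2) that by metis
  then show ?thesis using m(2) x by (intro bexI[of _ x] exI[of _ "m x"]) auto
qed

text \<open>
  Here \<open>P\<close> is a polytope with outer normals \<open>u i\<close>, and \<open>u i \<bullet> p i\<close> is the value of the support function
  of \<open>L\<close> at \<open>u i\<close>. The number \<open>r\<close> is the inradius of \<open>P\<close> relative to \<open>L\<close>, attained at \<open>x0\<close>. The region
  \<open>R i\<close> collects the points whose minimal quotient has least index \<open>i\<close>, and \<open>E k i\<close> is the part of
  the \<open>k\<close>-th slice in \<open>R i\<close>. Translation by \<open>(k + 1) \<epsilon> (p i)\<close> pushes \<open>E k i\<close> out of \<open>P\<close>, but only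
  into \<open>P + \<epsilon> L\<close>, and keeps it inside \<open>R i\<close>, so the images of the pieces remain disjoint.
\<close>

lemma layer_bound:
  fixes P L :: "'a::euclidean_space set" and N :: nat
  assumes P: "P = {z. \<forall>i<N. u i \<bullet> z \<le> h i}" "compact P" "P \<noteq> {}" and N: "0 < N"
    and L: "compact L" "convex L" "0 \<in> L"
    and p: "\<And>i. i < N \<Longrightarrow> p i \<in> L" "\<And>i x. i < N \<Longrightarrow> x \<in> L \<Longrightarrow> u i \<bullet> x \<le> u i \<bullet> p i"
    and pos: "\<And>i. i < N \<Longrightarrow> 0 < u i \<bullet> p i"
  shows "\<exists>x0 r. 0 \<le> r \<and> (\<forall>x\<in>L. x0 + r *\<^sub>R x \<in> P) \<and>
    (\<forall>\<epsilon>>0. measure lebesgue P \<le> (r / \<epsilon> + 1) * (measure lebesgue (P + (*\<^sub>R) \<epsilon> ` L) - measure lebesgue P))"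
proof -
  define s where "s i z = (h i - u i \<bullet> z) / (u i \<bullet> p i)" for i z
  have s_P: "z \<in> P \<longleftrightarrow> (\<forall>i<N. 0 \<le> s i z)" for z
    using pos by (auto simp: P(1) s_def zero_le_divide_iff dest: less_imp_le) (meson less_asym not_le)+
  have cont: "continuous_on X (s i)" if "i < N" for i X
    unfolding s_def using pos[OF that] by (intro continuous_intros) auto
  have shift_le: "s j z - c \<le> s j (z + c *\<^sub>R x)" if "j < N" "x \<in> L" "0 \<le> c" for j z c x
  proof -
    have "c * (u j \<bullet> x) \<le> c * (u j \<bullet> p j)" using p that by (intro mult_left_mono) auto
    then have "(h j - u j \<bullet> z - c * (u j \<bullet> p j)) / (u j \<bullet> p j) \<le> (h j - u j \<bullet> z - c * (u j \<bullet> x)) / (u j \<bullet> p j)"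
      using pos[OF that(1)] by (intro divide_right_mono) auto
    then show ?thesis
      using pos[OF that(1)] by (simp add: s_def inner_add_right diff_divide_distrib add_divide_distrib)
  qed
  have shift_eq: "s i (z + c *\<^sub>R p i) = s i z - c" if "i < N" for i z c
    using pos[OF that] by (simp add: s_def inner_add_right diff_divide_distrib add_divide_distrib)
  have "\<exists>x\<in>P. \<exists>r. (\<forall>i<N. r \<le> s i x) \<and> (\<forall>z\<in>P. \<exists>i<N. s i z \<le> r)"
    by (rule inradius_attained[OF P(2,3) N cont])
  then obtain x0 r where x0: "x0 \<in> P" and r: "\<forall>i<N. r \<le> s i x0" and rmax: "\<forall>z\<in>P. \<exists>i<N. s i z \<le> r"
    by blast
  obtain i where "i < N" "s i x0 \<le> r" using rmax x0 by blast
  then have "0 \<le> r" using x0 s_P[of x0] by force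
  have fits: "x0 + r *\<^sub>R x \<in> P" if "x \<in> L" for x
    unfolding s_P
  proof (intro allI impI)
    fix j assume "j < N"
    then show "0 \<le> s j (x0 + r *\<^sub>R x)" using shift_le[of j x r x0] that \<open>0 \<le> r\<close> r by fastforce
  qed
  have bound: "measure lebesgue P \<le> (r / \<epsilon> + 1) * (measure lebesgue (P + (*\<^sub>R) \<epsilon> ` L) - measure lebesgue P)"
    if eps: "\<epsilon> > 0" for \<epsilon>
  proof -
    let ?Q = "P + (*\<^sub>R) \<epsilon> ` L"
    define R where "R i = {z. \<forall>j<N. s i z \<le> s j z \<and> (j < i \<longrightarrow> s i z < s j z)}" for i
    define E where "E k i = {z \<in> P. real k * \<epsilon> \<le> s i z \<and> s i z < real (Suc k) * \<epsilon>} \<inter> R i" for k :: nat and i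
    define F where "F k i = (+) ((real (Suc k) * \<epsilon>) *\<^sub>R p i) ` E k i" for k i
    have lmP: "P \<in> lmeasurable" using P(2) by (rule lmeasurable_compact)
    have cQ: "compact ?Q" using P(2) L(1) by (intro compact_set_plus compact_scaling)
    then have lmQ: "?Q \<in> lmeasurable" by (rule lmeasurable_compact)
    have PQ: "P \<subseteq> ?Q"
    proof -
      have "0 \<in> (*\<^sub>R) \<epsilon> ` L" using L(3) by (intro image_eqI[of _ _ 0]) auto
      then show ?thesis using set_zero_plus2[of "(*\<^sub>R) \<epsilon> ` L" P] by (simp add: add.commute)
    qed
    have s_meas: "s i \<in> borel_measurable borel" for i
      unfolding s_def by measurable
    have E_meas: "E k i \<in> lmeasurable" for k i
    proof -
      have "P = {z \<in> space borel. \<forall>j\<in>{..<N}. u j \<bullet> z \<le> h j}" by (auto simp: P(1))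
      also have "\<dots> \<in> sets borel" by measurable
      finally have "P \<in> sets borel" .
      moreover have "{z \<in> space borel. real k * \<epsilon> \<le> s i z \<and> s i z < real (Suc k) * \<epsilon>} \<in> sets borel"
        using s_meas by measurable
      moreover have "{z \<in> space borel. \<forall>j\<in>{..<N}. s i z \<le> s j z \<and> (j < i \<longrightarrow> s i z < s j z)} \<in> sets borel"
        using s_meas by measurable
      moreover have "E k i = P \<inter> {z \<in> space borel. real k * \<epsilon> \<le> s i z \<and> s i z < real (Suc k) * \<epsilon>} \<inter>
          {z \<in> space borel. \<forall>j\<in>{..<N}. s i z \<le> s j z \<and> (j < i \<longrightarrow> s i z < s j z)}"
        by (auto simp: E_def R_def)
      ultimately have "E k i \<in> sets borel" by simp
      moreover have "bounded (E k i)"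
        using compact_imp_bounded[OF P(2)] by (rule bounded_subset) (auto simp: E_def)
      ultimately show ?thesis by (intro bounded_set_imp_lmeasurable) auto
    qed
    have F_meas: "F k i \<in> lmeasurable" and FE: "measure lebesgue (F k i) = measure lebesgue (E k i)" for k i
      unfolding F_def using E_meas by (auto intro: measurable_translation measure_translation)
    have F_R: "F k i \<subseteq> R i" if i: "i < N" for k i
    proof
      fix y assume "y \<in> F k i"
      then obtain z where z: "z \<in> R i" and y: "y = z + (real (Suc k) * \<epsilon>) *\<^sub>R p i"
        by (auto simp: F_def E_def add.commute)
      let ?c = "real (Suc k) * \<epsilon>"
      have c: "0 \<le> ?c" using eps by simp
      have "s j z - ?c \<le> s j y" if "j < N" for j
        unfolding y by (rule shift_le[OF that p(1)[OF i] c])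
      moreover have "s i y = s i z - ?c" unfolding y by (rule shift_eq[OF i])
      ultimately show "y \<in> R i" using z unfolding R_def by fastforce
    qed
    have F_Q: "F k i \<subseteq> ?Q - P" if i: "i < N" for k i
    proof
      fix y assume "y \<in> F k i"
      then obtain z where z: "z \<in> E k i" and y: "y = z + (real (Suc k) * \<epsilon>) *\<^sub>R p i"
        by (auto simp: F_def add.commute)
      \<comment> \<open>The path from z to y reaches the facet after time a; only the remaining time, at most eps, is spent outside P.\<close>
      define a where "a = s i z"
      have a: "0 \<le> a" "real k * \<epsilon> \<le> a" "a < real (Suc k) * \<epsilon>" and aj: "\<And>j. j < N \<Longrightarrow> a \<le> s j z"
        using z i s_P[of z] by (auto simp: E_def R_def a_def)
      have "0 \<le> s j (z + a *\<^sub>R p i)" if "j < N" for j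
        using shift_le[OF that p(1)[OF i] a(1), of z] aj[OF that] by simp
      then have "z + a *\<^sub>R p i \<in> P" by (simp add: s_P)
      moreover define t where "t = (real (Suc k) * \<epsilon> - a) / \<epsilon>"
      have t: "0 \<le> t" "t \<le> 1" using a eps by (auto simp: t_def field_simps)
      have "t *\<^sub>R p i + (1 - t) *\<^sub>R 0 \<in> L"
        using L p(1)[OF i] t by (intro convexD) auto
      then have "t *\<^sub>R p i \<in> L" by simp
      then have "\<epsilon> *\<^sub>R (t *\<^sub>R p i) \<in> (*\<^sub>R) \<epsilon> ` L" by (rule imageI)
      moreover have "y = (z + a *\<^sub>R p i) + \<epsilon> *\<^sub>R (t *\<^sub>R p i)"
        using eps by (simp add: y t_def flip: scaleR_add_left)
      ultimately have "y \<in> ?Q" by (metis set_plus_intro)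
      moreover have "s i y < 0" using a(3) unfolding y shift_eq[OF i] a_def by simp
      then have "y \<notin> P" using i s_P[of y] by force
      ultimately show "y \<in> ?Q - P" by simp
    qed
    define D where "D = measure lebesgue ?Q - measure lebesgue P"
    have D: "D = measure lebesgue (?Q - P)"
      unfolding D_def using lmP lmQ PQ by (simp add: measurable_measure_Diff fmeasurableD)
    then have "0 \<le> D" by simp
    have layer: "(\<Sum>i<N. measure lebesgue (E k i)) \<le> D" for k
    proof -
      have dis: "disjoint_family_on (F k) {..<N}"
      proof -
        have lt: "R i \<inter> R j = {}" if "i < j" "j < N" for i j
        proof -
          have "s i z \<le> s j z" if "z \<in> R i" for z
            using that \<open>j < N\<close> by (simp add: R_def)
          moreover have "s j z < s i z" if "z \<in> R j" for z
            using that \<open>i < j\<close> \<open>j < N\<close> by (simp add: R_def)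
          ultimately show ?thesis by (force simp: disjoint_iff)
        qed
        show ?thesis
          unfolding disjoint_family_on_def
        proof (intro ballI impI)
          fix i j assume ij: "i \<in> {..<N}" "j \<in> {..<N}" "i \<noteq> j"
          then have "R i \<inter> R j = {}" using lt[of i j] lt[of j i] by (cases "i < j") auto
          then show "F k i \<inter> F k j = {}" using F_R[of i k] F_R[of j k] ij by auto
        qed
      qed
      have "(\<Sum>i<N. measure lebesgue (E k i)) = (\<Sum>i<N. measure lebesgue (F k i))"
        by (simp add: FE)
      also have "\<dots> = measure lebesgue (\<Union>i<N. F k i)"
      proof (intro measure_finite_Union[symmetric] finite_lessThan dis)
        show "F k ` {..<N} \<subseteq> sets lebesgue" using F_meas fmeasurableD by blast
        show "emeasure lebesgue (F k i) \<noteq> \<infinity>" for i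
          using fmeasurableD2[OF F_meas] unfolding infinity_ennreal_def .
      qed
      also have "\<dots> \<le> measure lebesgue (?Q - P)"
      proof (intro measure_mono_fmeasurable)
        show "(\<Union>i<N. F k i) \<subseteq> ?Q - P" using F_Q by blast
        show "(\<Union>i<N. F k i) \<in> sets lebesgue" using fmeasurableD[OF F_meas] by (intro sets.finite_UN) auto
        show "?Q - P \<in> lmeasurable" using lmP lmQ by (intro fmeasurable.Diff)
      qed
      finally show ?thesis by (simp add: D)
    qed
    let ?M = "nat \<lfloor>r / \<epsilon>\<rfloor>"
    have cover: "P \<subseteq> (\<Union>k\<le>?M. \<Union>i<N. E k i)"
    proof
      fix z assume z: "z \<in> P"
      define i where "i = (LEAST i. i < N \<and> (\<forall>j<N. s i z \<le> s j z))"
      have "\<exists>i\<in>{..<N}. \<forall>j\<in>{..<N}. s i z \<le> s j z"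
      proof -
        have "Min ((\<lambda>j. s j z) ` {..<N}) \<in> (\<lambda>j. s j z) ` {..<N}"
          using N by (intro Min_in) auto
        then obtain i where "i \<in> {..<N}" "Min ((\<lambda>j. s j z) ` {..<N}) = s i z" by blast
        then show ?thesis using Min_le[of "(\<lambda>j. s j z) ` {..<N}"] by (intro bexI[of _ i]) auto
      qed
      then have "\<exists>i. i < N \<and> (\<forall>j<N. s i z \<le> s j z)" by blast
      then have i: "i < N \<and> (\<forall>j<N. s i z \<le> s j z)"
        unfolding i_def by (rule LeastI_ex)
      have least: "\<not> (\<forall>l<N. s j z \<le> s l z)" if "j < i" for j
        using not_less_Least[of j "\<lambda>i. i < N \<and> (\<forall>j<N. s i z \<le> s j z)"] that i
        unfolding i_def[symmetric] by auto
      have "s i z < s j z" if ji: "j < i" for j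
      proof -
        obtain l where "l < N" "s l z < s j z" using least[OF ji] by (auto simp: not_le)
        then show ?thesis using i by force
      qed
      then have "z \<in> R i" using i by (auto simp: R_def)
      define k where "k = nat \<lfloor>s i z / \<epsilon>\<rfloor>"
      have si: "0 \<le> s i z" using z i s_P by blast
      obtain l where "l < N" "s l z \<le> r" using rmax z by blast
      then have "s i z \<le> r" using i by force
      then have "k \<le> ?M"
        unfolding k_def using eps by (intro nat_mono floor_mono divide_right_mono) auto
      moreover have "real k = of_int \<lfloor>s i z / \<epsilon>\<rfloor>" using si eps by (simp add: k_def)
      then have "real k \<le> s i z / \<epsilon>" "s i z / \<epsilon> < real k + 1" by linarith+
      then have "real k * \<epsilon> \<le> s i z" "s i z < real (Suc k) * \<epsilon>"
        using eps by (simp_all add: field_simps)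
      ultimately show "z \<in> (\<Union>k\<le>?M. \<Union>i<N. E k i)"
        using z i \<open>z \<in> R i\<close> by (auto simp: E_def)
    qed
    have U_meas: "(\<Union>i<N. E k i) \<in> lmeasurable" for k
      by (rule fmeasurable.finite_UN) (use E_meas in auto)
    have "measure lebesgue P \<le> measure lebesgue (\<Union>k\<le>?M. \<Union>i<N. E k i)"
    proof (intro measure_mono_fmeasurable cover fmeasurableD lmP)
      show "(\<Union>k\<le>?M. \<Union>i<N. E k i) \<in> lmeasurable"
        by (rule fmeasurable.finite_UN) (use U_meas in auto)
    qed
    also have "\<dots> \<le> (\<Sum>k\<le>?M. measure lebesgue (\<Union>i<N. E k i))"
      using fmeasurableD[OF U_meas] by (intro measure_UNION_le) auto
    also have "\<dots> \<le> (\<Sum>k\<le>?M. \<Sum>i<N. measure lebesgue (E k i))"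
      using fmeasurableD[OF E_meas] by (intro sum_mono measure_UNION_le) auto
    also have "\<dots> \<le> (\<Sum>k\<le>?M. D)" by (intro sum_mono layer)
    also have "\<dots> = (real ?M + 1) * D" by (simp add: algebra_simps)
    also have "\<dots> \<le> (r / \<epsilon> + 1) * D"
      using \<open>0 \<le> r\<close> eps \<open>0 \<le> D\<close> by (intro mult_right_mono add_right_mono) auto
    finally show ?thesis by (simp add: D_def)
  qed
  show ?thesis using \<open>0 \<le> r\<close> fits bound by blast
qed



section \<open>Calculus of mixed volumes\<close>

lemmas mixed_volume_axioms = monotone_mixed_volume[unfolded monotone_mixed_volume_def is_mixed_volume_def]

lemma mixed_volume_sym:
  fixes Ks :: "(real ^ 'n::finite) set list"
  assumes "length Ks = CARD('n)" "set Ks \<subseteq> compact_convex_sets" "mset Ls = mset Ks"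
  shows "mixed_volume Ls = mixed_volume Ks"
  by (rule mixed_volume_axioms[THEN conjunct1, THEN conjunct1, rule_format]) (intro conjI assms)

lemma mixed_volume_expand:
  fixes Ks :: "(real ^ 'n::finite) set list"
  assumes "length Ks = CARD('n)" "set Ks \<subseteq> compact_convex_sets" "\<forall>i<CARD('n). 0 \<le> c i"
  shows "measure lebesgue (\<Sum>i<CARD('n). (*\<^sub>R) (c i) ` (Ks ! i)) =
      (\<Sum>is | length is = CARD('n) \<and> set is \<subseteq> {..<CARD('n)}. prod_list (map c is) * mixed_volume (map ((!) Ks) is))"
  by (rule mixed_volume_axioms[THEN conjunct1, THEN conjunct2, THEN conjunct2, rule_format]) (intro conjI assms)

lemma mixed_volume_linear:
  fixes Ks :: "(real ^ 'n::finite) set list"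
  assumes "Suc (length Ks) = CARD('n)" "set Ks \<subseteq> compact_convex_sets"
    "K \<in> compact_convex_sets" "L \<in> compact_convex_sets" "0 \<le> a" "0 \<le> b"
  shows "mixed_volume (((*\<^sub>R) a ` K + (*\<^sub>R) b ` L) # Ks) = a * mixed_volume (K # Ks) + b * mixed_volume (L # Ks)"
proof -
  have "mixed_volume ((K # Ks)[0 := (*\<^sub>R) a ` K + (*\<^sub>R) b ` L]) =
      a * mixed_volume ((K # Ks)[0 := K]) + b * mixed_volume ((K # Ks)[0 := L])"
    by (rule mixed_volume_axioms[THEN conjunct1, THEN conjunct2, THEN conjunct1, rule_format])
      (use assms in auto)
  then show ?thesis by simp
qed

lemma mixed_volume_mono:
  fixes Ks :: "(real ^ 'n::finite) set list"
  assumes "Suc (length Ks) = CARD('n)" "set Ks \<subseteq> compact_convex_sets"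
    "K \<in> compact_convex_sets" "L \<in> compact_convex_sets" "K \<subseteq> L"
  shows "mixed_volume (K # Ks) \<le> mixed_volume (L # Ks)"
proof -
  have "mixed_volume (K # Ks) \<le> mixed_volume ((K # Ks)[0 := L])"
    by (rule mixed_volume_axioms[THEN conjunct2, THEN conjunct1, rule_format]) (use assms in auto)
  then show ?thesis by simp
qed

lemma mixed_volume_translate:
  fixes Ks :: "(real ^ 'n::finite) set list"
  assumes "Suc (length Ks) = CARD('n)" "set Ks \<subseteq> compact_convex_sets" "K \<in> compact_convex_sets"
  shows "mixed_volume (({t} + K) # Ks) = mixed_volume (K # Ks)"
proof -
  have "mixed_volume ((K # Ks)[0 := {t} + (K # Ks) ! 0]) = mixed_volume (K # Ks)"
    by (rule mixed_volume_axioms[THEN conjunct2, THEN conjunct2, rule_format]) (use assms in auto)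
  then show ?thesis by simp
qed

lemma mixed_volume_add_scaled:
  fixes Ks :: "(real ^ 'n::finite) set list"
  assumes "Suc (length Ks) = CARD('n)" "set Ks \<subseteq> compact_convex_sets"
    "K \<in> compact_convex_sets" "L \<in> compact_convex_sets" "0 \<le> b"
  shows "mixed_volume ((K + (*\<^sub>R) b ` L) # Ks) = mixed_volume (K # Ks) + b * mixed_volume (L # Ks)"
  using mixed_volume_linear[OF assms(1-4), of 1 b] assms(5) by simp

lemma mixed_volume_zero:
  fixes Ks :: "(real ^ 'n::finite) set list"
  assumes "Suc (length Ks) = CARD('n)" "set Ks \<subseteq> compact_convex_sets"
  shows "mixed_volume ({0} # Ks) = 0"
  using mixed_volume_linear[OF assms, of "{0}" "{0}" 0 0]
  by (simp add: singleton_in_compact_convex_sets)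

lemma mixed_volume_scale:
  fixes Ks :: "(real ^ 'n::finite) set list"
  assumes "Suc (length Ks) = CARD('n)" "set Ks \<subseteq> compact_convex_sets"
    "K \<in> compact_convex_sets" "0 \<le> a"
  shows "mixed_volume ((*\<^sub>R) a ` K # Ks) = a * mixed_volume (K # Ks)"
  using mixed_volume_add_scaled[OF assms(1,2) singleton_in_compact_convex_sets assms(3,4), of 0]
    mixed_volume_zero[OF assms(1,2)] by (simp add: add.commute[of "{0}"])

text \<open>
  Compare with a point of the first set: translates of \<open>{0}\<close> have mixed volume \<open>0\<close>.
\<close>

lemma mixed_volume_nonneg:
  fixes Ks :: "(real ^ 'n::finite) set list"
  assumes "length Ks = CARD('n)" "set Ks \<subseteq> compact_convex_sets"
  shows "0 \<le> mixed_volume Ks"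
proof (cases Ks)
  case (Cons K Ls)
  then obtain x where "x \<in> K" using assms by (auto simp: compact_convex_sets_def)
  have len: "Suc (length Ls) = CARD('n)" and Ls: "set Ls \<subseteq> compact_convex_sets" and K: "K \<in> compact_convex_sets"
    using assms Cons by auto
  have "0 = mixed_volume (({x} + {0}) # Ls)"
    unfolding mixed_volume_translate[OF len Ls singleton_in_compact_convex_sets] mixed_volume_zero[OF len Ls] ..
  also have "\<dots> \<le> mixed_volume (K # Ls)"
    using \<open>x \<in> K\<close> by (intro mixed_volume_mono len Ls K plus_in_compact_convex_sets singleton_in_compact_convex_sets) auto
  finally show ?thesis by (simp add: Cons)
qed (use assms in simp)

lemma mixed_volume_sum:
  fixes Ks :: "(real ^ 'n::finite) set list"
  assumes "Suc (length Ks) = CARD('n)" "set Ks \<subseteq> compact_convex_sets" "finite I"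
    "\<And>i. i \<in> I \<Longrightarrow> B i \<in> compact_convex_sets"
  shows "(\<Sum>i\<in>I. B i) \<in> compact_convex_sets \<and> mixed_volume ((\<Sum>i\<in>I. B i) # Ks) = (\<Sum>i\<in>I. mixed_volume (B i # Ks))"
  using assms(3,4)
proof (induction I rule: finite_induct)
  case empty
  then show ?case using mixed_volume_zero[OF assms(1,2)] singleton_in_compact_convex_sets[of 0] by (simp add: set_zero)
next
  case (insert i I)
  then have "B i \<in> compact_convex_sets" "(\<Sum>i\<in>I. B i) \<in> compact_convex_sets" by auto
  then show ?case
    using mixed_volume_add_scaled[OF assms(1,2), of "B i" "\<Sum>i\<in>I. B i" 1] insert
      plus_in_compact_convex_sets[of "B i" "\<Sum>i\<in>I. B i"]
    by simp
qed

lemma mixed_volume_replicate: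
  fixes K :: "(real ^ 'n::finite) set"
  assumes "K \<in> compact_convex_sets"
  shows "mixed_volume (replicate CARD('n) K) = measure lebesgue K"
proof -
  let ?n = "CARD('n)"
  let ?c = "\<lambda>i :: nat. of_bool (i = 0) :: real"
  have "K \<noteq> {}" using assms by (auto simp: compact_convex_sets_def)
  then have "(\<Sum>i<?n. (*\<^sub>R) (?c i) ` (replicate ?n K ! i)) = K"
    using select_scaleR[of "{..<?n}" 0 "\<lambda>_. K"] by simp
  then have "measure lebesgue K =
     (\<Sum>is | length is = ?n \<and> set is \<subseteq> {..<?n}. prod_list (map ?c is) * mixed_volume (map ((!) (replicate ?n K)) is))"
    using mixed_volume_expand[of "replicate ?n K" ?c] assms by simp
  also have "\<dots> = (\<Sum>is\<in>{replicate ?n 0}. prod_list (map ?c is) * mixed_volume (map ((!) (replicate ?n K)) is))"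
  proof (intro sum.mono_neutral_right ballI)
    show "finite {is. length is = ?n \<and> set is \<subseteq> {..<?n}}"
      using finite_lists_length_eq[of "{..<?n}" ?n] by (simp add: conj_commute)
    show "{replicate ?n 0} \<subseteq> {is. length is = ?n \<and> set is \<subseteq> {..<?n}}" by auto
    fix "is" assume "is \<in> {is. length is = ?n \<and> set is \<subseteq> {..<?n}} - {replicate ?n 0}"
    then have "length is = ?n" "is \<noteq> replicate ?n 0" by auto
    then have "\<exists>i\<in>set is. i \<noteq> 0" by (metis replicate_eqI)
    then have "prod_list (map ?c is) = 0" by (force simp: prod_list_zero_iff)
    then show "prod_list (map ?c is) * mixed_volume (map ((!) (replicate ?n K)) is) = 0" by simp
  qed
  finally show ?thesis by simp
qed

text \<open>
  By multilinearity the expression under the limit is a polynomial in \<open>\<delta>\<close> for \<open>\<delta> > 0\<close>; the list is processed one entry at a time,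
  moving finished entries to \<open>Bs\<close>.
\<close>

lemma mixed_volume_perturb:
  fixes As Bs :: "(real ^ 'n::finite) set list"
  assumes "length As + length Bs = CARD('n)" "set As \<subseteq> compact_convex_sets" "set Bs \<subseteq> compact_convex_sets"
    and B: "B \<in> compact_convex_sets"
  shows "((\<lambda>\<delta>. mixed_volume (map (\<lambda>K. K + (*\<^sub>R) \<delta> ` B) As @ Bs)) \<longlongrightarrow> mixed_volume (As @ Bs)) (at_right 0)"
  using assms(1-3)
proof (induction As arbitrary: Bs)
  case (Cons A As)
  let ?M = "\<lambda>\<delta>. map (\<lambda>K. K + (*\<^sub>R) \<delta> ` B) As"
  have A: "A \<in> compact_convex_sets" and As: "set As \<subseteq> compact_convex_sets" using Cons.prems by auto
  have M: "set (?M \<delta>) \<subseteq> compact_convex_sets" for \<delta>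
    using As B by (auto intro!: plus_in_compact_convex_sets scaleR_in_compact_convex_sets)
  have move: "mixed_volume (X # ?M \<delta> @ Bs) = mixed_volume (?M \<delta> @ X # Bs)" if "X \<in> compact_convex_sets" for X \<delta>
    using that M Cons.prems by (intro mixed_volume_sym) auto
  have move0: "mixed_volume (A # As @ Bs) = mixed_volume (As @ A # Bs)"
    using A As Cons.prems by (intro mixed_volume_sym) auto
  have "mixed_volume (?M \<delta> @ A # Bs) + \<delta> * mixed_volume (?M \<delta> @ B # Bs) =
      mixed_volume (map (\<lambda>K. K + (*\<^sub>R) \<delta> ` B) (A # As) @ Bs)" if "0 < \<delta>" for \<delta>
    using mixed_volume_add_scaled[of "?M \<delta> @ Bs" A B \<delta>] that A B M Cons.prems by (simp add: move)
  then have "\<forall>\<^sub>F \<delta> in at_right 0. mixed_volume (?M \<delta> @ A # Bs) + \<delta> * mixed_volume (?M \<delta> @ B # Bs) =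
      mixed_volume (map (\<lambda>K. K + (*\<^sub>R) \<delta> ` B) (A # As) @ Bs)"
    by (intro eventually_at_right_less[THEN eventually_mono]) auto
  moreover have "((\<lambda>\<delta>. mixed_volume (?M \<delta> @ A # Bs) + \<delta> * mixed_volume (?M \<delta> @ B # Bs)) \<longlongrightarrow>
      mixed_volume (As @ A # Bs) + 0 * mixed_volume (As @ B # Bs)) (at_right 0)"
    using A B As Cons.prems by (intro tendsto_intros Cons.IH) auto
  ultimately show ?case using move0 by (simp add: tendsto_cong)
qed simp

lemma mixed_volume_mono_replicate:
  fixes As :: "(real ^ 'n::finite) set list"
  assumes "length As + k = CARD('n)" "set As \<subseteq> compact_convex_sets"
    "X \<in> compact_convex_sets" "Y \<in> compact_convex_sets" "X \<subseteq> Y"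
  shows "mixed_volume (As @ replicate k X) \<le> mixed_volume (As @ replicate k Y)"
  using assms(1,2)
proof (induction k arbitrary: As)
  case (Suc k)
  have set: "set (As @ replicate k X) \<subseteq> compact_convex_sets" using Suc.prems assms(3) by auto
  have "mixed_volume (As @ X # replicate k X) = mixed_volume (X # As @ replicate k X)"
    using Suc.prems set assms(3) by (intro mixed_volume_sym) auto
  also have "\<dots> \<le> mixed_volume (Y # As @ replicate k X)"
    using Suc.prems set assms by (intro mixed_volume_mono) auto
  also have "\<dots> = mixed_volume ((As @ [Y]) @ replicate k X)"
    using Suc.prems set assms(4) by (intro mixed_volume_sym) auto
  also have "\<dots> \<le> mixed_volume ((As @ [Y]) @ replicate k Y)"
    using Suc.prems assms(4) by (intro Suc.IH) auto
  finally show ?case by simp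
qed simp

text \<open>
  Telescoping from \<open>P, ..., P\<close> to \<open>P + \<epsilon> L, ..., P + \<epsilon> L\<close>, each step changes one argument and
  contributes \<open>\<epsilon>\<close> times a mixed volume that tends to \<open>V(L, P[n-1])\<close>.
\<close>

lemma volume_derivative:
  fixes P L :: "(real ^ 'n::finite) set"
  assumes P: "P \<in> compact_convex_sets" and L: "L \<in> compact_convex_sets"
  shows "((\<lambda>\<epsilon>. (measure lebesgue (P + (*\<^sub>R) \<epsilon> ` L) - measure lebesgue P) / \<epsilon>) \<longlongrightarrow>
    real CARD('n) * mixed_volume (L # replicate (CARD('n) - 1) P)) (at_right 0)"
proof -
  let ?n = "CARD('n)"
  let ?M = "\<lambda>\<epsilon>. P + (*\<^sub>R) \<epsilon> ` L"
  have M: "?M \<epsilon> \<in> compact_convex_sets" for \<epsilon>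
    using P L by (intro plus_in_compact_convex_sets scaleR_in_compact_convex_sets)
  define T where "T k \<epsilon> = mixed_volume (replicate k (?M \<epsilon>) @ L # replicate (?n - 1 - k) P)" for k \<epsilon>
  define S where "S k \<epsilon> = mixed_volume (replicate k (?M \<epsilon>) @ replicate (?n - k) P)" for k \<epsilon>
  have step: "S (Suc k) \<epsilon> - S k \<epsilon> = \<epsilon> * T k \<epsilon>" if k: "k < ?n" and e: "0 < \<epsilon>" for k \<epsilon>
  proof -
    let ?R = "replicate k (?M \<epsilon>) @ replicate (?n - 1 - k) P"
    have R: "set ?R \<subseteq> compact_convex_sets" "Suc (length ?R) = ?n" using M P k by auto
    have mv: "mixed_volume (replicate k (?M \<epsilon>) @ X # replicate (?n - 1 - k) P) = mixed_volume (X # ?R)"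
      if "X \<in> compact_convex_sets" for X
      using that R by (intro mixed_volume_sym) auto
    have "S (Suc k) \<epsilon> = mixed_volume (replicate k (?M \<epsilon>) @ ?M \<epsilon> # replicate (?n - 1 - k) P)"
      unfolding S_def replicate_Suc using k by (simp add: replicate_append_same[symmetric])
    moreover have "?n - k = Suc (?n - 1 - k)" using k by auto
    then have "S k \<epsilon> = mixed_volume (replicate k (?M \<epsilon>) @ P # replicate (?n - 1 - k) P)"
      unfolding S_def by simp
    ultimately show ?thesis
      unfolding T_def mv[OF M] mv[OF P] mv[OF L]
      using mixed_volume_add_scaled[OF R(2,1) P L, of \<epsilon>] e by simp
  qed
  have "(measure lebesgue (?M \<epsilon>) - measure lebesgue P) / \<epsilon> = (\<Sum>k<?n. T k \<epsilon>)" if e: "0 < \<epsilon>" for \<epsilon>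
  proof -
    have "measure lebesgue (?M \<epsilon>) - measure lebesgue P = S ?n \<epsilon> - S 0 \<epsilon>"
      unfolding S_def using mixed_volume_replicate[OF M] mixed_volume_replicate[OF P] by simp
    also have "\<dots> = (\<Sum>k<?n. S (Suc k) \<epsilon> - S k \<epsilon>)" by (rule sum_lessThan_telescope[symmetric])
    also have "\<dots> = \<epsilon> * (\<Sum>k<?n. T k \<epsilon>)" using step e by (simp add: sum_distrib_left)
    finally show ?thesis using e by simp
  qed
  then have "\<forall>\<^sub>F \<epsilon> in at_right 0. (measure lebesgue (?M \<epsilon>) - measure lebesgue P) / \<epsilon> = (\<Sum>k<?n. T k \<epsilon>)"
    by (intro eventually_at_right_less[THEN eventually_mono]) auto
  moreover have "(T k \<longlongrightarrow> mixed_volume (L # replicate (?n - 1) P)) (at_right 0)" if k: "k < ?n" for k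
  proof -
    have "((\<lambda>\<epsilon>. mixed_volume (map (\<lambda>K. K + (*\<^sub>R) \<epsilon> ` L) (replicate k P) @ (L # replicate (?n - 1 - k) P))) \<longlongrightarrow>
       mixed_volume (replicate k P @ (L # replicate (?n - 1 - k) P))) (at_right 0)"
      using k P L by (intro mixed_volume_perturb) auto
    moreover have "mixed_volume (replicate k P @ (L # replicate (?n - 1 - k) P)) = mixed_volume (L # replicate (?n - 1) P)"
    proof (intro mixed_volume_sym)
      have "replicate k P @ replicate (?n - 1 - k) P = replicate (?n - 1) P"
        using k by (simp flip: replicate_add)
      then show "mset (replicate k P @ (L # replicate (?n - 1 - k) P)) = mset (L # replicate (?n - 1) P)"
        by (metis (no_types, lifting) append_Cons mset.simps(2) mset_append union_mset_add_mset_right)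
    qed (use k P L in auto)
    ultimately show ?thesis by (simp add: T_def[abs_def])
  qed
  then have "((\<lambda>\<epsilon>. \<Sum>k<?n. T k \<epsilon>) \<longlongrightarrow> (\<Sum>k<?n. mixed_volume (L # replicate (?n - 1) P))) (at_right 0)"
    by (intro tendsto_sum) auto
  ultimately show ?thesis by (simp add: tendsto_cong)
qed



section \<open>The upper bound\<close>

text \<open>
  Let \<open>\<epsilon>\<close> tend to \<open>0\<close> in \<open>layer_bound\<close>. That \<open>0\<close> is interior to \<open>L\<close> makes the support function
  of \<open>L\<close> positive at the normals of \<open>P\<close>.
\<close>

lemma polytope_volume_bound:
  fixes P L :: "(real ^ 'n::finite) set"
  assumes P: "polytope P" "P \<noteq> {}" and L: "L \<in> compact_convex_sets" "0 \<in> interior L"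
  shows "\<exists>x0 r. 0 \<le> r \<and> (\<forall>x\<in>L. x0 + r *\<^sub>R x \<in> P) \<and>
    measure lebesgue P \<le> r * (real CARD('n) * mixed_volume (L # replicate (CARD('n) - 1) P))"
proof -
  have cP: "compact P" "convex P"
    using P polytope_imp_compact polytope_imp_convex by auto
  then have P': "P \<in> compact_convex_sets" using P by (simp add: compact_convex_sets_def)
  have cL: "compact L" "convex L" "0 \<in> L" using L interior_subset by (auto simp: compact_convex_sets_def)
  obtain F where F: "finite F" "P = \<Inter>F" "\<forall>h\<in>F. \<exists>a b. a \<noteq> 0 \<and> h = {x. a \<bullet> x \<le> b}"
    using polytope_imp_polyhedron[OF P(1)] unfolding polyhedron_def by auto
  obtain f where f: "bij_betw f {0..<card F} F" using ex_bij_betw_nat_finite[OF F(1)] by blast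
  let ?N = "card F"
  have fF: "f i \<in> F" if "i < ?N" for i using f that by (auto simp: bij_betw_def)
  have "\<forall>i. \<exists>a b. i < ?N \<longrightarrow> a \<noteq> 0 \<and> f i = {x. a \<bullet> x \<le> b}"
    using F(3) fF by blast
  then obtain u h where uh: "\<forall>i. i < ?N \<longrightarrow> u i \<noteq> 0 \<and> f i = {x. u i \<bullet> x \<le> h i}"
    by metis
  have "P = \<Inter>(f ` {0..<?N})" using f F(2) by (simp add: bij_betw_def)
  then have P_eq: "P = {z. \<forall>i<?N. u i \<bullet> z \<le> h i}" using uh by auto
  have N: "0 < ?N"
  proof (rule ccontr)
    assume "\<not> 0 < ?N"
    then have "P = UNIV" using P_eq by simp
    then show False using compact_imp_bounded[OF cP(1)] not_bounded_UNIV by simp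
  qed
  have "\<forall>i. \<exists>q\<in>L. \<forall>x\<in>L. u i \<bullet> x \<le> u i \<bullet> q"
    using cL by (intro allI continuous_attains_sup) (auto intro!: continuous_intros)
  then obtain p where p: "\<And>i. p i \<in> L" "\<And>i x. x \<in> L \<Longrightarrow> u i \<bullet> x \<le> u i \<bullet> p i"
    by metis
  have pos: "0 < u i \<bullet> p i" if "i < ?N" for i
  proof -
    obtain e where e: "e > 0" "cball 0 e \<subseteq> L" using L(2) by (meson mem_interior_cball)
    have un: "norm (u i) > 0" using uh that by simp
    then have "(e / norm (u i)) *\<^sub>R u i \<in> L" using e by (intro subsetD[OF e(2)]) simp
    then have "u i \<bullet> ((e / norm (u i)) *\<^sub>R u i) \<le> u i \<bullet> p i" by (rule p(2))
    moreover have "0 < u i \<bullet> ((e / norm (u i)) *\<^sub>R u i)" using e un by simp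
    ultimately show ?thesis by linarith
  qed
  obtain x0 r where r: "0 \<le> r" "\<forall>x\<in>L. x0 + r *\<^sub>R x \<in> P"
    and b: "\<And>\<epsilon>. \<epsilon> > 0 \<Longrightarrow> measure lebesgue P \<le> (r / \<epsilon> + 1) * (measure lebesgue (P + (*\<^sub>R) \<epsilon> ` L) - measure lebesgue P)"
    using layer_bound[OF P_eq cP(1) P(2) N cL p pos] by blast
  let ?q = "\<lambda>\<epsilon>. (measure lebesgue (P + (*\<^sub>R) \<epsilon> ` L) - measure lebesgue P) / \<epsilon>"
  let ?D = "real CARD('n) * mixed_volume (L # replicate (CARD('n) - 1) P)"
  have "((\<lambda>\<epsilon>. r * ?q \<epsilon> + \<epsilon> * ?q \<epsilon>) \<longlongrightarrow> r * ?D + 0 * ?D) (at_right 0)"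
    by (intro tendsto_intros volume_derivative P' L)
  moreover have "measure lebesgue P \<le> r * ?q \<epsilon> + \<epsilon> * ?q \<epsilon>" if "0 < \<epsilon>" for \<epsilon>
    using b[OF that] that by (simp add: distrib_right)
  then have "\<forall>\<^sub>F \<epsilon> in at_right 0. measure lebesgue P \<le> r * ?q \<epsilon> + \<epsilon> * ?q \<epsilon>"
    by (intro eventually_at_right_less[THEN eventually_mono]) auto
  ultimately have "measure lebesgue P \<le> r * ?D + 0 * ?D"
    by (intro tendsto_le[OF _ _ tendsto_const]) auto
  then show ?thesis using r by auto
qed

lemma bezout_polytope:
  fixes P L :: "(real ^ 'n::finite) set"
  assumes P: "polytope P" "P \<noteq> {}" and L: "L \<in> compact_convex_sets" "0 \<in> interior L"
    and Ls: "Suc (length Ls) = CARD('n)" "set Ls \<subseteq> compact_convex_sets"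
  shows "mixed_volume (L # Ls) * measure lebesgue P \<le>
    real CARD('n) * mixed_volume (L # replicate (CARD('n) - 1) P) * mixed_volume (P # Ls)"
proof -
  let ?D = "real CARD('n) * mixed_volume (L # replicate (CARD('n) - 1) P)"
  have P': "P \<in> compact_convex_sets"
    using P polytope_imp_compact polytope_imp_convex by (auto simp: compact_convex_sets_def)
  obtain x0 r where r: "0 \<le> r" "\<forall>x\<in>L. x0 + r *\<^sub>R x \<in> P" and vol: "measure lebesgue P \<le> r * ?D"
    using polytope_volume_bound[OF P L] by blast
  have D: "0 \<le> ?D" using P' L by (intro mult_nonneg_nonneg mixed_volume_nonneg) auto
  have "{x0} + (*\<^sub>R) r ` L \<subseteq> P" using r(2) by (auto simp: set_plus_def)
  then have "mixed_volume (({x0} + (*\<^sub>R) r ` L) # Ls) \<le> mixed_volume (P # Ls)"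
    using L P' by (intro mixed_volume_mono Ls plus_in_compact_convex_sets scaleR_in_compact_convex_sets
        singleton_in_compact_convex_sets)
  then have le: "r * mixed_volume (L # Ls) \<le> mixed_volume (P # Ls)"
    using mixed_volume_translate[OF Ls scaleR_in_compact_convex_sets[OF L(1)], of x0 r]
      mixed_volume_scale[OF Ls L(1) r(1)] by simp
  have "mixed_volume (L # Ls) * measure lebesgue P \<le> mixed_volume (L # Ls) * (r * ?D)"
    using vol L Ls by (intro mult_left_mono mixed_volume_nonneg) auto
  also have "\<dots> = ?D * (r * mixed_volume (L # Ls))" by simp
  also have "\<dots> \<le> ?D * mixed_volume (P # Ls)" using le D by (intro mult_left_mono)
  finally show ?thesis .
qed

lemma cball_in_compact_convex_sets: "0 \<le> r \<Longrightarrow> cball 0 r \<in> compact_convex_sets"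
  by (auto simp: compact_convex_sets_def)

lemma scaleR_cball: "0 \<le> \<delta> \<Longrightarrow> (*\<^sub>R) \<delta> ` cball (0::'a::real_normed_vector) 1 = cball 0 \<delta>"
  using cball_scale[of \<delta> 0 1] by (cases "\<delta> = 0") (auto simp: image_constant_conv)

text \<open>
  First \<open>K\<close> is enclosed in polytopes within \<open>K + \<delta> B\<close>, then \<open>L\<close>, translated to contain \<open>0\<close>, is replaced
  by \<open>L + \<delta> B\<close>, where \<open>B\<close> is the unit ball. In both cases the inequality survives \<open>\<delta> \<rightarrow> 0\<close>.
\<close>

lemma mixed_volume_bezout:
  fixes K L :: "(real ^ 'n::finite) set"
  assumes K: "K \<in> compact_convex_sets" and L: "L \<in> compact_convex_sets"
    and Ls: "Suc (length Ls) = CARD('n)" "set Ls \<subseteq> compact_convex_sets"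
  shows "mixed_volume (L # Ls) * measure lebesgue K \<le>
    real CARD('n) * mixed_volume (L # replicate (CARD('n) - 1) K) * mixed_volume (K # Ls)"
proof -
  let ?n = "CARD('n)"
  let ?B = "cball (0::real^'n) 1"
  have B: "?B \<in> compact_convex_sets" by (rule cball_in_compact_convex_sets) simp
  have inner: "mixed_volume (M # Ls) * measure lebesgue K \<le>
      real ?n * mixed_volume (M # replicate (?n - 1) K) * mixed_volume (K # Ls)"
    if M: "M \<in> compact_convex_sets" "0 \<in> interior M" for M
  proof -
    let ?K = "\<lambda>\<delta>. K + (*\<^sub>R) \<delta> ` ?B"
    have K\<delta>: "?K \<delta> \<in> compact_convex_sets" for \<delta>
      using K B by (intro plus_in_compact_convex_sets scaleR_in_compact_convex_sets)
    have "mixed_volume (M # Ls) * measure lebesgue K \<le>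
      real ?n * mixed_volume (M # replicate (?n - 1) (?K \<delta>)) * mixed_volume (?K \<delta> # Ls)" if d: "0 < \<delta>" for \<delta>
    proof -
      obtain P where P: "polytope P" "K \<subseteq> P" "P \<subseteq> K + cball 0 \<delta>"
        using polytope_approximation[of K \<delta>] K d by (auto simp: compact_convex_sets_def)
      have PK: "P \<subseteq> ?K \<delta>" using P(3) d by (simp add: scaleR_cball)
      have "P \<noteq> {}" using P K by (auto simp: compact_convex_sets_def)
      then have P': "P \<in> compact_convex_sets"
        using P polytope_imp_compact polytope_imp_convex by (auto simp: compact_convex_sets_def)
      have "mixed_volume (M # Ls) * measure lebesgue K \<le> mixed_volume (M # Ls) * measure lebesgue P"
        using P K P' M Ls
        by (intro mult_left_mono mixed_volume_nonneg measure_mono_fmeasurable)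
          (auto simp: compact_convex_sets_def intro: lmeasurable_compact fmeasurableD)
      also have "\<dots> \<le> real ?n * mixed_volume (M # replicate (?n - 1) P) * mixed_volume (P # Ls)"
        using P(1) \<open>P \<noteq> {}\<close> M Ls by (rule bezout_polytope)
      also have "\<dots> \<le> real ?n * mixed_volume (M # replicate (?n - 1) (?K \<delta>)) * mixed_volume (?K \<delta> # Ls)"
      proof (intro mult_mono mult_nonneg_nonneg mixed_volume_nonneg)
        show "mixed_volume (M # replicate (?n - 1) P) \<le> mixed_volume (M # replicate (?n - 1) (?K \<delta>))"
          using mixed_volume_mono_replicate[of "[M]" "?n - 1" P "?K \<delta>"] M P' K\<delta> PK by simp
        show "mixed_volume (P # Ls) \<le> mixed_volume (?K \<delta> # Ls)"
          using Ls P' K\<delta> PK by (intro mixed_volume_mono)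
      qed (use M P' K\<delta> Ls in auto)
      finally show ?thesis .
    qed
    then have ev: "\<forall>\<^sub>F \<delta> in at_right 0. mixed_volume (M # Ls) * measure lebesgue K \<le>
      real ?n * mixed_volume (M # replicate (?n - 1) (?K \<delta>)) * mixed_volume (?K \<delta> # Ls)"
      by (intro eventually_at_right_less[THEN eventually_mono]) auto
    have l1: "((\<lambda>\<delta>. mixed_volume (M # replicate (?n - 1) (?K \<delta>))) \<longlongrightarrow> mixed_volume (M # replicate (?n - 1) K)) (at_right 0)"
    proof -
      have s: "mixed_volume (replicate (?n - 1) X @ [M]) = mixed_volume (M # replicate (?n - 1) X)"
        if "X \<in> compact_convex_sets" for X
        using that M by (intro mixed_volume_sym) auto
      have "((\<lambda>\<delta>. mixed_volume (map (\<lambda>K. K + (*\<^sub>R) \<delta> ` ?B) (replicate (?n - 1) K) @ [M])) \<longlongrightarrow>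
          mixed_volume (replicate (?n - 1) K @ [M])) (at_right 0)"
        using K M B by (intro mixed_volume_perturb) auto
      then show ?thesis using s[OF K] s[OF K\<delta>] by simp
    qed
    have l2: "((\<lambda>\<delta>. mixed_volume (?K \<delta> # Ls)) \<longlongrightarrow> mixed_volume (K # Ls)) (at_right 0)"
      using mixed_volume_perturb[of "[K]" Ls ?B] K B Ls by simp
    have "((\<lambda>\<delta>. real ?n * mixed_volume (M # replicate (?n - 1) (?K \<delta>)) * mixed_volume (?K \<delta> # Ls)) \<longlongrightarrow>
      real ?n * mixed_volume (M # replicate (?n - 1) K) * mixed_volume (K # Ls)) (at_right 0)"
      by (intro tendsto_mult tendsto_const l1 l2)
    from tendsto_le[OF _ this tendsto_const ev] show ?thesis by simp
  qed
  obtain a where a: "a \<in> L" using L by (auto simp: compact_convex_sets_def)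
  let ?M = "\<lambda>\<delta>. ({-a} + L) + (*\<^sub>R) \<delta> ` ?B"
  have aL: "{-a} + L \<in> compact_convex_sets"
    using L by (intro plus_in_compact_convex_sets singleton_in_compact_convex_sets)
  have shape: "mixed_volume (?M \<delta> # Ks) = mixed_volume (L # Ks) + \<delta> * mixed_volume (?B # Ks)"
    if "0 < \<delta>" "Suc (length Ks) = ?n" "set Ks \<subseteq> compact_convex_sets" for \<delta> Ks
    using that L mixed_volume_add_scaled[OF that(2,3) aL B] mixed_volume_translate[OF that(2,3) L] by simp
  let ?R = "replicate (?n - 1) K"
  have R: "Suc (length ?R) = ?n" "set ?R \<subseteq> compact_convex_sets" using K by auto
  have "(mixed_volume (L # Ls) + \<delta> * mixed_volume (?B # Ls)) * measure lebesgue K \<le>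
      real ?n * (mixed_volume (L # ?R) + \<delta> * mixed_volume (?B # ?R)) * mixed_volume (K # Ls)" if d: "0 < \<delta>" for \<delta>
  proof -
    have "?M \<delta> \<in> compact_convex_sets"
      by (rule plus_in_compact_convex_sets[OF aL scaleR_in_compact_convex_sets[OF B]])
    moreover have "0 \<in> interior (?M \<delta>)"
    proof -
      have "0 \<in> {-a} + L" using a by (auto simp: set_plus_def)
      then have "cball 0 \<delta> \<subseteq> ?M \<delta>" using set_zero_plus2[of "{-a} + L" "cball 0 \<delta>"] d by (simp add: scaleR_cball)
      then show ?thesis using d by (meson mem_interior_cball)
    qed
    ultimately show ?thesis using inner[of "?M \<delta>"] shape[OF d Ls] shape[OF d R] by simp
  qed
  then have ev: "\<forall>\<^sub>F \<delta> in at_right 0. (mixed_volume (L # Ls) + \<delta> * mixed_volume (?B # Ls)) * measure lebesgue K \<le>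
      real ?n * (mixed_volume (L # ?R) + \<delta> * mixed_volume (?B # ?R)) * mixed_volume (K # Ls)"
    by (intro eventually_at_right_less[THEN eventually_mono]) auto
  have l1: "((\<lambda>\<delta>. (mixed_volume (L # Ls) + \<delta> * mixed_volume (?B # Ls)) * measure lebesgue K) \<longlongrightarrow>
      (mixed_volume (L # Ls) + 0 * mixed_volume (?B # Ls)) * measure lebesgue K) (at_right 0)"
    by (intro tendsto_intros)
  have l2: "((\<lambda>\<delta>. real ?n * (mixed_volume (L # ?R) + \<delta> * mixed_volume (?B # ?R)) * mixed_volume (K # Ls)) \<longlongrightarrow>
      real ?n * (mixed_volume (L # ?R) + 0 * mixed_volume (?B # ?R)) * mixed_volume (K # Ls)) (at_right 0)"
    by (intro tendsto_intros)
  from tendsto_le[OF _ l2 l1 ev] show ?thesis by simp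
qed

section \<open>Sharpness\<close>

definition edge :: "real ^ 'n::finite \<Rightarrow> (real ^ 'n) set" where
  "edge b = (\<lambda>t. t *\<^sub>R b) ` {0..1}"

lemma edge_in_compact_convex_sets: "edge b \<in> compact_convex_sets"
proof -
  have "linear (\<lambda>t. t *\<^sub>R b)" by (rule linear_scale_left)
  then show ?thesis
    unfolding compact_convex_sets_def edge_def
    by (auto intro!: compact_continuous_image continuous_intros convex_linear_image)
qed

lemma cube_eq_sum_edges: "cbox 0 One = (\<Sum>b\<in>Basis. edge (b :: real ^ 'n::finite))"
proof -
  have "cbox 0 One = {x :: real ^ 'n. \<forall>i\<in>Basis. x \<bullet> i \<in> {0..1}}"
    by (auto simp: cbox_def)
  also have "\<dots> = (\<Sum>b\<in>Basis. edge b)"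
    unfolding box_eq_set_sum_Basis edge_def ..
  finally show ?thesis .
qed

text \<open>
  The edges in \<open>cs\<close> lie in a common hyperplane, so their sum has volume \<open>0\<close>. This volume is a sum of
  nonnegative mixed volumes, one of which is the claimed one.
\<close>

lemma mixed_volume_edges_zero:
  fixes cs :: "(real ^ 'n::finite) list"
  assumes len: "length cs = CARD('n)" and b: "b \<in> Basis" "b \<notin> set cs" and cs: "set cs \<subseteq> Basis"
  shows "mixed_volume (map edge cs) = 0"
proof -
  let ?n = "CARD('n)" and ?Ks = "map edge cs"
  have Ks: "length ?Ks = ?n" "set ?Ks \<subseteq> compact_convex_sets"
    using len edge_in_compact_convex_sets by auto
  have edge0: "x \<bullet> b = 0" if "c \<in> set cs" "x \<in> edge c" for c x
    using that b cs by (auto simp: edge_def inner_Basis subset_iff)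
  have "(\<Sum>i<?n. (*\<^sub>R) 1 ` (?Ks ! i)) \<subseteq> {x. b \<bullet> x = 0}"
  proof
    fix x assume "x \<in> (\<Sum>i<?n. (*\<^sub>R) 1 ` (?Ks ! i))"
    then obtain s where x: "x = sum s {..<?n}" and s: "\<forall>i\<in>{..<?n}. s i \<in> (*\<^sub>R) 1 ` (?Ks ! i)"
      unfolding set_sum_alt[OF finite_lessThan] by auto
    have "s i \<bullet> b = 0" if "i < ?n" for i
      using s that len edge0[of "cs ! i" "s i"] by auto
    then show "x \<in> {x. b \<bullet> x = 0}" by (simp add: x inner_commute[of b] inner_sum_left)
  qed
  moreover have "negligible {x. b \<bullet> x = 0}"
    using nonzero_Basis[OF b(1)] by (simp add: negligible_hyperplane)
  ultimately have "measure lebesgue (\<Sum>i<?n. (*\<^sub>R) 1 ` (?Ks ! i)) = 0"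
    using negligible_subset negligible_imp_measure0 by blast
  then have sum0: "(\<Sum>is | length is = ?n \<and> set is \<subseteq> {..<?n}. mixed_volume (map ((!) ?Ks) is)) = 0"
    using mixed_volume_expand[OF Ks, of "\<lambda>_. 1"] by (simp add: map_replicate_const)
  have nn: "0 \<le> mixed_volume (map ((!) ?Ks) is)" if "is \<in> {is. length is = ?n \<and> set is \<subseteq> {..<?n}}" for "is"
    using that len by (intro mixed_volume_nonneg) (auto simp: subset_iff edge_in_compact_convex_sets)
  have "finite {is. length is = ?n \<and> set is \<subseteq> {..<?n}}"
    using finite_lists_length_eq[of "{..<?n}" ?n] by (simp add: conj_commute)
  from sum_nonneg_0[OF this nn sum0, of "[0..<?n]"]
  have "mixed_volume (map ((!) ?Ks) [0..<?n]) = 0" by (simp add: atLeast0LessThan)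
  then show ?thesis using len map_nth[of ?Ks] by simp
qed

lemma measure_cube: "measure lebesgue (cbox 0 One :: (real ^ 'n::finite) set) = 1"
  by (simp add: measure_completion content_unit)

lemma measure_elongated_cube:
  fixes b :: "real ^ 'n::finite"
  assumes b: "b \<in> Basis" and e: "0 \<le> \<epsilon>"
  shows "measure lebesgue (cbox 0 One + (*\<^sub>R) \<epsilon> ` edge b) = 1 + \<epsilon>"
proof -
  have "cbox 0 One + (*\<^sub>R) \<epsilon> ` edge b = cbox 0 (One + \<epsilon> *\<^sub>R b)"
  proof
    show "cbox 0 One + (*\<^sub>R) \<epsilon> ` edge b \<subseteq> cbox 0 (One + \<epsilon> *\<^sub>R b)"
    proof
      fix x assume "x \<in> cbox 0 One + (*\<^sub>R) \<epsilon> ` edge b"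
      then obtain y t where x: "x = y + \<epsilon> *\<^sub>R t *\<^sub>R b" and y: "y \<in> cbox 0 One" and t: "0 \<le> t" "t \<le> 1"
        by (auto simp: set_plus_def edge_def)
      have "\<epsilon> * t \<le> \<epsilon>" "0 \<le> \<epsilon> * t" using t e by (auto simp: mult_left_le)
      then show "x \<in> cbox 0 (One + \<epsilon> *\<^sub>R b)"
        using y b unfolding x by (auto simp: mem_box inner_add_left inner_Basis add_mono)
    qed
    show "cbox 0 (One + \<epsilon> *\<^sub>R b) \<subseteq> cbox 0 One + (*\<^sub>R) \<epsilon> ` edge b"
    proof
      fix x assume x: "x \<in> cbox 0 (One + \<epsilon> *\<^sub>R b)"
      define s where "s = max 0 (x \<bullet> b - 1)"
      have xb: "0 \<le> x \<bullet> b" "x \<bullet> b \<le> 1 + \<epsilon>" using x b by (auto simp: mem_box inner_add_left)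
      have xi: "0 \<le> x \<bullet> i \<and> x \<bullet> i \<le> 1" if "i \<in> Basis" "i \<noteq> b" for i
        using x b that by (auto simp: mem_box inner_add_left inner_Basis)
      have s: "0 \<le> s" "s \<le> \<epsilon>" using xb e by (auto simp: s_def)
      have "x - s *\<^sub>R b \<in> cbox 0 One"
        unfolding mem_box
      proof
        fix i :: "real^'n" assume i: "i \<in> Basis"
        show "0 \<bullet> i \<le> (x - s *\<^sub>R b) \<bullet> i \<and> (x - s *\<^sub>R b) \<bullet> i \<le> One \<bullet> i"
          using xi[OF i] xb i b by (cases "i = b") (auto simp: inner_diff_left inner_Basis s_def)
      qed
      moreover have "s *\<^sub>R b \<in> (*\<^sub>R) \<epsilon> ` edge b"
      proof (cases "\<epsilon> = 0")
        case True
        then show ?thesis using s by (auto simp: edge_def image_image intro: image_eqI[of _ _ 0])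
      next
        case False
        then show ?thesis using s e
          by (auto simp: edge_def image_image intro!: image_eqI[of _ _ "s / \<epsilon>"])
      qed
      ultimately have "(x - s *\<^sub>R b) + s *\<^sub>R b \<in> cbox 0 One + (*\<^sub>R) \<epsilon> ` edge b"
        by (rule set_plus_intro)
      then show "x \<in> cbox 0 One + (*\<^sub>R) \<epsilon> ` edge b" by simp
    qed
  qed
  moreover have "measure lebesgue (cbox 0 (One + \<epsilon> *\<^sub>R b)) = (\<Prod>i\<in>Basis. (One + \<epsilon> *\<^sub>R b) \<bullet> i)"
    using e b by (subst measure_completion, simp, subst content_cbox) (auto simp: inner_add_left inner_Basis)
  moreover have "(\<Prod>i\<in>Basis. (One + \<epsilon> *\<^sub>R b) \<bullet> i) = (\<Prod>i\<in>Basis. if i = b then 1 + \<epsilon> else 1)"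
    using b by (intro prod.cong) (auto simp: inner_add_left inner_Basis)
  ultimately show ?thesis using b by simp
qed

lemma cube_in_compact_convex_sets: "cbox 0 One \<in> compact_convex_sets"
  by (simp add: compact_convex_sets_def)

text \<open>
  Elongating the cube along \<open>b\<close> by \<open>\<epsilon>\<close> adds volume \<open>\<epsilon>\<close>; compare with \<open>volume_derivative\<close>.
\<close>

lemma mixed_volume_edge_cube:
  fixes b :: "real ^ 'n::finite"
  assumes b: "b \<in> Basis"
  shows "real CARD('n) * mixed_volume (edge b # replicate (CARD('n) - 1) (cbox 0 One)) = 1"
proof -
  let ?q = "\<lambda>\<epsilon>. (measure lebesgue (cbox 0 One + (*\<^sub>R) \<epsilon> ` edge b) - measure lebesgue (cbox 0 One :: (real^'n) set)) / \<epsilon>"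
  have "\<forall>\<^sub>F \<epsilon> in at_right 0. ?q \<epsilon> = 1"
    using measure_elongated_cube[OF b] by (intro eventually_at_right_less[THEN eventually_mono]) (auto simp: measure_cube)
  then have "(?q \<longlongrightarrow> 1) (at_right 0)" by (rule tendsto_eventually)
  moreover have "(?q \<longlongrightarrow> real CARD('n) * mixed_volume (edge b # replicate (CARD('n) - 1) (cbox 0 One))) (at_right 0)"
    by (intro volume_derivative cube_in_compact_convex_sets edge_in_compact_convex_sets)
  ultimately show ?thesis using tendsto_unique trivial_limit_at_right_real by blast
qed

text \<open>
  In the expansion of the volume \<open>1\<close> of the cube, every nonzero term equals this mixed volume.
\<close>

lemma mixed_volume_edges_pos:
  fixes bs :: "(real ^ 'n::finite) list"
  assumes bs: "distinct bs" "set bs = Basis"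
  shows "0 < mixed_volume (map edge bs)"
proof -
  let ?n = "CARD('n)" and ?Ks = "map edge bs"
  have len: "length bs = ?n" using distinct_card[OF bs(1)] bs(2) by simp
  have Ks: "length ?Ks = ?n" "set ?Ks \<subseteq> compact_convex_sets"
    using len edge_in_compact_convex_sets by auto
  have "(\<Sum>i<?n. (*\<^sub>R) 1 ` (?Ks ! i)) = (\<Sum>i<?n. edge (bs ! i))"
    using len by (intro sum.cong) auto
  also have "\<dots> = (\<Sum>b\<in>Basis. edge b)"
    using sum.reindex_bij_betw[OF bij_betw_nth[OF bs(1) refl refl], of edge] len bs(2) by simp
  finally have "1 = measure lebesgue (\<Sum>i<?n. (*\<^sub>R) 1 ` (?Ks ! i))"
    by (simp add: measure_cube flip: cube_eq_sum_edges)
  then have one: "1 = (\<Sum>is | length is = ?n \<and> set is \<subseteq> {..<?n}. mixed_volume (map ((!) ?Ks) is))"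
    using mixed_volume_expand[OF Ks, of "\<lambda>_. 1"] by (simp add: map_replicate_const)
  have "mixed_volume (map ((!) ?Ks) is) = 0"
    if v: "mixed_volume ?Ks = 0" and "is": "length is = ?n" "set is \<subseteq> {..<?n}" for "is"
  proof -
    let ?cs = "map ((!) bs) is"
    have eq: "map ((!) ?Ks) is = map edge ?cs" using "is" len by auto
    have sub: "set ?cs \<subseteq> Basis" using "is" len bs(2) nth_mem by fastforce
    show ?thesis
    proof (cases "set ?cs = Basis")
      case True
      then have "distinct ?cs" using "is" by (intro card_distinct) simp
      then have "mset ?cs = mset bs" using True bs set_eq_iff_mset_eq_distinct by blast
      then have "mset (map edge ?cs) = mset ?Ks" by (metis mset_map)
      then show ?thesis unfolding eq using mixed_volume_sym[OF Ks] v by metis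
    next
      case False
      then obtain b where "b \<in> Basis" "b \<notin> set ?cs" using sub by blast
      then show ?thesis unfolding eq using "is" sub by (intro mixed_volume_edges_zero) auto
    qed
  qed
  then have "mixed_volume ?Ks \<noteq> 0" using one by (auto simp: sum.neutral)
  then show ?thesis using mixed_volume_nonneg[OF Ks] by simp
qed

text \<open>
  Apply the inequality to the edges of the cube thickened by \<open>\<delta> B\<close>, and to the cube itself, and let
  \<open>\<delta>\<close> tend to \<open>0\<close>. With \<open>v\<close> the mixed volume of the edges, the limit reads
  \<open>v * 1 \<le> c * (1 / n) * v\<close>.
\<close>

lemma bezout_constant_lower_bound:
  assumes c: "c < real CARD('n::finite)"
    and bezout: "\<And>(L :: (real ^ 'n) set) Ls K. \<lbrakk>L \<in> convex_bodies; set Ls \<subseteq> convex_bodies;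
       length Ls = CARD('n) - 1; K \<in> convex_bodies\<rbrakk> \<Longrightarrow>
       mixed_volume (L # Ls) * measure lebesgue K
          \<le> c * mixed_volume (L # replicate (CARD('n) - 1) K) * mixed_volume (Ls @ [K])"
  shows False
proof -
  let ?n = "CARD('n)" and ?B = "cball (0::real^'n) 1" and ?Q = "cbox 0 One :: (real^'n) set"
  obtain bs :: "(real^'n) list" where bs: "distinct bs" "set bs = Basis"
    using finite_distinct_list[OF finite_Basis] by blast
  have lenbs: "length bs = ?n" using distinct_card[OF bs(1)] bs(2) by simp
  then obtain b cs where bcs: "bs = b # cs" by (cases bs) auto
  have b: "b \<in> Basis" and len: "Suc (length cs) = ?n" using bs lenbs bcs by auto
  let ?L = "edge b" and ?Ls = "map edge cs"
  define v where "v = mixed_volume (?L # ?Ls)"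
  have v: "0 < v" using mixed_volume_edges_pos[OF bs] by (simp add: v_def bcs)
  have B: "?B \<in> compact_convex_sets" by (rule cball_in_compact_convex_sets) simp
  have Ls: "Suc (length ?Ls) = ?n" "set ?Ls \<subseteq> compact_convex_sets"
    using len edge_in_compact_convex_sets by auto
  note Q = cube_in_compact_convex_sets
  have Qb: "?Q \<in> convex_bodies"
    by (simp add: convex_bodies_def interior_cbox box_ne_empty)
  let ?p = "\<lambda>\<delta> K. K + (*\<^sub>R) \<delta> ` ?B"
  have body: "?p \<delta> K \<in> convex_bodies" if K: "K \<in> compact_convex_sets" and d: "0 < \<delta>" for K \<delta>
  proof -
    have pK: "?p \<delta> K \<in> compact_convex_sets"
      by (rule plus_in_compact_convex_sets[OF K scaleR_in_compact_convex_sets[OF B]])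
    obtain x where x: "x \<in> K" using K by (auto simp: compact_convex_sets_def)
    have "cball x \<delta> \<subseteq> ?p \<delta> K"
    proof
      fix y assume "y \<in> cball x \<delta>"
      then have "x + (y - x) \<in> K + cball 0 \<delta>"
        using x by (intro set_plus_intro) (auto simp: dist_norm norm_minus_commute)
      then show "y \<in> ?p \<delta> K" using d by (simp add: scaleR_cball)
    qed
    then have "x \<in> interior (?p \<delta> K)" using d by (meson mem_interior_cball)
    then show ?thesis using pK by (auto simp: convex_bodies_def compact_convex_sets_def)
  qed
  let ?F = "\<lambda>\<delta>. mixed_volume (map (?p \<delta>) (?L # ?Ls) @ [])"
  let ?G = "\<lambda>\<delta>. mixed_volume (map (?p \<delta>) [?L] @ replicate (?n - 1) ?Q)"
  let ?H = "\<lambda>\<delta>. mixed_volume (map (?p \<delta>) ?Ls @ [?Q])"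
  have "?F \<delta> * measure lebesgue ?Q \<le> c * ?G \<delta> * ?H \<delta>" if d: "0 < \<delta>" for \<delta>
  proof -
    have "mixed_volume (?p \<delta> ?L # map (?p \<delta>) ?Ls) * measure lebesgue ?Q \<le>
        c * mixed_volume (?p \<delta> ?L # replicate (?n - 1) ?Q) * mixed_volume (map (?p \<delta>) ?Ls @ [?Q])"
      by (rule bezout) (use body[OF edge_in_compact_convex_sets d] Qb len in auto)
    then show ?thesis by simp
  qed
  then have ev: "\<forall>\<^sub>F \<delta> in at_right 0. ?F \<delta> * measure lebesgue ?Q \<le> c * ?G \<delta> * ?H \<delta>"
    by (intro eventually_at_right_less[THEN eventually_mono]) auto
  have F: "(?F \<longlongrightarrow> mixed_volume ((?L # ?Ls) @ [])) (at_right 0)"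
    using Ls B edge_in_compact_convex_sets by (intro mixed_volume_perturb) auto
  have G: "(?G \<longlongrightarrow> mixed_volume ([?L] @ replicate (?n - 1) ?Q)) (at_right 0)"
    using Q B edge_in_compact_convex_sets by (intro mixed_volume_perturb) auto
  have H: "(?H \<longlongrightarrow> mixed_volume (?Ls @ [?Q])) (at_right 0)"
    using Ls Q B by (intro mixed_volume_perturb) auto
  have "mixed_volume ((?L # ?Ls) @ []) * measure lebesgue ?Q \<le>
     c * mixed_volume ([?L] @ replicate (?n - 1) ?Q) * mixed_volume (?Ls @ [?Q])"
    by (rule tendsto_le[OF _ _ _ ev]) (intro trivial_limit_at_right_real tendsto_mult tendsto_const F G H)+
  moreover have "mixed_volume (?Ls @ [?Q]) = v"
  proof -
    have "mixed_volume (?Ls @ [?Q]) = mixed_volume (?Q # ?Ls)"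
      using Ls Q by (intro mixed_volume_sym) auto
    also have "\<dots> = (\<Sum>a\<in>Basis. mixed_volume (edge a # ?Ls))"
      unfolding cube_eq_sum_edges using mixed_volume_sum[OF Ls finite_Basis] edge_in_compact_convex_sets by blast
    also have "\<dots> = (\<Sum>a\<in>Basis. if a = b then v else 0)"
    proof (intro sum.cong refl)
      fix a :: "real^'n" assume a: "a \<in> Basis"
      show "mixed_volume (edge a # ?Ls) = (if a = b then v else 0)"
        using mixed_volume_edges_zero[of "a # cs" b] a b bs len by (auto simp: v_def bcs)
    qed
    also have "\<dots> = v" using b by simp
    finally show ?thesis .
  qed
  ultimately have "v \<le> c * mixed_volume (?L # replicate (?n - 1) ?Q) * v"
    by (simp add: measure_cube v_def)
  then have "1 \<le> c * mixed_volume (?L # replicate (?n - 1) ?Q)" using v by simp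
  moreover have pos: "0 < mixed_volume (?L # replicate (?n - 1) ?Q)"
    using mixed_volume_edge_cube[OF b] by (metis of_nat_0_less_iff zero_less_card_finite zero_less_mult_pos zero_less_one)
  then have "c * mixed_volume (?L # replicate (?n - 1) ?Q) < real ?n * mixed_volume (?L # replicate (?n - 1) ?Q)"
    using c by (intro mult_strict_right_mono)
  ultimately show False using mixed_volume_edge_cube[OF b] by simp
qed

lemma convex_bodies_subset: "convex_bodies \<subseteq> compact_convex_sets"
  by (auto simp: convex_bodies_def compact_convex_sets_def)

theorem mainTheorem6:
  shows
    "(\<forall>(L :: (real ^ 'n::finite) set) Ls K.
        L \<in> compact_convex_sets \<and> set Ls \<subseteq> compact_convex_sets \<and> length Ls = CARD('n) - 1 \<and>
        K \<in> compact_convex_sets \<longrightarrow>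
        mixed_volume (L # Ls) * measure lebesgue K
          \<le> real CARD('n) * mixed_volume (L # replicate (CARD('n) - 1) K) * mixed_volume (Ls @ [K])) \<and>
     (\<forall>c < real CARD('n). \<not> (\<forall>(L :: (real ^ 'n) set) Ls K.
        L \<in> compact_convex_sets \<and> set Ls \<subseteq> compact_convex_sets \<and> length Ls = CARD('n) - 1 \<and>
        K \<in> compact_convex_sets \<longrightarrow>
        mixed_volume (L # Ls) * measure lebesgue K
          \<le> c * mixed_volume (L # replicate (CARD('n) - 1) K) * mixed_volume (Ls @ [K]))) \<and>
     (\<forall>c < real CARD('n). \<not> (\<forall>(L :: (real ^ 'n) set) Ls K.
        L \<in> convex_bodies \<and> set Ls \<subseteq> convex_bodies \<and> length Ls = CARD('n) - 1 \<and>
        K \<in> convex_bodies \<longrightarrow>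
        mixed_volume (L # Ls) * measure lebesgue K
          \<le> c * mixed_volume (L # replicate (CARD('n) - 1) K) * mixed_volume (Ls @ [K])))"
proof (intro conjI allI impI notI)
  fix L K :: "(real ^ 'n) set" and Ls :: "(real ^ 'n) set list"
  assume A: "L \<in> compact_convex_sets \<and> set Ls \<subseteq> compact_convex_sets \<and> length Ls = CARD('n) - 1 \<and>
        K \<in> compact_convex_sets"
  then have len: "Suc (length Ls) = CARD('n)" by simp
  have "mixed_volume (Ls @ [K]) = mixed_volume (K # Ls)"
    using A len by (intro mixed_volume_sym) auto
  then show "mixed_volume (L # Ls) * measure lebesgue K
      \<le> real CARD('n) * mixed_volume (L # replicate (CARD('n) - 1) K) * mixed_volume (Ls @ [K])"
    using mixed_volume_bezout[of K L Ls] A len by simp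
next
  fix c :: real
  assume c: "c < real CARD('n)" and "\<forall>(L :: (real ^ 'n) set) Ls K.
        L \<in> compact_convex_sets \<and> set Ls \<subseteq> compact_convex_sets \<and> length Ls = CARD('n) - 1 \<and>
        K \<in> compact_convex_sets \<longrightarrow>
        mixed_volume (L # Ls) * measure lebesgue K
          \<le> c * mixed_volume (L # replicate (CARD('n) - 1) K) * mixed_volume (Ls @ [K])"
  then show False
    using convex_bodies_subset by (intro bezout_constant_lower_bound[OF c]) blast
next
  fix c :: real
  assume c: "c < real CARD('n)" and "\<forall>(L :: (real ^ 'n) set) Ls K.
        L \<in> convex_bodies \<and> set Ls \<subseteq> convex_bodies \<and> length Ls = CARD('n) - 1 \<and>
        K \<in> convex_bodies \<longrightarrow>
        mixed_volume (L # Ls) * measure lebesgue K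
          \<le> c * mixed_volume (L # replicate (CARD('n) - 1) K) * mixed_volume (Ls @ [K])"
  then show False
    by (intro bezout_constant_lower_bound[OF c]) blast
qed


end
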